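(* Let $K_1,K_2:[0,1]\times[0,1]\to\mathbb{R}$ be deterministic kernels and let $(\theta_n)_{n\in\mathbb{N}}$ be a sequence of random kernels on $[0,1]^2$ with $\theta_n\in L^\infty([0,1]^2)$. Assume that one of the following two sets of hypotheses holds (all conditions are spelled out in the context): (J1) $K_1,K_2$ satisfy (H1), and $(\theta_n)$ satisfies (H2) and (H3); (J2) $K_1,K_2$ satisfy (H1'), and $(\theta_n)$ satisfies (H2), (H3) and (H4). For $(s,t)\in[0,1]^2$ put $$X_n(s,t)=\int_0^1\int_0^1 K_1(s,u)K_2(t,v)\,\theta_n(u,v)\,du\,dv ,\qquad W^{K_1,K_2}_{s,t}=\int_0^1\int_0^1K_1(s,u)K_2(t,v)\,dB_{u,v},$$ where $B=\{B_{u,v},(u,v)\in[0,1]^2\}$ is a standard Brownian sheet. Then the laws of the processes $\{X_n(s,t),(s,t)\in[0,1]^2\}$ converge weakly, in the space $\mathcal{C}([0,1]^2)$ of continuous functions, to the law of $\{W^{K_1,K_2}_{s,t},(s,t)\in[0,1]^2\}$ as $n\to\infty$.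
   Context: The processes $\theta_n$ are jointly measurable random functions on $[0,1]^2$, defined on a probability space $(\Omega,\mathcal F,P)$ with expectation $E$, with bounded trajectories. The Brownian sheet $B$ may live on another probability space. For a function $X$ of two variables and $s\le s'$, $t\le t'$, write $\Delta_{s,t}X(s',t')=X(s',t')-X(s',t)-X(s,t')+X(s,t)$. $W^{K_1,K_2}$ is the centered Gaussian process with covariance $E[W_{s_1,s_2}W_{s_1',s_2'}]=\prod_{i=1}^2\int_0^1K_i(s_i,u)K_i(s_i',u)\,du$ (its continuous version is considered). **(H1)** For $i=1,2$: (i) $K_i$ is measurable and $K_i(0,r)=0$ for almost every $r\in[0,1]$; (ii) there exist an increasing continuous function $G_i:[0,1]\to\mathbb{R}$ and $\alpha_i>1$ such that for all $0\le s<s'\le1$, $\int_0^1(K_i(s',r)-K_i(s,r))^2dr\le (G_i(s')-G_i(s))^{\alpha_i}$. **(H1')** For $i=1,2$: (i) $K_i$ is measurable and $K_i(0,r)=0$ for almost every $r\in[0,1]$; (ii') there exist an increasing continuous function $G_i:[0,1]\to\mathbb{R}$ and $0<\rho_i\le1$ such that for all $0\le s<s'\le1$, $\int_0^1(K_i(s',r)-K_i(s,r))^2dr\le (G_i(s')-G_i(s))^{\rho_i}$; (iii) there exist constants $M_i>0$, $\beta_i>0$ such that for all $0\le s<s'\le1$ and $0\le s_0<s_0'\le1$, $\int_{s_0}^{s_0'}(K_i(s',r)-K_i(s,r))^2dr\le M_i(s_0'-s_0)^{\beta_i}$. **(H2)** The processes $\zeta_n(s,t)=\int_0^t\int_0^s\theta_n(x,y)\,dx\,dy$,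 $(s,t)\in[0,1]^2$, converge in law in $\mathcal{C}([0,1]^2)$, as $n\to\infty$, to the Brownian sheet. **(H3)** There is a constant $C$ (independent of $n,f,g$) such that for any $f,g\in L^2([0,1])$ and all $n$, $E\left(\int_{[0,1]^2}f(x)g(y)\theta_n(x,y)\,dx\,dy\right)^2\le C\int_{[0,1]^2}f(x)^2g(y)^2\,dx\,dy$. **(H4)** (used when (H1') holds, with $G_i,\rho_i,M_i,\beta_i$ from (H1')). For $0\le s<s'\le1$, $0\le t<t'\le 1$ define $$Y_n(s_0,t_0)=\int_{[0,s_0]\times[0,t_0]}(K_1(s',x)-K_1(s,x))(K_2(t',y)-K_2(t,y))\,\theta_n(x,y)\,dx\,dy .$$ There exist an even number $m>\frac{4}{\min\{\rho_1,\rho_2\}}$, a parameter $\gamma\in(0,1)$ (depending only on $\beta_1,\beta_2$) and a constant $C_{m,M}$ (depending only on $m,M_1,M_2$; in particular not on $n,s,s',t,t',s_0,s_0',t_0,t_0'$) such that for all $n$, all $0\le s<s'\le1$, $0\le t<t'\le 1$, and all $s_0,s_0',t_0,t_0'$ in $(0,1]$ with $0<s_0<s_0'<2s_0$, $0<t_0<t_0'<2t_0$, $$E\left[\left(\Delta_{s_0,t_0}Y_n(s_0',t_0')\right)^m\right]\le C_{m,M}\,(G_1(s')-G_1(s))^{\frac{m\rho_1}{4}}(G_2(t')-G_2(t))^{\frac{m\rho_2}{4}}\left[(s_0'-s_0)(t_0'-t_0)\right]^{m\gamma}.$$ *)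

theory Defs
  imports "HOL-Probability.Probability"
begin

(* A random function on [0,1]^2 is a map X :: 'a => real * real => real on the sample space;
   only its values at points of the unit square matter. *)

abbreviation unit_square :: "(real \<times> real) set" where
  "unit_square \<equiv> {0..1} \<times> {0..1}"

definition rect_incr :: "(real \<times> real \<Rightarrow> real) \<Rightarrow> real \<Rightarrow> real \<Rightarrow> real \<Rightarrow> real \<Rightarrow> real" where
  "rect_incr X s t s' t' = X (s', t') - X (s', t) - X (s, t') + X (s, t)"


section \<open>Convergence in law in the space of continuous functions on the unit square\<close>

(* Elements of this metric space are extensional: they take the value undefined outside the
   square, which is why trajectories are restricted to the square below. *)

definition C_square :: "(real \<times> real \<Rightarrow> real) metric" where
  "C_square = cfunspace (top_of_set unit_square) euclidean_metric"

lemma mspace_C_square: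
  "mspace C_square = {f \<in> extensional unit_square. continuous_on unit_square f}"
proof -
  have "bounded (f ` unit_square)" if "continuous_on unit_square f" for f :: "real \<times> real \<Rightarrow> real"
    using that by (intro compact_imp_bounded compact_continuous_image compact_Times) auto
  then show ?thesis
    unfolding C_square_def by (auto simp: mtopology_of_def)
qed

definition borel_C :: "(real \<times> real \<Rightarrow> real) measure" where
  "borel_C = sigma (mspace C_square) {U. openin (mtopology_of C_square) U}"

definition trajectory :: "('a \<Rightarrow> real \<times> real \<Rightarrow> real) \<Rightarrow> 'a \<Rightarrow> real \<times> real \<Rightarrow> real" where
  "trajectory X \<omega> = restrict (X \<omega>) unit_square"

definition law_C :: "'a measure \<Rightarrow> ('a \<Rightarrow> real \<times> real \<Rightarrow> real) \<Rightarrow> (real \<times> real \<Rightarrow> real) measure" where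
  "law_C M X = distr M borel_C (trajectory X)"

definition weak_conv_C ::
  "(nat \<Rightarrow> (real \<times> real \<Rightarrow> real) measure) \<Rightarrow> (real \<times> real \<Rightarrow> real) measure \<Rightarrow> bool" where
  "weak_conv_C \<mu>s \<mu> \<longleftrightarrow>
     (\<forall>F. continuous_map (mtopology_of C_square) euclideanreal F \<and> bounded (F ` mspace C_square)
        \<longrightarrow> (\<lambda>n. LINT x|\<mu>s n. F x) \<longlonglongrightarrow> (LINT x|\<mu>. F x))"

(* The measurability clauses include that all trajectories are continuous on the square. *)

definition converges_in_law_C ::
  "'a measure \<Rightarrow> (nat \<Rightarrow> 'a \<Rightarrow> real \<times> real \<Rightarrow> real) \<Rightarrow>
   'b measure \<Rightarrow> ('b \<Rightarrow> real \<times> real \<Rightarrow> real) \<Rightarrow> bool" where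
  "converges_in_law_C M X N Z \<longleftrightarrow>
     (\<forall>n. trajectory (X n) \<in> M \<rightarrow>\<^sub>M borel_C) \<and> trajectory Z \<in> N \<rightarrow>\<^sub>M borel_C \<and>
     weak_conv_C (\<lambda>n. law_C M (X n)) (law_C N Z)"


section \<open>Brownian sheet and Wiener integral\<close>

(* The point mass at 0 counts as a centered Gaussian law. *)

definition centered_gaussian :: "'a measure \<Rightarrow> ('a \<Rightarrow> real) \<Rightarrow> bool" where
  "centered_gaussian M X \<longleftrightarrow> X \<in> borel_measurable M \<and>
     ((AE \<omega> in M. X \<omega> = 0) \<or> (\<exists>\<sigma>>0. distributed M lborel X (normal_density 0 \<sigma>)))"

definition centered_gaussian_process ::
  "'a measure \<Rightarrow> ('a \<Rightarrow> real \<times> real \<Rightarrow> real) \<Rightarrow> bool" where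
  "centered_gaussian_process M X \<longleftrightarrow>
     (\<forall>A c. finite A \<and> A \<subseteq> unit_square \<longrightarrow> centered_gaussian M (\<lambda>\<omega>. \<Sum>p\<in>A. c p * X \<omega> p))"

definition brownian_sheet :: "'a measure \<Rightarrow> ('a \<Rightarrow> real \<times> real \<Rightarrow> real) \<Rightarrow> bool" where
  "brownian_sheet M B \<longleftrightarrow>
     centered_gaussian_process M B \<and>
     (\<forall>s\<in>{0..1}. \<forall>t\<in>{0..1}. \<forall>s'\<in>{0..1}. \<forall>t'\<in>{0..1}.
        (LINT \<omega>|M. B \<omega> (s, t) * B \<omega> (s', t')) = min s s' * min t t') \<and>
     (\<forall>\<omega>\<in>space M. continuous_on unit_square (B \<omega>))"

(* A step function is given by a list of entries (c, a, b, a', b'), each standing for c times the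
   indicator function of the rectangle (a,b] x (a',b']. *)

type_synonym step = "(real \<times> real \<times> real \<times> real \<times> real) list"

definition valid_step :: "step \<Rightarrow> bool" where
  "valid_step S \<longleftrightarrow>
     (\<forall>(c, a, b, a', b') \<in> set S. 0 \<le> a \<and> a \<le> b \<and> b \<le> 1 \<and> 0 \<le> a' \<and> a' \<le> b' \<and> b' \<le> 1)"

definition step_fun :: "step \<Rightarrow> real \<times> real \<Rightarrow> real" where
  "step_fun S p = (\<Sum>(c, a, b, a', b') \<leftarrow> S. c * indicator ({a<..b} \<times> {a'<..b'}) p)"

definition step_integral :: "(real \<times> real \<Rightarrow> real) \<Rightarrow> step \<Rightarrow> real" where
  "step_integral x S = (\<Sum>(c, a, b, a', b') \<leftarrow> S. c * rect_incr x a a' b b')"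

(* Z is a version of the Wiener integral of f against B: the limit in L^2(M) of the integrals of
   step functions tending to f in L^2 of the square. *)

definition is_wiener_integral ::
  "'a measure \<Rightarrow> ('a \<Rightarrow> real \<times> real \<Rightarrow> real) \<Rightarrow> (real \<times> real \<Rightarrow> real) \<Rightarrow> ('a \<Rightarrow> real) \<Rightarrow> bool" where
  "is_wiener_integral M B f Z \<longleftrightarrow>
     set_borel_measurable lborel unit_square f \<and> Z \<in> borel_measurable M \<and>
     (\<exists>S. (\<forall>k. valid_step (S k)) \<and>
        (\<lambda>k. \<integral>\<^sup>+p\<in>unit_square. ennreal ((f p - step_fun (S k) p)\<^sup>2) \<partial>lborel) \<longlonglongrightarrow> 0 \<and>
        (\<lambda>k. \<integral>\<^sup>+\<omega>. ennreal ((Z \<omega> - step_integral (B \<omega>) (S k))\<^sup>2) \<partial>M) \<longlonglongrightarrow> 0)"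

definition continuous_version_W ::
  "'a measure \<Rightarrow> ('a \<Rightarrow> real \<times> real \<Rightarrow> real) \<Rightarrow> (real \<Rightarrow> real \<Rightarrow> real) \<Rightarrow> (real \<Rightarrow> real \<Rightarrow> real) \<Rightarrow>
   ('a \<Rightarrow> real \<times> real \<Rightarrow> real) \<Rightarrow> bool" where
  "continuous_version_W M B K1 K2 W \<longleftrightarrow>
     (\<forall>s\<in>{0..1}. \<forall>t\<in>{0..1}.
        is_wiener_integral M B (\<lambda>(u, v). K1 s u * K2 t v) (\<lambda>\<omega>. W \<omega> (s, t))) \<and>
     (\<forall>\<omega>\<in>space M. continuous_on unit_square (W \<omega>))"


section \<open>The random kernels and the hypotheses\<close>

definition random_kernels :: "'a measure \<Rightarrow> (nat \<Rightarrow> 'a \<Rightarrow> real \<Rightarrow> real \<Rightarrow> real) \<Rightarrow> bool" where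
  "random_kernels M \<theta> \<longleftrightarrow>
     (\<forall>n. (\<lambda>(\<omega>, x, y). \<theta> n \<omega> x y) \<in> borel_measurable (M \<Otimes>\<^sub>M restrict_space borel unit_square) \<and>
          (\<forall>\<omega>\<in>space M. \<exists>c. \<forall>x\<in>{0..1}. \<forall>y\<in>{0..1}. \<bar>\<theta> n \<omega> x y\<bar> \<le> c))"

definition X_proc ::
  "(real \<Rightarrow> real \<Rightarrow> real) \<Rightarrow> (real \<Rightarrow> real \<Rightarrow> real) \<Rightarrow> (nat \<Rightarrow> 'a \<Rightarrow> real \<Rightarrow> real \<Rightarrow> real) \<Rightarrow>
   nat \<Rightarrow> 'a \<Rightarrow> real \<times> real \<Rightarrow> real" where
  "X_proc K1 K2 \<theta> n \<omega> = (\<lambda>(s, t).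
     LINT v:{0..1}|lborel. (LINT u:{0..1}|lborel. K1 s u * K2 t v * \<theta> n \<omega> u v))"

definition zeta_proc ::
  "(nat \<Rightarrow> 'a \<Rightarrow> real \<Rightarrow> real \<Rightarrow> real) \<Rightarrow> nat \<Rightarrow> 'a \<Rightarrow> real \<times> real \<Rightarrow> real" where
  "zeta_proc \<theta> n \<omega> = (\<lambda>(s, t).
     LINT y:{0..t}|lborel. (LINT x:{0..s}|lborel. \<theta> n \<omega> x y))"

(* In all hypotheses below, integrability is required together with each bound, because the
   integral of a non-integrable function is 0 by convention. *)

definition kernel_basic :: "(real \<Rightarrow> real \<Rightarrow> real) \<Rightarrow> bool" where
  "kernel_basic K \<longleftrightarrow>
     (\<lambda>(s, r). K s r) \<in> borel_measurable (restrict_space borel unit_square) \<and>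
     (AE r in lborel. r \<in> {0..1} \<longrightarrow> K 0 r = 0)"

definition increment_bound ::
  "(real \<Rightarrow> real \<Rightarrow> real) \<Rightarrow> (real \<Rightarrow> real) \<Rightarrow> real \<Rightarrow> bool" where
  "increment_bound K G a \<longleftrightarrow>
     mono_on {0..1} G \<and> continuous_on {0..1} G \<and>
     (\<forall>s s'. 0 \<le> s \<and> s < s' \<and> s' \<le> 1 \<longrightarrow>
        set_integrable lborel {0..1} (\<lambda>r. (K s' r - K s r)\<^sup>2) \<and>
        (LINT r:{0..1}|lborel. (K s' r - K s r)\<^sup>2) \<le> (G s' - G s) powr a)"

definition H1 :: "(real \<Rightarrow> real \<Rightarrow> real) \<Rightarrow> bool" where
  "H1 K \<longleftrightarrow> kernel_basic K \<and> (\<exists>G \<alpha>. \<alpha> > 1 \<and> increment_bound K G \<alpha>)"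

definition H1' ::
  "(real \<Rightarrow> real \<Rightarrow> real) \<Rightarrow> (real \<Rightarrow> real) \<Rightarrow> real \<Rightarrow> real \<Rightarrow> real \<Rightarrow> bool" where
  "H1' K G \<rho> C \<beta> \<longleftrightarrow>
     kernel_basic K \<and> 0 < \<rho> \<and> \<rho> \<le> 1 \<and> increment_bound K G \<rho> \<and> C > 0 \<and> \<beta> > 0 \<and>
     (\<forall>s s' s0 s0'. 0 \<le> s \<and> s < s' \<and> s' \<le> 1 \<and> 0 \<le> s0 \<and> s0 < s0' \<and> s0' \<le> 1 \<longrightarrow>
        set_integrable lborel {s0..s0'} (\<lambda>r. (K s' r - K s r)\<^sup>2) \<and>
        (LINT r:{s0..s0'}|lborel. (K s' r - K s r)\<^sup>2) \<le> C * (s0' - s0) powr \<beta>)"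

definition H2 ::
  "'a measure \<Rightarrow> (nat \<Rightarrow> 'a \<Rightarrow> real \<Rightarrow> real \<Rightarrow> real) \<Rightarrow>
   'b measure \<Rightarrow> ('b \<Rightarrow> real \<times> real \<Rightarrow> real) \<Rightarrow> bool" where
  "H2 M \<theta> N B \<longleftrightarrow> converges_in_law_C M (zeta_proc \<theta>) N B"

definition in_L2 :: "(real \<Rightarrow> real) \<Rightarrow> bool" where
  "in_L2 f \<longleftrightarrow> set_borel_measurable lborel {0..1} f \<and> set_integrable lborel {0..1} (\<lambda>x. (f x)\<^sup>2)"

definition H3 :: "'a measure \<Rightarrow> (nat \<Rightarrow> 'a \<Rightarrow> real \<Rightarrow> real \<Rightarrow> real) \<Rightarrow> bool" where
  "H3 M \<theta> \<longleftrightarrow>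
     (\<exists>C. \<forall>f g n. in_L2 f \<and> in_L2 g \<longrightarrow>
        integrable M (\<lambda>\<omega>. (LINT p:unit_square|lborel. f (fst p) * g (snd p) * \<theta> n \<omega> (fst p) (snd p))\<^sup>2) \<and>
        (LINT \<omega>|M. (LINT p:unit_square|lborel. f (fst p) * g (snd p) * \<theta> n \<omega> (fst p) (snd p))\<^sup>2)
          \<le> C * (LINT p:unit_square|lborel. (f (fst p))\<^sup>2 * (g (snd p))\<^sup>2))"

definition Y_proc ::
  "(real \<Rightarrow> real \<Rightarrow> real) \<Rightarrow> (real \<Rightarrow> real \<Rightarrow> real) \<Rightarrow> (nat \<Rightarrow> 'a \<Rightarrow> real \<Rightarrow> real \<Rightarrow> real) \<Rightarrow>
   real \<Rightarrow> real \<Rightarrow> real \<Rightarrow> real \<Rightarrow> nat \<Rightarrow> 'a \<Rightarrow> real \<times> real \<Rightarrow> real" where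
  "Y_proc K1 K2 \<theta> s s' t t' n \<omega> = (\<lambda>(s0, t0).
     LINT p:{0..s0} \<times> {0..t0}|lborel.
       (K1 s' (fst p) - K1 s (fst p)) * (K2 t' (snd p) - K2 t (snd p)) * \<theta> n \<omega> (fst p) (snd p))"

definition H4 ::
  "'a measure \<Rightarrow> (nat \<Rightarrow> 'a \<Rightarrow> real \<Rightarrow> real \<Rightarrow> real) \<Rightarrow>
   (real \<Rightarrow> real \<Rightarrow> real) \<Rightarrow> (real \<Rightarrow> real \<Rightarrow> real) \<Rightarrow>
   (real \<Rightarrow> real) \<Rightarrow> (real \<Rightarrow> real) \<Rightarrow> real \<Rightarrow> real \<Rightarrow> bool" where
  "H4 M \<theta> K1 K2 G1 G2 \<rho>1 \<rho>2 \<longleftrightarrow>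
     (\<exists>(m::nat) \<gamma> C. even m \<and> real m > 4 / min \<rho>1 \<rho>2 \<and> 0 < \<gamma> \<and> \<gamma> < 1 \<and>
       (\<forall>n s s' t t' s0 s0' t0 t0'.
          0 \<le> s \<and> s < s' \<and> s' \<le> 1 \<and> 0 \<le> t \<and> t < t' \<and> t' \<le> 1 \<and>
          0 < s0 \<and> s0 < s0' \<and> s0' < 2 * s0 \<and> s0' \<le> 1 \<and>
          0 < t0 \<and> t0 < t0' \<and> t0' < 2 * t0 \<and> t0' \<le> 1 \<longrightarrow>
          integrable M (\<lambda>\<omega>. (rect_incr (Y_proc K1 K2 \<theta> s s' t t' n \<omega>) s0 t0 s0' t0') ^ m) \<and>
          (LINT \<omega>|M. (rect_incr (Y_proc K1 K2 \<theta> s s' t t' n \<omega>) s0 t0 s0' t0') ^ m)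
            \<le> C * (G1 s' - G1 s) powr (real m * \<rho>1 / 4) * (G2 t' - G2 t) powr (real m * \<rho>2 / 4)
                * ((s0' - s0) * (t0' - t0)) powr (real m * \<gamma>)))"

end

theory Submission
  imports Defs
begin

text \<open>The trajectory \<open>X n\<close> is a bilinear functional of the kernels \<open>K1\<close>, \<open>K2\<close>, and for step kernels it is a
finite linear combination of values of \<open>\<zeta>\<^sub>n\<close>. So \<open>X n\<close> is compared with a map \<open>\<Phi>\<close> that depends
continuously on finitely many values of its argument: \<open>X n\<close> is replaced by its values on a finite mesh
(first error), and at each mesh point the two kernels are replaced by step functions (second error),
which turns \<open>X n\<close> into \<open>\<Phi> \<zeta>\<^sub>n\<close>. The limit \<open>W\<close> is approximated by \<open>\<Phi> B\<close> in the same way. If both errors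
are small in mean, uniformly in \<open>n\<close>, then the convergence in law of \<open>\<zeta>\<^sub>n\<close> to \<open>B\<close>, applied to \<open>\<Phi>\<close>,
passes to \<open>X n\<close> and \<open>W\<close> (\<open>convergence_by_step_maps\<close>).

For this argument the test functionals must make sense on step functions, which are not continuous.
Hence weak convergence is first reduced to functionals that are Lipschitz for a truncated
supremum distance on all functions (\<open>converges_in_law_lipschitz\<close>): a bounded continuous functional on the
space of continuous functions is an increasing limit of its Lipschitz lower envelopes, and the envelopes
extend to all functions by the same formula.

The second error is an \<open>L\<^sup>2\<close> estimate. For \<open>X n\<close> it is (H3), applied to both terms of
\<open>f \<otimes> g - f' \<otimes> g' = (f - f') \<otimes> g + f' \<otimes> (g - g')\<close>; for \<open>W\<close> it is the isometry of the Wiener integral on step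
functions. Step functions \<open>f'\<close>, \<open>g'\<close> of one variable close to \<open>f\<close>, \<open>g\<close> are slices of the planar step functions
that define the Wiener integral of \<open>f \<otimes> g\<close> (\<open>tensor_step_approx\<close>).

The first error is controlled by dyadic chaining in both parameters at once. A moment bound on
rectangular increments of order \<open>(\<Delta>G1)\<^bsup>a1\<^esup> (\<Delta>G2)\<^bsup>a2\<^esup>\<close> with \<open>a1, a2 > 1\<close> becomes, after the time change by
\<open>G1\<close> and \<open>G2\<close>, a bound by powers above one of the area of the rectangle; the number of dyadic cells of a level
is the inverse of the area of a cell, so the largest increments of the levels form a convergent
double series (\<open>equicontinuity_of_rect_moment\<close>). Under (H1), second moments suffice by (H3). Under (H1')
the exponent of the second moment is too small; there the moments of order \<open>m\<close> of (H4) are used, which control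
\<open>\<theta>\<close> only on rectangles \<open>[s0, s0'] \<times> [t0, t0']\<close> with \<open>s0' < 2 s0\<close> and \<open>t0' < 2 t0\<close>. The unit square is cut
into such rectangles along a geometric progression, and the factor \<open>[(s0' - s0) (t0' - t0)]\<^bsup>m\<gamma>\<^esup>\<close> makes the sum
converge (\<open>rect_moment_of_H4\<close>).\<close>

section \<open>Functionals that are Lipschitz for a truncated supremum distance\<close>

text \<open>Truncating inside the supremum makes the distance finite for arbitrary functions, so that a
continuous trajectory can be compared with a step function, and a limit in this distance is a
uniform limit on the square.\<close>

definition trunc_dist :: "(real \<times> real \<Rightarrow> real) \<Rightarrow> (real \<times> real \<Rightarrow> real) \<Rightarrow> real" where
  "trunc_dist x y = (SUP p\<in>unit_square. min 1 \<bar>x p - y p\<bar>)"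

definition trunc_lipschitz :: "real \<Rightarrow> ((real \<times> real \<Rightarrow> real) \<Rightarrow> real) \<Rightarrow> bool" where
  "trunc_lipschitz L H \<longleftrightarrow> 0 \<le> L \<and> (\<forall>x y. \<bar>H x - H y\<bar> \<le> L * trunc_dist x y)"

lemma unit_square_nonempty: "unit_square \<noteq> {}" by auto

lemma trunc_dist_le:
  assumes "\<And>p. p \<in> unit_square \<Longrightarrow> \<bar>x p - y p\<bar> \<le> r"
  shows "trunc_dist x y \<le> r"
  unfolding trunc_dist_def
  by (rule cSUP_least[OF unit_square_nonempty]) (use assms in \<open>force intro: min.coboundedI2\<close>)

lemma trunc_dist_ge:
  assumes "p \<in> unit_square"
  shows "min 1 \<bar>x p - y p\<bar> \<le> trunc_dist x y"
  unfolding trunc_dist_def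
  by (rule cSUP_upper[OF assms]) (auto intro!: bdd_aboveI2[of _ _ 1])

lemma trunc_dist_nonneg: "0 \<le> trunc_dist x y"
  using trunc_dist_ge[of "(0,0)" x y] by (auto intro: order_trans[rotated])

lemma trunc_dist_le_1: "trunc_dist x y \<le> 1"
  unfolding trunc_dist_def by (rule cSUP_least[OF unit_square_nonempty]) auto

lemma trunc_dist_sym: "trunc_dist x y = trunc_dist y x"
  unfolding trunc_dist_def by (simp add: abs_minus_commute)

lemma trunc_dist_triangle: "trunc_dist x z \<le> trunc_dist x y + trunc_dist y z"
  unfolding trunc_dist_def[of x z]
proof (rule cSUP_least[OF unit_square_nonempty])
  fix p assume p: "p \<in> unit_square"
  show "min 1 \<bar>x p - z p\<bar> \<le> trunc_dist x y + trunc_dist y z"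
    using trunc_dist_ge[OF p, of x y] trunc_dist_ge[OF p, of y z]
      abs_triangle_ineq[of "x p - y p" "y p - z p"] trunc_dist_nonneg[of x y] trunc_dist_nonneg[of y z]
    by (simp add: min_def split: if_splits)
qed

lemma trunc_dist_restrict [simp]: "trunc_dist (restrict x unit_square) y = trunc_dist x y"
  unfolding trunc_dist_def by (rule SUP_cong) auto

lemma trunc_dist_self [simp]: "trunc_dist x x = 0"
  using trunc_dist_le[of x x 0] trunc_dist_nonneg[of x x] by auto

lemma trunc_lipschitz_restrict:
  assumes "trunc_lipschitz L H" shows "H (restrict x unit_square) = H x"
proof -
  have "\<bar>H (restrict x unit_square) - H x\<bar> \<le> L * trunc_dist (restrict x unit_square) x"
    using assms unfolding trunc_lipschitz_def by blast
  then show ?thesis by simp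
qed

lemma trunc_lipschitz_bounded: "trunc_lipschitz L H \<Longrightarrow> \<bar>H x\<bar> \<le> \<bar>H (\<lambda>_. 0)\<bar> + L"
proof -
  assume "trunc_lipschitz L H"
  then have "\<bar>H x - H (\<lambda>_. 0)\<bar> \<le> L * trunc_dist x (\<lambda>_. 0)" "0 \<le> L"
    unfolding trunc_lipschitz_def by auto
  moreover have "L * trunc_dist x (\<lambda>_. 0) \<le> L * 1"
    by (rule mult_left_mono[OF trunc_dist_le_1 \<open>0 \<le> L\<close>])
  ultimately show ?thesis by linarith
qed

text \<open>Used twice: with \<open>f = 0\<close> it is the distance to \<open>A\<close>, and with \<open>f\<close> a bounded functional it is the
Lipschitz lower envelope of \<open>f\<close>. The infimum runs over \<open>A\<close> only, but the argument \<open>x\<close> is arbitrary.\<close>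

lemma trunc_lipschitz_infimum:
  assumes "A \<noteq> {}" "\<And>y. y \<in> A \<Longrightarrow> b \<le> f y" "0 \<le> k"
  shows "trunc_lipschitz k (\<lambda>x. INF y\<in>A. f y + k * trunc_dist x y)"
proof -
  have bdd: "bdd_below ((\<lambda>y. f y + k * trunc_dist x y) ` A)" for x
    by (rule bdd_belowI2[of _ b]) (use assms trunc_dist_nonneg in \<open>simp add: add_increasing2\<close>)
  have le: "(INF y\<in>A. f y + k * trunc_dist x y) \<le> (INF y\<in>A. f y + k * trunc_dist z y) + k * trunc_dist x z" for x z
  proof -
    have "(INF y\<in>A. f y + k * trunc_dist x y) - k * trunc_dist x z \<le> (INF y\<in>A. f y + k * trunc_dist z y)"
    proof (rule cINF_greatest[OF assms(1)])
      fix y assume "y \<in> A"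
      then have "(INF y\<in>A. f y + k * trunc_dist x y) \<le> f y + k * trunc_dist x y"
        by (rule cINF_lower[OF bdd])
      also have "\<dots> \<le> f y + k * (trunc_dist x z + trunc_dist z y)"
        using trunc_dist_triangle assms(3) by (intro add_left_mono mult_left_mono) auto
      finally show "(INF y\<in>A. f y + k * trunc_dist x y) - k * trunc_dist x z \<le> f y + k * trunc_dist z y"
        by (simp add: algebra_simps)
    qed
    then show ?thesis by simp
  qed
  show ?thesis
    unfolding trunc_lipschitz_def
  proof (intro conjI allI assms(3))
    fix x z show "\<bar>(INF y\<in>A. f y + k * trunc_dist x y) - (INF y\<in>A. f y + k * trunc_dist z y)\<bar> \<le> k * trunc_dist x z"
      using le[of x z] le[of z x] trunc_dist_sym[of x z] by (simp add: abs_le_iff)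
  qed
qed

section \<open>The space of continuous functions on the square\<close>

lemma openin_C_square_iff:
  "openin (mtopology_of C_square) U \<longleftrightarrow> U \<subseteq> mspace C_square \<and>
    (\<forall>x\<in>U. \<exists>r>0. \<forall>y\<in>mspace C_square. mdist C_square x y < r \<longrightarrow> y \<in> U)"
proof -
  interpret Metric_space "mspace C_square" "mdist C_square" by (rule Metric_space_mspace_mdist)
  show ?thesis
    unfolding mtopology_of_def openin_mtopology
  proof -
    have "(\<exists>r>0. mball x r \<subseteq> U) \<longleftrightarrow>
        (\<exists>r>0. \<forall>y\<in>mspace C_square. mdist C_square x y < r \<longrightarrow> y \<in> U)"
      if "U \<subseteq> mspace C_square" "x \<in> U" for x
    proof -
      have "x \<in> mspace C_square" using that by blast
      then show ?thesis by (simp add: subset_iff Ball_def imp_conjL)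
    qed
    then show "(U \<subseteq> mspace C_square \<and> (\<forall>x. x \<in> U \<longrightarrow> (\<exists>r>0. mball x r \<subseteq> U))) =
      (U \<subseteq> mspace C_square \<and> (\<forall>x\<in>U. \<exists>r>0. \<forall>y\<in>mspace C_square. mdist C_square x y < r \<longrightarrow> y \<in> U))"
      by (simp add: Ball_def cong: conj_cong)
  qed
qed

lemma C_square_dist_le:
  assumes "0 \<le> r" "\<And>p. p \<in> unit_square \<Longrightarrow> \<bar>x p - y p\<bar> \<le> r"
  shows "mdist C_square x y \<le> r"
  unfolding C_square_def by (rule mdist_cfunspace_le) (use assms in \<open>auto simp: dist_real_def\<close>)

lemma C_square_dist_ge:
  assumes "x \<in> mspace C_square" "y \<in> mspace C_square" "p \<in> unit_square"
  shows "\<bar>x p - y p\<bar> \<le> mdist C_square x y"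
  using mdist_cfunspace_imp_mdist_le[of x "top_of_set unit_square" euclidean_metric y "mdist C_square x y" p] assms
  unfolding C_square_def by (auto simp: dist_real_def)

lemma mdist_le_trunc_dist:
  assumes "trunc_dist x y < 1"
  shows "mdist C_square x y \<le> trunc_dist x y"
  using assms trunc_dist_ge[of _ x y]
  by (intro C_square_dist_le trunc_dist_nonneg) (force simp: min_def split: if_splits)

lemma trunc_dist_le_mdist:
  assumes "x \<in> mspace C_square" "y \<in> mspace C_square"
  shows "trunc_dist x y \<le> mdist C_square x y"
  by (rule trunc_dist_le[OF C_square_dist_ge[OF assms]])

lemma space_borel_C [simp]: "space borel_C = mspace C_square"
  unfolding borel_C_def by (rule space_measure_of) (auto simp: openin_C_square_iff)

lemma openin_borel_C: "openin (mtopology_of C_square) U \<Longrightarrow> U \<in> sets borel_C"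
  unfolding borel_C_def by (subst sets_measure_of) (auto simp: openin_C_square_iff)

lemma continuous_map_borel_C:
  assumes "continuous_map (mtopology_of C_square) euclideanreal F"
  shows "F \<in> borel_measurable borel_C"
proof (rule borel_measurableI)
  fix S :: "real set" assume "open S"
  then have "openin (mtopology_of C_square) {x \<in> mspace C_square. F x \<in> S}"
    using openin_continuous_map_preimage[OF assms, of S] by simp
  then show "F -` S \<inter> space borel_C \<in> sets borel_C"
    using openin_borel_C[of "{x \<in> mspace C_square. F x \<in> S}"] by (simp add: vimage_def Int_def conj_commute)
qed

lemma continuous_map_lipschitz:
  assumes "\<And>x y. x \<in> mspace C_square \<Longrightarrow> y \<in> mspace C_square \<Longrightarrow> \<bar>F x - F y\<bar> \<le> c * mdist C_square x y"
  shows "continuous_map (mtopology_of C_square) euclideanreal F"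
  unfolding continuous_map
proof (intro conjI allI impI)
  fix U :: "real set" assume "openin euclideanreal U"
  then have U: "open U" by simp
  show "openin (mtopology_of C_square) {x \<in> topspace (mtopology_of C_square). F x \<in> U}"
    unfolding openin_C_square_iff
  proof (intro conjI ballI)
    fix x assume x: "x \<in> {x \<in> topspace (mtopology_of C_square). F x \<in> U}"
    then obtain e where e: "e > 0" "\<And>z. dist z (F x) < e \<Longrightarrow> z \<in> U"
      using U unfolding open_dist by blast
    show "\<exists>r>0. \<forall>y\<in>mspace C_square. mdist C_square x y < r \<longrightarrow> y \<in> {x \<in> topspace (mtopology_of C_square). F x \<in> U}"
    proof (intro exI[of _ "e / (\<bar>c\<bar> + 1)"] conjI ballI impI)
      fix y assume y: "y \<in> mspace C_square" and d: "mdist C_square x y < e / (\<bar>c\<bar> + 1)"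
      have "\<bar>F y - F x\<bar> \<le> c * mdist C_square x y"
        using assms[of x y] x y by (auto simp: abs_minus_commute)
      also have "\<dots> \<le> (\<bar>c\<bar> + 1) * mdist C_square x y"
        by (rule mult_right_mono) auto
      also have "\<dots> < e" using d by (simp add: field_simps)
      finally show "y \<in> {x \<in> topspace (mtopology_of C_square). F x \<in> U}"
        using y e by (auto simp: dist_real_def)
    qed (use e in auto)
  qed auto
qed auto

lemma trunc_lipschitz_continuous:
  assumes "trunc_lipschitz L H"
  shows "continuous_map (mtopology_of C_square) euclideanreal H"
proof (rule continuous_map_lipschitz)
  fix x y assume xy: "x \<in> mspace C_square" "y \<in> mspace C_square"
  have "\<bar>H x - H y\<bar> \<le> L * trunc_dist x y" "0 \<le> L" using assms unfolding trunc_lipschitz_def by auto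
  then show "\<bar>H x - H y\<bar> \<le> L * mdist C_square x y"
    using mult_left_mono[OF trunc_dist_le_mdist[OF xy] \<open>0 \<le> L\<close>] by linarith
qed

lemma trunc_lipschitz_measurable:
  assumes "trunc_lipschitz L H" "trajectory X \<in> M \<rightarrow>\<^sub>M borel_C"
  shows "(\<lambda>\<omega>. H (X \<omega>)) \<in> borel_measurable M"
  using measurable_compose[OF assms(2) continuous_map_borel_C[OF trunc_lipschitz_continuous[OF assms(1)]]]
  by (simp add: trajectory_def trunc_lipschitz_restrict[OF assms(1)])

section \<open>Weak convergence from truncated-Lipschitz functionals\<close>

text \<open>A point far from \<open>x\<close> pays a penalty \<open>k\<close> times its distance, which for large \<open>k\<close> exceeds the oscillation
\<open>2 b\<close> of \<open>F\<close>; at a point close to \<open>x\<close>, continuity keeps \<open>F\<close> above \<open>F x - e/2\<close>.\<close>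

lemma lower_envelope_tendsto:
  assumes F: "continuous_map (mtopology_of C_square) euclideanreal F"
    and b: "\<And>y. y \<in> mspace C_square \<Longrightarrow> \<bar>F y\<bar> \<le> b" and x: "x \<in> mspace C_square"
  shows "(\<lambda>k. INF y\<in>mspace C_square. F y + real k * trunc_dist x y) \<longlonglongrightarrow> F x"
    and "\<And>k. (INF y\<in>mspace C_square. F y + real k * trunc_dist x y) \<le> F x"
    and "\<And>k. \<bar>INF y\<in>mspace C_square. F y + real k * trunc_dist x y\<bar> \<le> b"
proof -
  let ?C = "mspace C_square"
  let ?E = "\<lambda>k. INF y\<in>?C. F y + real k * trunc_dist x y"
  have ne: "?C \<noteq> {}" using x by auto
  have low: "- b \<le> F y + real k * trunc_dist x y" if "y \<in> ?C" for k y
    using b[OF that] mult_nonneg_nonneg[OF _ trunc_dist_nonneg, of "real k" x y] by linarith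
  have bdd: "bdd_below ((\<lambda>y. F y + real k * trunc_dist x y) ` ?C)" for k
    by (rule bdd_belowI2[of _ "-b"]) (rule low)
  show up: "?E k \<le> F x" for k
    using cINF_lower[OF bdd x, of k] by simp
  show "\<bar>?E k\<bar> \<le> b" for k
  proof -
    have "- b \<le> ?E k" by (rule cINF_greatest[OF ne low])
    then show ?thesis using up[of k] b[OF x] by (simp only: abs_le_iff) linarith
  qed
  show "?E \<longlonglongrightarrow> F x"
  proof (rule LIMSEQ_I)
    fix e :: real assume e: "0 < e"
    let ?U = "{y \<in> ?C. F y \<in> {F x - e/2<..}}"
    have "openin (mtopology_of C_square) ?U"
      using openin_continuous_map_preimage[OF F, of "{F x - e/2<..}"] by simp
    moreover have "x \<in> ?U" using x e by auto
    ultimately obtain r where r: "r > 0" "\<And>y. y \<in> ?C \<Longrightarrow> mdist C_square x y < r \<Longrightarrow> y \<in> ?U"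
      unfolding openin_C_square_iff by blast
    \<comment> \<open>the truncated distance determines the supremum distance only below 1\<close>
    define d where "d = min r 1"
    have d: "d > 0" "d \<le> 1" "d \<le> r" using r by (auto simp: d_def)
    obtain K where K: "real K > 2 * b / d" using reals_Archimedean2 by blast
    have "\<bar>?E k - F x\<bar> < e" if k: "k \<ge> K" for k
    proof -
      have "F x - e/2 \<le> ?E k"
      proof (rule cINF_greatest[OF ne])
        fix y assume y: "y \<in> ?C"
        show "F x - e/2 \<le> F y + real k * trunc_dist x y"
        proof (cases "trunc_dist x y < d")
          case True
          then have "mdist C_square x y < r" using mdist_le_trunc_dist[of x y] d by linarith
          then have "F x - e/2 < F y" using r(2)[OF y] by auto
          then show ?thesis using mult_nonneg_nonneg[OF _ trunc_dist_nonneg, of "real k" x y] by linarith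
        next
          case False
          have "2 * b \<le> real K * d" using K d by (simp add: field_simps)
          also have "\<dots> \<le> real k * trunc_dist x y" using False k d by (intro mult_mono) auto
          finally show ?thesis using b[OF x] b[OF y] e by linarith
        qed
      qed
      then show ?thesis using up[of k] e by linarith
    qed
    then show "\<exists>no. \<forall>n\<ge>no. norm (?E n - F x) < e" by auto
  qed
qed

lemma trajectory_mspace:
  "trajectory X \<omega> \<in> mspace C_square \<longleftrightarrow> continuous_on unit_square (X \<omega>)"
  unfolding mspace_C_square trajectory_def by (auto cong: continuous_on_cong)

text \<open>The expectation of \<open>F\<close> is bounded below by that of an envelope, for which convergence is assumed, and the
expectations of the envelopes at the limit \<open>Z\<close> tend to that of \<open>F\<close>.\<close>

lemma liminf_expectation:
  assumes "prob_space M" "prob_space N"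
    and X: "\<And>n. trajectory (X n) \<in> M \<rightarrow>\<^sub>M borel_C" and Z: "trajectory Z \<in> N \<rightarrow>\<^sub>M borel_C"
    and conv: "\<And>L H. trunc_lipschitz L H \<Longrightarrow> (\<lambda>n. LINT \<omega>|M. H (X n \<omega>)) \<longlonglongrightarrow> (LINT \<omega>|N. H (Z \<omega>))"
    and F: "continuous_map (mtopology_of C_square) euclideanreal F"
    and b: "\<And>y. y \<in> mspace C_square \<Longrightarrow> \<bar>F y\<bar> \<le> b" and e: "e > 0"
  shows "\<forall>\<^sub>F n in sequentially. (LINT \<omega>|M. F (trajectory (X n) \<omega>)) > (LINT \<omega>|N. F (trajectory Z \<omega>)) - e"
proof -
  interpret M: prob_space M by fact
  interpret N: prob_space N by fact
  let ?C = "mspace C_square"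
  define E where "E = (\<lambda>k x. INF y\<in>?C. F y + real k * trunc_dist x y)"
  have inX: "\<omega> \<in> space M \<Longrightarrow> trajectory (X n) \<omega> \<in> ?C" for n \<omega>
    using measurable_space[OF X] by simp
  have inZ: "\<omega> \<in> space N \<Longrightarrow> trajectory Z \<omega> \<in> ?C" for \<omega>
    using measurable_space[OF Z] by simp
  obtain \<omega>0 where "\<omega>0 \<in> space M" using M.not_empty by blast
  then have ne: "?C \<noteq> {}" using inX by blast
  have lipE: "trunc_lipschitz (real k) (E k)" for k
    unfolding E_def by (rule trunc_lipschitz_infimum[OF ne, of "-b"]) (use b in \<open>auto simp: abs_le_iff, smt (verit)\<close>)
  note env = lower_envelope_tendsto[OF F b]
  have FX [measurable]: "(\<lambda>\<omega>. F (trajectory (X n) \<omega>)) \<in> borel_measurable M" for n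
    using measurable_compose[OF X continuous_map_borel_C[OF F]] .
  have FZ [measurable]: "(\<lambda>\<omega>. F (trajectory Z \<omega>)) \<in> borel_measurable N"
    using measurable_compose[OF Z continuous_map_borel_C[OF F]] .
  have EX [measurable]: "(\<lambda>\<omega>. E k (trajectory (X n) \<omega>)) \<in> borel_measurable M" for n k
    using measurable_compose[OF X continuous_map_borel_C[OF trunc_lipschitz_continuous[OF lipE]]] .
  have EZ [measurable]: "(\<lambda>\<omega>. E k (trajectory Z \<omega>)) \<in> borel_measurable N" for k
    using measurable_compose[OF Z continuous_map_borel_C[OF trunc_lipschitz_continuous[OF lipE]]] .
  have "(\<lambda>k. LINT \<omega>|N. E k (trajectory Z \<omega>)) \<longlonglongrightarrow> (LINT \<omega>|N. F (trajectory Z \<omega>))"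
  proof (rule integral_dominated_convergence[where w="\<lambda>_. b"])
    show "AE \<omega> in N. (\<lambda>k. E k (trajectory Z \<omega>)) \<longlonglongrightarrow> F (trajectory Z \<omega>)"
      by (rule AE_I2) (use env(1) inZ in \<open>auto simp: E_def\<close>)
    show "AE \<omega> in N. norm (E k (trajectory Z \<omega>)) \<le> b" for k
      by (rule AE_I2) (use env(3) inZ in \<open>auto simp: E_def\<close>)
  qed auto
  from order_tendstoD(1)[OF this, of "(LINT \<omega>|N. F (trajectory Z \<omega>)) - e"] e
  obtain k where k: "(LINT \<omega>|N. E k (trajectory Z \<omega>)) > (LINT \<omega>|N. F (trajectory Z \<omega>)) - e"
    by (auto simp: eventually_sequentially)
  have "(\<lambda>n. LINT \<omega>|M. E k (trajectory (X n) \<omega>)) \<longlonglongrightarrow> (LINT \<omega>|N. E k (trajectory Z \<omega>))"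
    using conv[OF lipE[of k]] by (simp add: trajectory_def trunc_lipschitz_restrict[OF lipE])
  from order_tendstoD(1)[OF this k]
  show ?thesis
  proof (rule eventually_mono)
    fix n assume *: "(LINT \<omega>|N. F (trajectory Z \<omega>)) - e < (LINT \<omega>|M. E k (trajectory (X n) \<omega>))"
    have "(LINT \<omega>|M. E k (trajectory (X n) \<omega>)) \<le> (LINT \<omega>|M. F (trajectory (X n) \<omega>))"
    proof (rule integral_mono)
      show "integrable M (\<lambda>\<omega>. E k (trajectory (X n) \<omega>))"
        by (rule M.integrable_const_bound[where B=b]) (use env(3) inX EX in \<open>auto simp: E_def\<close>)
      show "integrable M (\<lambda>\<omega>. F (trajectory (X n) \<omega>))"
        by (rule M.integrable_const_bound[where B=b]) (use b inX in auto)
    qed (use env(2) inX in \<open>auto simp: E_def\<close>)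
    then show "(LINT \<omega>|M. F (trajectory (X n) \<omega>)) > (LINT \<omega>|N. F (trajectory Z \<omega>)) - e"
      using * by linarith
  qed
qed

text \<open>The lower bound for \<open>F\<close> and the lower bound for \<open>- F\<close> together give the limit.\<close>

theorem converges_in_law_lipschitz:
  assumes "prob_space M" "prob_space N"
    and X: "\<And>n. trajectory (X n) \<in> M \<rightarrow>\<^sub>M borel_C" and Z: "trajectory Z \<in> N \<rightarrow>\<^sub>M borel_C"
    and conv: "\<And>L H. trunc_lipschitz L H \<Longrightarrow> (\<lambda>n. LINT \<omega>|M. H (X n \<omega>)) \<longlonglongrightarrow> (LINT \<omega>|N. H (Z \<omega>))"
  shows "converges_in_law_C M X N Z"
  unfolding converges_in_law_C_def weak_conv_C_def
proof (intro conjI allI impI X Z)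
  fix F assume "continuous_map (mtopology_of C_square) euclideanreal F \<and> bounded (F ` mspace C_square)"
  then obtain b where F: "continuous_map (mtopology_of C_square) euclideanreal F"
    and b: "\<And>y. y \<in> mspace C_square \<Longrightarrow> \<bar>F y\<bar> \<le> b"
    by (auto simp: bounded_iff)
  have F': "continuous_map (mtopology_of C_square) euclideanreal (\<lambda>x. - F x)"
    using F by (rule continuous_map_minus)
  have lX: "(LINT x|law_C M (X n). F x) = (LINT \<omega>|M. F (trajectory (X n) \<omega>))" for n
    unfolding law_C_def by (rule integral_distr[OF X continuous_map_borel_C[OF F]])
  have lZ: "(LINT x|law_C N Z. F x) = (LINT \<omega>|N. F (trajectory Z \<omega>))"
    unfolding law_C_def by (rule integral_distr[OF Z continuous_map_borel_C[OF F]])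
  have lim: "\<forall>\<^sub>F n in sequentially. (LINT \<omega>|M. G (trajectory (X n) \<omega>)) > (LINT \<omega>|N. G (trajectory Z \<omega>)) - e"
    if "continuous_map (mtopology_of C_square) euclideanreal G"
      "\<And>y. y \<in> mspace C_square \<Longrightarrow> \<bar>G y\<bar> \<le> b" "e > 0" for G e
    by (rule liminf_expectation[OF assms(1,2) X Z conv]) (use that in auto)
  show "(\<lambda>n. LINT x|law_C M (X n). F x) \<longlonglongrightarrow> (LINT x|law_C N Z. F x)"
    unfolding lX lZ
  proof (rule tendstoI)
    fix e :: real assume e: "e > 0"
    show "\<forall>\<^sub>F n in sequentially. dist (LINT \<omega>|M. F (trajectory (X n) \<omega>)) (LINT \<omega>|N. F (trajectory Z \<omega>)) < e"
      using lim[OF F b e]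
    proof (rule eventually_elim2)
      show "\<forall>\<^sub>F n in sequentially. (LINT \<omega>|M. - F (trajectory (X n) \<omega>)) > (LINT \<omega>|N. - F (trajectory Z \<omega>)) - e"
        by (rule lim[OF F' _ e]) (use b in auto)
    qed (auto simp: dist_real_def)
  qed
qed

section \<open>Finite-valued meshes and measurability of trajectories\<close>

lemma finite_rank_continuous:
  fixes idx :: "(real \<times> real) \<Rightarrow> nat"
  assumes "trunc_lipschitz L H" "\<And>p. p \<in> unit_square \<Longrightarrow> idx p < m"
  shows "continuous_on UNIV (\<lambda>v :: nat \<Rightarrow> real. H (\<lambda>p. v (idx p)))"
  unfolding continuous_on_def
proof (intro ballI tendstoI)
  fix v :: "nat \<Rightarrow> real" and e :: real assume e: "e > 0"
  have L: "0 \<le> L" using assms(1) by (simp add: trunc_lipschitz_def)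
  have "\<forall>\<^sub>F w in at v. \<bar>w i - v i\<bar> < e / (L + 1)" for i
  proof -
    have "((\<lambda>w :: nat \<Rightarrow> real. w i) \<longlongrightarrow> v i) (at v)"
      using continuous_on_product_coordinates[of i, where ?'b=real] unfolding continuous_on_def by auto
    from tendstoD[OF this, of "e / (L+1)"] show ?thesis using e L by (simp add: dist_real_def)
  qed
  then have "\<forall>\<^sub>F w in at v. \<forall>i\<in>{..<m}. \<bar>w i - v i\<bar> < e / (L + 1)"
    by (intro eventually_ball_finite) auto
  then show "\<forall>\<^sub>F w in at v within UNIV. dist (H (\<lambda>p. w (idx p))) (H (\<lambda>p. v (idx p))) < e"
  proof (rule eventually_mono)
    fix w assume w: "\<forall>i\<in>{..<m}. \<bar>w i - v i\<bar> < e / (L + 1)"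
    have "\<bar>H (\<lambda>p. w (idx p)) - H (\<lambda>p. v (idx p))\<bar> \<le> L * trunc_dist (\<lambda>p. w (idx p)) (\<lambda>p. v (idx p))"
      using assms(1) by (auto simp: trunc_lipschitz_def)
    also have "\<dots> \<le> L * (e / (L+1))"
      using L w assms(2) by (intro mult_left_mono trunc_dist_le) (auto simp: less_imp_le)
    also have "\<dots> < e" using L e by (simp add: field_simps)
    finally show "dist (H (\<lambda>p. w (idx p))) (H (\<lambda>p. v (idx p))) < e" by (simp add: dist_real_def)
  qed
qed

text \<open>\<open>X \<omega> \<circ> P\<close> depends only on the finitely many values of \<open>X \<omega>\<close> at points of \<open>P ` unit_square\<close>. They are collected in
a sequence, because coordinatewise measurability into the countable power \<open>nat \<Rightarrow> real\<close> is measurability.\<close>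

lemma finite_rank_measurable:
  assumes H: "trunc_lipschitz L H" and fin: "finite (P ` unit_square)" and P: "P ` unit_square \<subseteq> unit_square"
    and X: "\<And>q. q \<in> unit_square \<Longrightarrow> (\<lambda>\<omega>. X \<omega> q) \<in> borel_measurable M"
  shows "(\<lambda>\<omega>. H (X \<omega> \<circ> P)) \<in> borel_measurable M"
proof -
  obtain g and m :: nat where g: "P ` unit_square = g ` {i. i < m}"
    using fin unfolding finite_conv_nat_seg_image by auto
  define idx where "idx p = (SOME i. i < m \<and> P p = g i)" for p
  have idx: "idx p < m \<and> P p = g (idx p)" if "p \<in> unit_square" for p
    unfolding idx_def by (rule someI_ex) (use that g in blast)
  define V where "V \<omega> i = (if i < m then X \<omega> (g i) else 0)" for \<omega> i
  have V: "V \<in> borel_measurable M"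
  proof (rule measurable_coordinatewise_then_product)
    fix i show "(\<lambda>\<omega>. V \<omega> i) \<in> borel_measurable M"
      using X[of "g i"] g P by (cases "i < m") (auto simp: V_def)
  qed
  have "(\<lambda>v :: nat \<Rightarrow> real. H (\<lambda>p. v (idx p))) \<in> borel_measurable borel"
    by (rule borel_measurable_continuous_onI[OF finite_rank_continuous[OF H]]) (use idx in auto)
  from measurable_compose[OF V this]
  have "(\<lambda>\<omega>. H (\<lambda>p. V \<omega> (idx p))) \<in> borel_measurable M" .
  moreover have "H (\<lambda>p. V \<omega> (idx p)) = H (X \<omega> \<circ> P)" for \<omega>
    by (subst (1 2) trunc_lipschitz_restrict[OF H, symmetric], rule arg_cong[of _ _ H])
       (auto simp: restrict_def V_def idx fun_eq_iff)
  ultimately show ?thesis by simp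
qed

text \<open>\<open>x \<circ> P k\<close> is a step function built from finitely many values of \<open>x\<close>; it tends uniformly to \<open>x\<close> when \<open>x\<close> is
continuous.\<close>

definition mesh :: "(nat \<Rightarrow> real \<times> real \<Rightarrow> real \<times> real) \<Rightarrow> bool" where
  "mesh P \<longleftrightarrow> (\<forall>k. P k ` unit_square \<subseteq> unit_square \<and> finite (P k ` unit_square)) \<and>
     uniform_limit unit_square P (\<lambda>p. p) sequentially"

lemma mesh_trunc_dist:
  assumes P: "mesh P" and x: "continuous_on unit_square x"
  shows "(\<lambda>k. trunc_dist (x \<circ> P k) x) \<longlonglongrightarrow> 0"
proof (rule tendstoI)
  fix e :: real assume e: "e > 0"
  have "uniformly_continuous_on unit_square x"
    by (rule compact_uniformly_continuous[OF x]) (simp add: compact_Times)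
  then obtain d where d: "d > 0" "\<And>p q. p \<in> unit_square \<Longrightarrow> q \<in> unit_square \<Longrightarrow> dist q p < d \<Longrightarrow> dist (x q) (x p) < e/2"
    unfolding uniformly_continuous_on_def using half_gt_zero[OF e] by metis
  have "\<forall>\<^sub>F k in sequentially. \<forall>p\<in>unit_square. dist (P k p) p < d"
    using P d(1) unfolding mesh_def uniform_limit_iff by blast
  then show "\<forall>\<^sub>F k in sequentially. dist (trunc_dist (x \<circ> P k) x) 0 < e"
  proof (rule eventually_mono)
    fix k assume k: "\<forall>p\<in>unit_square. dist (P k p) p < d"
    have "trunc_dist (x \<circ> P k) x \<le> e/2"
    proof (rule trunc_dist_le)
      fix p assume p: "p \<in> unit_square"
      then have "P k p \<in> unit_square" using P unfolding mesh_def by blast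
      from d(2)[OF p this] k p show "\<bar>(x \<circ> P k) p - x p\<bar> \<le> e/2"
        by (auto simp: dist_real_def less_imp_le)
    qed
    then show "dist (trunc_dist (x \<circ> P k) x) 0 < e" using trunc_dist_nonneg[of "x \<circ> P k" x] e by auto
  qed
qed

lemma trunc_lipschitz_mesh_tendsto:
  assumes H: "trunc_lipschitz L H" and P: "mesh P" and x: "continuous_on unit_square x"
  shows "(\<lambda>k. H (x \<circ> P k)) \<longlonglongrightarrow> H x"
proof -
  have "(\<lambda>k. L * trunc_dist (x \<circ> P k) x) \<longlonglongrightarrow> 0"
    using tendsto_mult_left[OF mesh_trunc_dist[OF P x], of L] by simp
  then have "(\<lambda>k. H (x \<circ> P k) - H x) \<longlonglongrightarrow> 0"
    by (rule Lim_null_comparison[rotated]) (use H in \<open>auto simp: trunc_lipschitz_def\<close>)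
  then show ?thesis by (simp add: LIM_zero_iff)
qed

text \<open>The trajectory lies in an open set \<open>U\<close> exactly when its distance to the complement of \<open>U\<close> is positive. This
distance makes sense for step functions too, hence it is the limit of its values at \<open>X \<omega> \<circ> P k\<close>, which are
measurable.\<close>

lemma trajectory_measurable:
  assumes P: "mesh P" and cont: "\<And>\<omega>. \<omega> \<in> space M \<Longrightarrow> continuous_on unit_square (X \<omega>)"
    and X: "\<And>q. q \<in> unit_square \<Longrightarrow> (\<lambda>\<omega>. X \<omega> q) \<in> borel_measurable M"
  shows "trajectory X \<in> M \<rightarrow>\<^sub>M borel_C"
  unfolding borel_C_def
proof (rule measurable_measure_of)
  show "{U. openin (mtopology_of C_square) U} \<subseteq> Pow (mspace C_square)"
    by (auto simp: openin_C_square_iff)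
  show "trajectory X \<in> space M \<rightarrow> mspace C_square"
    using cont by (auto simp: trajectory_mspace)
  fix U assume "U \<in> {U. openin (mtopology_of C_square) U}"
  then have U: "openin (mtopology_of C_square) U" by simp
  let ?A = "mspace C_square - U"
  show "trajectory X -` U \<inter> space M \<in> sets M"
  proof (cases "?A = {}")
    case True
    then have "trajectory X -` U \<inter> space M = space M"
      using cont trajectory_mspace[of X] by auto
    then show ?thesis by simp
  next
    case False
    define h where "h x = (INF y\<in>?A. 0 + 1 * trunc_dist x y)" for x
    have h: "trunc_lipschitz 1 h" unfolding h_def by (rule trunc_lipschitz_infimum[OF False, of 0]) auto
    have "(\<lambda>\<omega>. h (X \<omega>)) \<in> borel_measurable M"
    proof (rule borel_measurable_LIMSEQ_real)
      show "(\<lambda>\<omega>. h (X \<omega> \<circ> P k)) \<in> borel_measurable M" for k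
        by (rule finite_rank_measurable[OF h]) (use P X in \<open>auto simp: mesh_def\<close>)
      show "\<omega> \<in> space M \<Longrightarrow> (\<lambda>k. h (X \<omega> \<circ> P k)) \<longlonglongrightarrow> h (X \<omega>)" for \<omega>
        by (rule trunc_lipschitz_mesh_tendsto[OF h P cont])
    qed
    then have "{\<omega> \<in> space M. 0 < h (X \<omega>)} \<in> sets M" by measurable
    moreover have "trajectory X \<omega> \<in> U \<longleftrightarrow> 0 < h (X \<omega>)" if w: "\<omega> \<in> space M" for \<omega>
    proof
      let ?x = "trajectory X \<omega>"
      have hx: "h (X \<omega>) = h ?x" unfolding trajectory_def by (simp add: trunc_lipschitz_restrict[OF h])
      assume "?x \<in> U"
      then obtain r where r: "r > 0" "\<And>y. y \<in> mspace C_square \<Longrightarrow> mdist C_square ?x y < r \<Longrightarrow> y \<in> U"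
        using U unfolding openin_C_square_iff by blast
      have "min r 1 \<le> h ?x" unfolding h_def
      proof (rule cINF_greatest[OF False])
        fix y assume y: "y \<in> ?A"
        then have "\<not> mdist C_square ?x y < r" using r(2) by blast
        then show "min r 1 \<le> 0 + 1 * trunc_dist ?x y"
          using mdist_le_trunc_dist[of ?x y] by (cases "trunc_dist ?x y < 1") auto
      qed
      then show "0 < h (X \<omega>)" using r hx by linarith
    next
      let ?x = "trajectory X \<omega>"
      have hx: "h (X \<omega>) = h ?x" unfolding trajectory_def by (simp add: trunc_lipschitz_restrict[OF h])
      have bdd: "bdd_below ((\<lambda>y. 0 + 1 * trunc_dist ?x y) ` ?A)"
        by (rule bdd_belowI2[of _ 0]) (simp add: trunc_dist_nonneg)
      assume pos: "0 < h (X \<omega>)"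
      show "?x \<in> U"
      proof (rule ccontr)
        assume "?x \<notin> U"
        then have "?x \<in> ?A" using cont[OF w] trajectory_mspace[of X] by auto
        from cINF_lower[OF bdd this] have "h ?x \<le> 0" unfolding h_def by simp
        then show False using pos hx by simp
      qed
    qed
    then have "trajectory X -` U \<inter> space M = {\<omega> \<in> space M. 0 < h (X \<omega>)}" by auto
    ultimately show ?thesis by simp
  qed
qed

section \<open>Dyadic chaining of rectangular increments\<close>

text \<open>\<open>dyad_idx k s / 2\<^sup>k\<close> is the largest point of level \<open>k\<close> that is strictly below \<open>s\<close>, or \<open>0\<close> if \<open>s = 0\<close>. With the
floor instead of the strict inequality, level \<open>0\<close> would send \<open>1\<close> to itself; here it sends all of
\<open>[0,1]\<close> to \<open>0\<close>, so chains start on the axes, where the processes vanish.\<close>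

definition dyad_idx :: "nat \<Rightarrow> real \<Rightarrow> nat" where
  "dyad_idx k s = nat (\<lceil>2 ^ k * s\<rceil> - 1)"

definition dyad :: "nat \<Rightarrow> real \<Rightarrow> real" where
  "dyad k s = real (dyad_idx k s) / 2 ^ k"

lemma dyad_idx_Suc:
  "dyad_idx (Suc k) s = 2 * dyad_idx k s \<or> dyad_idx (Suc k) s = 2 * dyad_idx k s + 1"
proof -
  define x where "x = 2 ^ k * s"
  have "\<lceil>2 * x\<rceil> = 2 * \<lceil>x\<rceil> \<or> \<lceil>2 * x\<rceil> = 2 * \<lceil>x\<rceil> - 1"
  proof -
    have "real_of_int \<lceil>x\<rceil> - 1 < x" "x \<le> of_int \<lceil>x\<rceil>" by linarith+
    then have "\<lceil>2 * x\<rceil> \<le> 2 * \<lceil>x\<rceil>" "2 * \<lceil>x\<rceil> - 2 < \<lceil>2 * x\<rceil>"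
      by (simp_all add: ceiling_le_iff less_ceiling_iff)
    then show ?thesis by linarith
  qed
  moreover have "dyad_idx (Suc k) s = nat (\<lceil>2 * x\<rceil> - 1)" "dyad_idx k s = nat (\<lceil>x\<rceil> - 1)"
    by (simp_all add: dyad_idx_def x_def mult.assoc)
  ultimately show ?thesis by linarith
qed

lemma dyad_idx_0: "s \<le> 1 \<Longrightarrow> dyad_idx 0 s = 0"
  by (simp add: dyad_idx_def ceiling_le_iff)

lemma dyad_0: "s \<le> 1 \<Longrightarrow> dyad 0 s = 0"
  by (simp add: dyad_def dyad_idx_0)

lemma dyad_idx_less: "s \<le> 1 \<Longrightarrow> dyad_idx k s < 2 ^ k"
proof (induction k)
  case (Suc k)
  then show ?case using dyad_idx_Suc[of k s] by auto
qed (simp add: dyad_idx_0)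

lemma dyad_mem: "s \<in> {0..1} \<Longrightarrow> dyad k s \<in> {0..1}"
proof -
  assume "s \<in> {0..1}"
  then have "real (dyad_idx k s) < real (2 ^ k)" using dyad_idx_less[of s k] by (simp only: of_nat_less_iff) auto
  then show ?thesis by (auto simp: dyad_def field_simps)
qed

lemma finite_dyad: "finite (dyad k ` {0..1})"
proof (rule finite_subset)
  show "dyad k ` {0..1} \<subseteq> (\<lambda>i. real i / 2 ^ k) ` {..<2 ^ k}"
    using dyad_idx_less by (auto simp: dyad_def intro!: imageI)
qed auto

lemma dyad_close:
  assumes "s \<in> {0..1}" shows "\<bar>dyad k s - s\<bar> \<le> (1/2) ^ k"
proof -
  let ?x = "2 ^ k * s"
  have "0 \<le> ?x" using assms by simp
  then have "\<bar>real (nat (\<lceil>?x\<rceil> - 1)) - ?x\<bar> \<le> 1" by linarith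
  then have "\<bar>real (dyad_idx k s) - ?x\<bar> / 2 ^ k \<le> 1 / 2 ^ k"
    unfolding dyad_idx_def by (intro divide_right_mono) auto
  also have "\<bar>real (dyad_idx k s) - ?x\<bar> / 2 ^ k = \<bar>(real (dyad_idx k s) - ?x) / 2 ^ k\<bar>"
    by simp
  also have "(real (dyad_idx k s) - ?x) / 2 ^ k = dyad k s - s"
    by (simp add: dyad_def diff_divide_distrib)
  finally show ?thesis by (simp add: power_one_over)
qed

lemma dyad_tendsto: "s \<in> {0..1} \<Longrightarrow> (\<lambda>k. dyad k s) \<longlonglongrightarrow> s"
proof -
  assume s: "s \<in> {0..1}"
  have "(\<lambda>k. dyad k s - s) \<longlonglongrightarrow> 0"
    by (rule Lim_null_comparison[where g="\<lambda>k. (1/2) ^ k"])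
       (use dyad_close[OF s] in \<open>auto intro: LIMSEQ_power_zero\<close>)
  then show ?thesis by (simp add: LIM_zero_iff)
qed

text \<open>Passing from level \<open>i\<close> to level \<open>Suc i\<close> either leaves the approximating point where it is or moves it to the
right by one step of level \<open>Suc i\<close>, starting from an even multiple of that step. Only these cells occur in the chain.\<close>

definition dyad_cell :: "(real \<times> real \<Rightarrow> real) \<Rightarrow> nat \<Rightarrow> nat \<Rightarrow> nat \<Rightarrow> nat \<Rightarrow> real" where
  "dyad_cell x i j r q = rect_incr x (2 * real r / 2 ^ Suc i) (2 * real q / 2 ^ Suc j)
     ((2 * real r + 1) / 2 ^ Suc i) ((2 * real q + 1) / 2 ^ Suc j)"

lemma rect_incr_dyad:
  fixes x :: "real \<times> real \<Rightarrow> real"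
  shows "rect_incr x (dyad i s) (dyad j t) (dyad (Suc i) s) (dyad (Suc j) t) \<in>
    {0, dyad_cell x i j (dyad_idx i s) (dyad_idx j t)}"
proof -
  have *: "dyad (Suc k) u = dyad k u \<or>
    (dyad k u = 2 * real (dyad_idx k u) / 2 ^ Suc k \<and> dyad (Suc k) u = (2 * real (dyad_idx k u) + 1) / 2 ^ Suc k)" for k u
    using dyad_idx_Suc[of k u] by (auto simp: dyad_def)
  from *[of i s] *[of j t] show ?thesis
    by (elim disjE) (auto simp: rect_incr_def dyad_cell_def)
qed

lemma sum_rect_incr_telescope:
  fixes a :: "nat \<Rightarrow> nat \<Rightarrow> real"
  shows "(\<Sum>i<n. \<Sum>j<n. a (Suc i) (Suc j) - a (Suc i) j - a i (Suc j) + a i j) = a n n - a n 0 - a 0 n + a 0 0"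
proof -
  have "(\<Sum>j<n. a (Suc i) (Suc j) - a (Suc i) j - a i (Suc j) + a i j) = (a (Suc i) n - a (Suc i) 0) - (a i n - a i 0)" for i
  proof -
    have "(\<Sum>j<n. a (Suc i) (Suc j) - a (Suc i) j - a i (Suc j) + a i j) =
      (\<Sum>j<n. a (Suc i) (Suc j) - a (Suc i) j) - (\<Sum>j<n. a i (Suc j) - a i j)"
      by (simp add: sum_subtractf[symmetric] algebra_simps)
    then show ?thesis by (simp add: sum_lessThan_telescope)
  qed
  then have "(\<Sum>i<n. \<Sum>j<n. a (Suc i) (Suc j) - a (Suc i) j - a i (Suc j) + a i j) =
    (\<Sum>i<n. (a (Suc i) n - a (Suc i) 0) - (a i n - a i 0))" by simp
  also have "\<dots> = (a n n - a n 0) - (a 0 n - a 0 0)" by (rule sum_lessThan_telescope)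
  finally show ?thesis by simp
qed

text \<open>This replaces the maximum of finitely many increments by a sum of powers without taking roots of expectations.\<close>

lemma abs_le_young:
  fixes x \<eta> :: real
  assumes "\<eta> > 0" "even m" "m > 0"
  shows "\<bar>x\<bar> \<le> \<eta> + x ^ m / \<eta> ^ (m - 1)"
proof (cases "\<bar>x\<bar> \<le> \<eta>")
  case True
  then show ?thesis using assms by (simp add: add_increasing2 zero_le_even_power)
next
  case False
  obtain l where m: "m = Suc l" using assms by (cases m) auto
  have "\<eta> ^ l \<le> \<bar>x\<bar> ^ l" using False assms by (intro power_mono) auto
  then have "\<bar>x\<bar> * \<eta> ^ l \<le> \<bar>x\<bar> * \<bar>x\<bar> ^ l" by (intro mult_left_mono) auto
  also have "\<dots> = \<bar>x\<bar> ^ m" by (simp add: m)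
  also have "\<dots> = x ^ m" using assms by (simp add: power_even_abs)
  finally have "\<bar>x\<bar> \<le> x ^ m / \<eta> ^ l" using assms by (simp add: field_simps)
  then show ?thesis using assms m by simp
qed

lemma suminf_ennreal_geometric2:
  assumes "0 \<le> c" "0 < \<mu>" "\<mu> < 1"
  shows "(\<Sum>i. \<Sum>j. ennreal (c * \<mu> ^ i * \<mu> ^ j)) = ennreal (c / (1 - \<mu>) ^ 2)"
proof -
  have geo: "(\<Sum>j. ennreal (d * \<mu> ^ j)) = ennreal (d / (1 - \<mu>))" if "0 \<le> d" for d
  proof (rule suminf_ennreal_eq)
    show "(\<lambda>j. d * \<mu> ^ j) sums (d / (1 - \<mu>))"
      using sums_mult[OF geometric_sums, of \<mu> d] assms by simp
  qed (use that assms in auto)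
  have "(\<Sum>i. \<Sum>j. ennreal (c * \<mu> ^ i * \<mu> ^ j)) = (\<Sum>i. ennreal ((c / (1 - \<mu>)) * \<mu> ^ i))"
    using assms geo[of "c * \<mu> ^ i" for i] by (simp only: mult_nonneg_nonneg zero_le_power less_imp_le times_divide_eq_left)
  also have "\<dots> = ennreal (c / (1 - \<mu>) / (1 - \<mu>))"
    using assms by (intro geo) auto
  finally show ?thesis by (simp add: power2_eq_square)
qed

text \<open>A bound for all increments of the pair of levels \<open>(i, j)\<close>: \<open>abs_le_young\<close> with \<open>\<eta> = \<mu>\<^bsup>2(i+j)\<^esup>\<close>, the maximum over the cells
being bounded by the sum.\<close>

definition cell_bound :: "real \<Rightarrow> nat \<Rightarrow> (real \<times> real \<Rightarrow> real) \<Rightarrow> nat \<Rightarrow> nat \<Rightarrow> real" where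
  "cell_bound \<mu> m x i j = \<mu> ^ (2 * (i + j)) +
     (\<Sum>r<2 ^ i. \<Sum>q<2 ^ j. (dyad_cell x i j r q) ^ m) / (\<mu> ^ (2 * (i + j))) ^ (m - 1)"

text \<open>Bounds for the terms of the telescoping series that remain when the partial sum over \<open>i, j < k\<close> is removed.\<close>

definition chain_bound :: "real \<Rightarrow> nat \<Rightarrow> nat \<Rightarrow> (real \<times> real \<Rightarrow> real) \<Rightarrow> ennreal" where
  "chain_bound \<mu> m k x = (\<Sum>i. \<Sum>j. ennreal (if k \<le> i \<or> k \<le> j then cell_bound \<mu> m x i j else 0))"

lemma cell_bound_nonneg: "0 < \<mu> \<Longrightarrow> even m \<Longrightarrow> 0 \<le> cell_bound \<mu> m x i j"
  unfolding cell_bound_def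
  by (intro add_nonneg_nonneg divide_nonneg_nonneg sum_nonneg) (auto simp: zero_le_even_power)

lemma dyad_incr_le_cell_bound:
  assumes "0 < \<mu>" "even m" "0 < m" "s \<le> 1" "t \<le> 1"
  shows "\<bar>rect_incr x (dyad i s) (dyad j t) (dyad (Suc i) s) (dyad (Suc j) t)\<bar> \<le> cell_bound \<mu> m x i j"
proof -
  let ?c = "dyad_cell x i j" and ?\<eta> = "\<mu> ^ (2 * (i + j))"
  let ?r = "dyad_idx i s" and ?q = "dyad_idx j t"
  have eta: "?\<eta> > 0" using assms by simp
  have "\<bar>?c ?r ?q\<bar> \<le> cell_bound \<mu> m x i j"
  proof -
    have "(?c ?r ?q) ^ m \<le> (\<Sum>q<2 ^ j. (?c ?r q) ^ m)"
      by (rule member_le_sum[of _ _ "\<lambda>q. (?c ?r q) ^ m"]) (use assms dyad_idx_less in \<open>auto simp: zero_le_even_power\<close>)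
    also have "\<dots> \<le> (\<Sum>r<2 ^ i. \<Sum>q<2 ^ j. (?c r q) ^ m)"
      by (rule member_le_sum[of _ _ "\<lambda>r. \<Sum>q<2 ^ j. (?c r q) ^ m"])
        (use assms dyad_idx_less in \<open>auto simp: zero_le_even_power intro!: sum_nonneg\<close>)
    finally have "(?c ?r ?q) ^ m / ?\<eta> ^ (m - 1) \<le> (\<Sum>r<2 ^ i. \<Sum>q<2 ^ j. (?c r q) ^ m) / ?\<eta> ^ (m - 1)"
      using eta by (intro divide_right_mono) auto
    then show ?thesis using abs_le_young[OF eta assms(2,3), of "?c ?r ?q"] unfolding cell_bound_def by linarith
  qed
  then show ?thesis using rect_incr_dyad[of x i s j t] cell_bound_nonneg[of \<mu> m x i j] assms by auto
qed

text \<open>The value at \<open>(dyad n s, dyad n t)\<close> is the sum of the increments over all pairs of levels below \<open>n\<close>, since the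
boundary terms of the telescoping sum lie on the axes. Subtracting the sum for \<open>k\<close> and letting \<open>n\<close> tend to
infinity gives the bound, by continuity of \<open>x\<close>.\<close>

lemma chain_bound_le:
  assumes mu: "0 < \<mu>" and m: "even m" "0 < m" and st: "s \<in> {0..1}" "t \<in> {0..1}"
    and cont: "continuous_on unit_square x"
    and zero: "\<And>u. u \<in> {0..1} \<Longrightarrow> x (0, u) = 0" "\<And>u. u \<in> {0..1} \<Longrightarrow> x (u, 0) = 0"
  shows "ennreal \<bar>x (s, t) - x (dyad k s, dyad k t)\<bar> \<le> chain_bound \<mu> m k x"
proof -
  define a where "a i j = x (dyad i s, dyad j t)" for i j
  define d where "d i j = a (Suc i) (Suc j) - a (Suc i) j - a i (Suc j) + a i j" for i j
  have d: "\<bar>d i j\<bar> \<le> cell_bound \<mu> m x i j" for i j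
    using dyad_incr_le_cell_bound[OF mu m, of s t x i j] st by (simp add: d_def a_def rect_incr_def)
  have a0: "a 0 j = 0" "a i 0 = 0" for i j
    using st zero dyad_mem by (auto simp: a_def dyad_0)
  have ann: "a n n = (\<Sum>p\<in>{..<n} \<times> {..<n}. d (fst p) (snd p))" for n
    using sum_rect_incr_telescope[of a n]
    by (simp add: a0 d_def[symmetric] sum.cartesian_product case_prod_unfold)
  have bound: "ennreal \<bar>a n n - a k k\<bar> \<le> chain_bound \<mu> m k x" if kn: "k \<le> n" for n
  proof -
    let ?f = "\<lambda>i j. if k \<le> i \<or> k \<le> j then cell_bound \<mu> m x i j else 0"
    let ?S = "{..<n} \<times> {..<n} - {..<k} \<times> {..<k}"
    have nn: "0 \<le> ?f i j" for i j using cell_bound_nonneg[OF mu m(1)] by simp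
    have "a n n - a k k = (\<Sum>p\<in>?S. d (fst p) (snd p))"
      unfolding ann using kn by (subst sum_diff) auto
    also have "\<bar>\<dots>\<bar> \<le> (\<Sum>p\<in>?S. ?f (fst p) (snd p))"
      by (rule sum_abs[THEN order_trans], rule sum_mono) (use d in auto)
    also have "\<dots> \<le> (\<Sum>p\<in>{..<n} \<times> {..<n}. ?f (fst p) (snd p))"
      by (rule sum_mono2) (use nn in auto)
    also have "\<dots> = (\<Sum>i<n. \<Sum>j<n. ?f i j)"
      by (simp add: sum.cartesian_product case_prod_unfold)
    finally have "ennreal \<bar>a n n - a k k\<bar> \<le> ennreal (\<Sum>i<n. \<Sum>j<n. ?f i j)"
      by (rule ennreal_leI)
    also have "\<dots> = (\<Sum>i<n. \<Sum>j<n. ennreal (?f i j))"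
      using nn by (subst sum_ennreal[symmetric]) (auto intro!: sum_nonneg sum.cong)
    also have "\<dots> \<le> (\<Sum>i<n. \<Sum>j. ennreal (?f i j))"
      by (intro sum_mono sum_le_suminf) auto
    also have "\<dots> \<le> chain_bound \<mu> m k x"
      unfolding chain_bound_def by (intro sum_le_suminf) auto
    finally show ?thesis .
  qed
  have "(\<lambda>n. (dyad n s, dyad n t)) \<longlonglongrightarrow> (s, t)"
    by (intro tendsto_Pair dyad_tendsto st)
  then have "(\<lambda>n. x (dyad n s, dyad n t)) \<longlonglongrightarrow> x (s, t)"
    using st dyad_mem by (intro continuous_on_tendsto_compose[OF cont]) (auto intro!: always_eventually)
  then have "(\<lambda>n. ennreal \<bar>a n n - a k k\<bar>) \<longlonglongrightarrow> ennreal \<bar>x (s, t) - a k k\<bar>"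
    unfolding a_def by (intro tendsto_ennrealI tendsto_rabs tendsto_diff tendsto_const)
  then have "ennreal \<bar>x (s, t) - a k k\<bar> \<le> chain_bound \<mu> m k x"
    by (rule LIMSEQ_le_const2) (use bound in blast)
  then show ?thesis by (simp add: a_def)
qed

lemma dyad_cell_points:
  assumes "r < 2 ^ i"
  shows "0 \<le> 2 * real r / 2 ^ Suc i" "2 * real r / 2 ^ Suc i < (2 * real r + 1) / 2 ^ Suc i" "(2 * real r + 1) / 2 ^ Suc i \<le> 1"
proof -
  have "r + 1 \<le> 2 ^ i" using assms by simp
  then have "real (r + 1) \<le> real (2 ^ i)" by (rule of_nat_mono)
  then show "(2 * real r + 1) / 2 ^ Suc i \<le> 1" by (simp add: field_simps)
  show "2 * real r / 2 ^ Suc i < (2 * real r + 1) / 2 ^ Suc i" by (rule divide_strict_right_mono) auto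
qed auto

lemma dyad_cell_mem:
  assumes "r < 2 ^ i"
  shows "2 * real r / 2 ^ Suc i \<in> {0..1}" "(2 * real r + 1) / 2 ^ Suc i \<in> {0..1}"
  unfolding atLeastAtMost_iff using dyad_cell_points[OF assms] by linarith+

lemma sum_sum_ennreal:
  assumes "\<And>r q. 0 \<le> f r q"
  shows "ennreal (\<Sum>r\<in>A. \<Sum>q\<in>B. f r q) = (\<Sum>r\<in>A. \<Sum>q\<in>B. ennreal (f r q))"
  using assms by (simp add: sum_ennreal sum_nonneg)

text \<open>There are \<open>2\<^bsup>i+j\<^esup>\<close> cells of levels \<open>(i, j)\<close>, each contributing at most \<open>C (2\<^bsup>-i\<^esup> 2\<^bsup>-j\<^esup>)\<^sup>a\<close>; the total is
\<open>C (2\<^bsup>1-a\<^esup>)\<^bsup>i+j\<^esup> = C \<eta>\<^sup>m\<close> for \<open>\<eta> = \<mu>\<^bsup>2(i+j)\<^esup>\<close>, so \<open>cell_bound\<close> has expectation at most \<open>(1 + C) \<eta>\<close>. If \<open>i\<close> or \<open>j\<close> is at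
least \<open>k\<close>, half of the exponent in \<open>\<mu>\<^bsup>2(i+j)\<^esup>\<close> is spent on the factor \<open>\<mu>\<^sup>k\<close> and the other half makes the double
series converge.\<close>

lemma nn_integral_chain_bound:
  assumes m: "even m" "0 < m" and mu: "0 < \<mu>" "\<mu> < 1" "\<mu> ^ (2 * m) = 2 powr (1 - a)" and a: "1 < a" and C: "0 \<le> C"
    and M: "prob_space M"
    and meas: "\<And>p. p \<in> unit_square \<Longrightarrow> (\<lambda>\<omega>. X \<omega> p) \<in> borel_measurable M"
    and mom: "\<And>s s' t t'. 0 \<le> s \<Longrightarrow> s < s' \<Longrightarrow> s' \<le> 1 \<Longrightarrow> 0 \<le> t \<Longrightarrow> t < t' \<Longrightarrow> t' \<le> 1 \<Longrightarrow>
      (\<integral>\<^sup>+\<omega>. ennreal ((rect_incr (X \<omega>) s t s' t') ^ m) \<partial>M) \<le> ennreal (C * ((s' - s) * (t' - t)) powr a)"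
  shows "(\<lambda>\<omega>. chain_bound \<mu> m k (X \<omega>)) \<in> borel_measurable M"
    and "(\<integral>\<^sup>+\<omega>. chain_bound \<mu> m k (X \<omega>) \<partial>M) \<le> ennreal ((1 + C) * \<mu> ^ k / (1 - \<mu>) ^ 2)"
proof -
  interpret prob_space M by fact
  have cellm: "(\<lambda>\<omega>. dyad_cell (X \<omega>) i j r q) \<in> borel_measurable M" if "r < 2 ^ i" "q < 2 ^ j" for i j r q
    unfolding dyad_cell_def rect_incr_def
    by (intro borel_measurable_add borel_measurable_diff meas SigmaI dyad_cell_mem that)
  have cbm [measurable]: "(\<lambda>\<omega>. cell_bound \<mu> m (X \<omega>) i j) \<in> borel_measurable M" for i j
    unfolding cell_bound_def
    by (intro borel_measurable_add borel_measurable_const borel_measurable_divide borel_measurable_sum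
        borel_measurable_power cellm) auto
  show "(\<lambda>\<omega>. chain_bound \<mu> m k (X \<omega>)) \<in> borel_measurable M"
    unfolding chain_bound_def by measurable
  have cb: "(\<integral>\<^sup>+\<omega>. ennreal (cell_bound \<mu> m (X \<omega>) i j) \<partial>M) \<le> ennreal ((1 + C) * \<mu> ^ (2 * (i + j)))" for i j
  proof -
    let ?\<eta> = "\<mu> ^ (2 * (i + j))"
    let ?D = "?\<eta> ^ (m - 1)"
    have eta: "?\<eta> > 0" using mu by simp
    have D: "?D > 0" using mu by simp
    let ?v = "C * ((1 / 2 ^ Suc i) * (1 / 2 ^ Suc j)) powr a"
    have cell: "(\<integral>\<^sup>+\<omega>. ennreal ((dyad_cell (X \<omega>) i j r q) ^ m) \<partial>M) \<le> ennreal ?v" if "r < 2 ^ i" "q < 2 ^ j" for r q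
    proof -
      have "(2 * real r + 1) / 2 ^ Suc i - 2 * real r / 2 ^ Suc i = 1 / 2 ^ Suc i" for r i by (simp add: field_simps)
      then show ?thesis
        unfolding dyad_cell_def
        using mom[OF dyad_cell_points[OF that(1)] dyad_cell_points[OF that(2)]] by simp
    qed
    have "(\<integral>\<^sup>+\<omega>. ennreal (cell_bound \<mu> m (X \<omega>) i j) \<partial>M) =
      (\<integral>\<^sup>+\<omega>. ennreal ?\<eta> + (\<Sum>r<2 ^ i. \<Sum>q<2 ^ j. ennreal (1 / ?D) * ennreal ((dyad_cell (X \<omega>) i j r q) ^ m)) \<partial>M)"
    proof (rule nn_integral_cong)
      fix \<omega>
      have nn: "0 \<le> (1 / ?D) * (dyad_cell (X \<omega>) i j r q) ^ m" for r q
        using D m by (intro mult_nonneg_nonneg) (auto simp: zero_le_even_power)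
      have e1: "cell_bound \<mu> m (X \<omega>) i j = ?\<eta> + (\<Sum>r<2 ^ i. \<Sum>q<2 ^ j. (1 / ?D) * (dyad_cell (X \<omega>) i j r q) ^ m)"
        by (simp add: cell_bound_def sum_divide_distrib)
      have e2: "(\<Sum>r<2 ^ i. \<Sum>q<2 ^ j. ennreal (1 / ?D) * ennreal ((dyad_cell (X \<omega>) i j r q) ^ m)) =
          (\<Sum>r<2 ^ i. \<Sum>q<2 ^ j. ennreal ((1 / ?D) * (dyad_cell (X \<omega>) i j r q) ^ m))"
        using D m by (intro sum.cong refl ennreal_mult[symmetric]) (auto simp: zero_le_even_power)
      show "ennreal (cell_bound \<mu> m (X \<omega>) i j) = ennreal ?\<eta> +
        (\<Sum>r<2 ^ i. \<Sum>q<2 ^ j. ennreal (1 / ?D) * ennreal ((dyad_cell (X \<omega>) i j r q) ^ m))"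
        unfolding e1 e2 sum_sum_ennreal[OF nn, symmetric]
        by (rule ennreal_plus[OF less_imp_le[OF eta]]) (intro sum_nonneg nn)
    qed
    also have "\<dots> = ennreal ?\<eta> + (\<Sum>r<2 ^ i. \<Sum>q<2 ^ j. ennreal (1 / ?D) * (\<integral>\<^sup>+\<omega>. ennreal ((dyad_cell (X \<omega>) i j r q) ^ m) \<partial>M))"
    proof -
      have cm: "(\<lambda>\<omega>. ennreal (1 / ?D) * ennreal ((dyad_cell (X \<omega>) i j r q) ^ m)) \<in> borel_measurable M"
        if "r < 2 ^ i" "q < 2 ^ j" for r q
        by (intro borel_measurable_times_ennreal borel_measurable_const measurable_compose[OF _ measurable_ennreal]
            borel_measurable_power cellm that)
      have "(\<integral>\<^sup>+\<omega>. (\<Sum>r<2 ^ i. \<Sum>q<2 ^ j. ennreal (1 / ?D) * ennreal ((dyad_cell (X \<omega>) i j r q) ^ m)) \<partial>M) =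
        (\<Sum>r<2 ^ i. \<integral>\<^sup>+\<omega>. (\<Sum>q<2 ^ j. ennreal (1 / ?D) * ennreal ((dyad_cell (X \<omega>) i j r q) ^ m)) \<partial>M)"
        by (rule nn_integral_sum) (intro borel_measurable_sum cm; simp)
      also have "\<dots> = (\<Sum>r<2 ^ i. \<Sum>q<2 ^ j. \<integral>\<^sup>+\<omega>. ennreal (1 / ?D) * ennreal ((dyad_cell (X \<omega>) i j r q) ^ m) \<partial>M)"
        by (rule sum.cong[OF refl], rule nn_integral_sum) (rule cm; simp)
      also have "\<dots> = (\<Sum>r<2 ^ i. \<Sum>q<2 ^ j. ennreal (1 / ?D) * (\<integral>\<^sup>+\<omega>. ennreal ((dyad_cell (X \<omega>) i j r q) ^ m) \<partial>M))"
        by (rule sum.cong[OF refl], rule sum.cong[OF refl], rule nn_integral_cmult)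
           (intro measurable_compose[OF _ measurable_ennreal] borel_measurable_power cellm; simp)
      finally have int_sum: "(\<integral>\<^sup>+\<omega>. (\<Sum>r<2 ^ i. \<Sum>q<2 ^ j. ennreal (1 / ?D) * ennreal ((dyad_cell (X \<omega>) i j r q) ^ m)) \<partial>M) =
        (\<Sum>r<2 ^ i. \<Sum>q<2 ^ j. ennreal (1 / ?D) * (\<integral>\<^sup>+\<omega>. ennreal ((dyad_cell (X \<omega>) i j r q) ^ m) \<partial>M))" .
      have "(\<integral>\<^sup>+\<omega>. ennreal ?\<eta> + (\<Sum>r<2 ^ i. \<Sum>q<2 ^ j. ennreal (1 / ?D) * ennreal ((dyad_cell (X \<omega>) i j r q) ^ m)) \<partial>M) =
        (\<integral>\<^sup>+\<omega>. ennreal ?\<eta> \<partial>M) + (\<integral>\<^sup>+\<omega>. (\<Sum>r<2 ^ i. \<Sum>q<2 ^ j. ennreal (1 / ?D) * ennreal ((dyad_cell (X \<omega>) i j r q) ^ m)) \<partial>M)"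
        by (rule nn_integral_add) ((intro borel_measurable_const borel_measurable_sum cm; simp)+)
      then show ?thesis unfolding int_sum by (simp add: emeasure_space_1)
    qed
    also have "\<dots> \<le> ennreal ?\<eta> + (\<Sum>r<(2::nat) ^ i. \<Sum>q<(2::nat) ^ j. ennreal (1 / ?D) * ennreal ?v)"
      by (intro add_left_mono sum_mono mult_left_mono cell) auto
    also have "\<dots> = ennreal (?\<eta> + 2 ^ i * (2 ^ j * (1 / ?D * ?v)))"
    proof -
      have "(\<Sum>r<(2::nat) ^ i. \<Sum>q<(2::nat) ^ j. ennreal (1 / ?D) * ennreal ?v) = (\<Sum>r<(2::nat) ^ i. \<Sum>q<(2::nat) ^ j. ennreal (1 / ?D * ?v))"
        using D C by (intro sum.cong refl ennreal_mult[symmetric]) auto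
      also have "\<dots> = ennreal (\<Sum>r<(2::nat) ^ i. \<Sum>q<(2::nat) ^ j. 1 / ?D * ?v)"
        by (rule sum_sum_ennreal[symmetric]) (use D C in simp)
      also have "\<dots> = ennreal (2 ^ i * (2 ^ j * (1 / ?D * ?v)))" by simp
      finally show ?thesis using eta D C by (subst ennreal_plus) auto
    qed
    also have "\<dots> \<le> ennreal ((1 + C) * ?\<eta>)"
    proof (rule ennreal_leI)
      have half: "2 ^ n * (1 / 2 ^ Suc n) powr a \<le> (\<mu> ^ (2 * m)) ^ n" for n
      proof -
        have "(1 / 2 ^ Suc n) powr a \<le> (1 / 2 ^ n) powr a" using a by (intro powr_mono2) (auto simp: field_simps)
        also have "(1 / 2 ^ n) powr a = (2 powr (- real n)) powr a" by (simp add: powr_minus powr_realpow field_simps)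
        also have "\<dots> = 2 powr (- real n * a)" by (simp add: powr_powr)
        finally have "2 ^ n * (1 / 2 ^ Suc n) powr a \<le> 2 ^ n * 2 powr (- real n * a)" by simp
        also have "\<dots> = 2 powr (real n) * 2 powr (- real n * a)" by (simp add: powr_realpow)
        also have "\<dots> = 2 powr ((1 - a) * real n)" by (simp add: powr_add[symmetric] algebra_simps)
        also have "\<dots> = (\<mu> ^ (2 * m)) ^ n" unfolding mu(3) by (simp add: powr_powr[symmetric] powr_realpow)
        finally show ?thesis .
      qed
      have "2 ^ i * (2 ^ j * (1 / ?D * ?v)) = C / ?D * ((2 ^ i * (1 / 2 ^ Suc i) powr a) * (2 ^ j * (1 / 2 ^ Suc j) powr a))"
        by (subst powr_mult) (auto simp: field_simps)
      also have "\<dots> \<le> C / ?D * ((\<mu> ^ (2 * m)) ^ i * (\<mu> ^ (2 * m)) ^ j)"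
        using C D half mu by (intro mult_left_mono mult_mono) auto
      also have "(\<mu> ^ (2 * m)) ^ i * (\<mu> ^ (2 * m)) ^ j = ?\<eta> ^ m"
        by (simp add: power_mult[symmetric] power_add[symmetric] algebra_simps)
      also have "\<dots> = ?D * ?\<eta>" using m by (simp add: power_eq_if mult.commute)
      also have "C / ?D * (?D * ?\<eta>) = C * ?\<eta>" using D by simp
      finally show "?\<eta> + 2 ^ i * (2 ^ j * (1 / ?D * ?v)) \<le> (1 + C) * ?\<eta>" by (simp add: algebra_simps)
    qed
    finally show ?thesis .
  qed
  have "(\<integral>\<^sup>+\<omega>. chain_bound \<mu> m k (X \<omega>) \<partial>M) =
    (\<Sum>i. \<Sum>j. \<integral>\<^sup>+\<omega>. ennreal (if k \<le> i \<or> k \<le> j then cell_bound \<mu> m (X \<omega>) i j else 0) \<partial>M)"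
    unfolding chain_bound_def by (subst nn_integral_suminf; (subst nn_integral_suminf)?) measurable
  also have "\<dots> \<le> (\<Sum>i. \<Sum>j. ennreal (((1 + C) * \<mu> ^ k) * \<mu> ^ i * \<mu> ^ j))"
  proof (intro suminf_le summableI)
    fix i j
    show "(\<integral>\<^sup>+\<omega>. ennreal (if k \<le> i \<or> k \<le> j then cell_bound \<mu> m (X \<omega>) i j else 0) \<partial>M) \<le>
      ennreal (((1 + C) * \<mu> ^ k) * \<mu> ^ i * \<mu> ^ j)"
    proof (cases "k \<le> i \<or> k \<le> j")
      case True
      have "\<mu> ^ (2 * (i + j)) = \<mu> ^ (i + j) * \<mu> ^ (i + j)" by (simp add: mult_2 power_add)
      also have "\<dots> \<le> \<mu> ^ k * \<mu> ^ (i + j)"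
        using True mu by (intro mult_right_mono power_decreasing) auto
      finally have "(1 + C) * \<mu> ^ (2 * (i + j)) \<le> ((1 + C) * \<mu> ^ k) * \<mu> ^ i * \<mu> ^ j"
        using C by (simp add: power_add mult_left_mono mult.assoc)
      then show ?thesis using True by (auto intro!: order_trans[OF cb] ennreal_leI)
    qed auto
  qed
  also have "\<dots> = ennreal (((1 + C) * \<mu> ^ k) / (1 - \<mu>) ^ 2)"
    by (rule suminf_ennreal_geometric2) (use mu C in auto)
  finally show "(\<integral>\<^sup>+\<omega>. chain_bound \<mu> m k (X \<omega>) \<partial>M) \<le> ennreal ((1 + C) * \<mu> ^ k / (1 - \<mu>) ^ 2)" by simp
qed

section \<open>Time change\<close>

text \<open>\<open>\<tau>\<close> inverts \<open>\<sigma>\<close>, and in the new time the increments of \<open>G\<close> are at most linear.\<close>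

definition time_change :: "(real \<Rightarrow> real) \<Rightarrow> (real \<Rightarrow> real) \<Rightarrow> (real \<Rightarrow> real) \<Rightarrow> real \<Rightarrow> bool" where
  "time_change G \<tau> \<sigma> c \<longleftrightarrow> c > 0 \<and> (\<forall>s\<in>{0..1}. \<tau> s \<in> {0..1} \<and> \<sigma> s \<in> {0..1} \<and> \<tau> (\<sigma> s) = s) \<and>
     continuous_on {0..1} \<tau> \<and> \<tau> 0 = 0 \<and>
     (\<forall>x y. 0 \<le> x \<and> x < y \<and> y \<le> 1 \<longrightarrow> \<tau> x < \<tau> y \<and> G (\<tau> y) - G (\<tau> x) \<le> c * (y - x))"

text \<open>\<open>G\<close> may be constant on intervals, so the normalised function \<open>s \<mapsto> G s + s\<close>, which is strictly increasing, is
inverted instead.\<close>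

lemma time_change_exists:
  fixes G :: "real \<Rightarrow> real"
  assumes mono: "mono_on {0..1} G" and cont: "continuous_on {0..1} G"
  shows "\<exists>\<tau> \<sigma> c. time_change G \<tau> \<sigma> c"
proof -
  define c where "c = G 1 + 1 - G 0"
  define \<sigma> where "\<sigma> s = (G s + s - G 0) / c" for s
  have c: "c > 0" using mono_onD[OF mono, of 0 1] by (simp add: c_def)
  have Gm: "x \<in> {0..1} \<Longrightarrow> y \<in> {0..1} \<Longrightarrow> x \<le> y \<Longrightarrow> G x \<le> G y" for x y
    using mono by (rule mono_onD)
  have smono: "strict_mono_on {0..1} \<sigma>"
    by (intro strict_mono_onI) (use c Gm in \<open>force simp: \<sigma>_def divide_strict_right_mono intro!: divide_strict_right_mono add_le_less_mono\<close>)
  have inj: "inj_on \<sigma> {0..1}" using smono by (rule strict_mono_on_imp_inj_on)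
  have cs: "continuous_on {0..1} \<sigma>" unfolding \<sigma>_def using c by (intro continuous_intros cont) auto
  have s0: "\<sigma> 0 = 0" "\<sigma> 1 = 1" using c by (auto simp: \<sigma>_def c_def)
  have sub: "\<sigma> ` {0..1} \<subseteq> {0..1}"
  proof safe
    fix s :: real assume s: "s \<in> {0..1}"
    have "\<sigma> 0 \<le> \<sigma> s" "\<sigma> s \<le> \<sigma> 1" using strict_mono_on_leD[OF smono] s by auto
    then show "\<sigma> s \<in> {0..1}" by (simp add: s0)
  qed
  have img: "\<sigma> ` {0..1} = {0..1}"
  proof
    show "{0..1} \<subseteq> \<sigma> ` {0..1}"
    proof
      fix y :: real assume "y \<in> {0..1}"
      then obtain x where "0 \<le> x" "x \<le> 1" "\<sigma> x = y" using IVT'[of \<sigma> 0 y 1] cs s0 by auto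
      then show "y \<in> \<sigma> ` {0..1}" by auto
    qed
  qed (rule sub)
  define \<tau> where "\<tau> = inv_into {0..1} \<sigma>"
  have ts: "s \<in> {0..1} \<Longrightarrow> \<tau> (\<sigma> s) = s" for s unfolding \<tau>_def by (rule inv_into_f_f[OF inj])
  have st: "y \<in> {0..1} \<Longrightarrow> \<sigma> (\<tau> y) = y" for y unfolding \<tau>_def by (rule f_inv_into_f) (simp add: img)
  have tm: "y \<in> {0..1} \<Longrightarrow> \<tau> y \<in> {0..1}" for y unfolding \<tau>_def by (rule inv_into_into) (simp add: img)
  have tmono: "strict_mono_on {0..1} \<tau>"
  proof (rule strict_mono_onI)
    fix x y :: real assume xy: "x \<in> {0..1}" "y \<in> {0..1}" "x < y"
    show "\<tau> x < \<tau> y"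
    proof (rule ccontr)
      assume "\<not> \<tau> x < \<tau> y"
      then have "\<sigma> (\<tau> y) \<le> \<sigma> (\<tau> x)" using strict_mono_on_leD[OF smono] tm xy by auto
      then show False using st xy by auto
    qed
  qed
  have "time_change G \<tau> \<sigma> c"
    unfolding time_change_def
  proof (intro conjI allI impI ballI c)
    show "continuous_on {0..1} \<tau>"
      using continuous_on_inv[OF cs, of \<tau>] ts img by auto
    show "\<tau> 0 = 0" using ts[of 0] s0 by simp
    fix x y :: real assume "0 \<le> x \<and> x < y \<and> y \<le> 1"
    then have xy: "0 \<le> x" "x < y" "y \<le> 1" by auto
    have "G (\<tau> z) + \<tau> z - G 0 = c * z" if "z \<in> {0..1}" for z
      using st[OF that] c by (simp add: \<sigma>_def field_simps)
    from this[of x] this[of y] xy have "G (\<tau> y) - G (\<tau> x) = c * (y - x) - (\<tau> y - \<tau> x)" by (auto simp: algebra_simps)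
    moreover show "\<tau> x < \<tau> y" using strict_mono_onD[OF tmono, of x y] xy by auto
    ultimately show "G (\<tau> y) - G (\<tau> x) \<le> c * (y - x)" by simp
  next
    fix s :: real assume "s \<in> {0..1}"
    then show "\<tau> s \<in> {0..1}" "\<sigma> s \<in> {0..1}" "\<tau> (\<sigma> s) = s" using tm sub ts by blast+
  qed
  then show ?thesis by blast
qed

lemma mesh_time_change:
  assumes tc1: "time_change G1 \<tau>1 \<sigma>1 c1" and tc2: "time_change G2 \<tau>2 \<sigma>2 c2"
  shows "mesh (\<lambda>k p. (\<tau>1 (dyad k (\<sigma>1 (fst p))), \<tau>2 (dyad k (\<sigma>2 (snd p)))))"
proof -
  note t1 = tc1[unfolded time_change_def] and t2 = tc2[unfolded time_change_def]
  show ?thesis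
  unfolding mesh_def
proof (intro conjI allI)
  fix k
  let ?P = "\<lambda>p. (\<tau>1 (dyad k (\<sigma>1 (fst p))), \<tau>2 (dyad k (\<sigma>2 (snd p))))"
  have d: "dyad k (\<sigma>1 s) \<in> {0..1}" "dyad k (\<sigma>2 s) \<in> {0..1}" if "s \<in> {0..1}" for s
    using that t1 t2 dyad_mem by blast+
  show "?P ` unit_square \<subseteq> unit_square"
  proof
    fix p' assume "p' \<in> ?P ` unit_square"
    then obtain p where p: "p \<in> unit_square" "p' = ?P p" by blast
    then have "fst p \<in> {0..1}" "snd p \<in> {0..1}" by auto
    then have "\<tau>1 (dyad k (\<sigma>1 (fst p))) \<in> {0..1}" "\<tau>2 (dyad k (\<sigma>2 (snd p))) \<in> {0..1}" using d t1 t2 by blast+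
    then show "p' \<in> unit_square" using p(2) by simp
  qed
  have "?P ` unit_square \<subseteq> (\<tau>1 ` dyad k ` {0..1}) \<times> (\<tau>2 ` dyad k ` {0..1})"
  proof
    fix p' assume "p' \<in> ?P ` unit_square"
    then obtain p where p: "p \<in> unit_square" "p' = ?P p" by blast
    then have "fst p \<in> {0..1}" "snd p \<in> {0..1}" by auto
    then have "\<sigma>1 (fst p) \<in> {0..1}" "\<sigma>2 (snd p) \<in> {0..1}" using t1 t2 by blast+
    then show "p' \<in> (\<tau>1 ` dyad k ` {0..1}) \<times> (\<tau>2 ` dyad k ` {0..1})" using p(2) by blast
  qed
  then show "finite (?P ` unit_square)"
    by (rule finite_subset) (intro finite_cartesian_product finite_imageI finite_dyad)
next
  let ?P = "\<lambda>k p. (\<tau>1 (dyad k (\<sigma>1 (fst p))), \<tau>2 (dyad k (\<sigma>2 (snd p))))"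
  have one: "uniform_limit unit_square (\<lambda>k p. \<tau> (dyad k (\<sigma> (f p)))) f sequentially"
    if t: "\<And>s. s \<in> {0..1} \<Longrightarrow> \<sigma> s \<in> {0..1}" "continuous_on {0..1} \<tau>" "\<And>s. s \<in> {0..1} \<Longrightarrow> \<tau> (\<sigma> s) = s"
      and f: "\<And>p. p \<in> unit_square \<Longrightarrow> f p \<in> {0..1}" for \<tau> \<sigma> and f :: "real \<times> real \<Rightarrow> real"
  proof (rule uniform_limitI)
    fix e :: real assume e: "e > 0"
    have "uniformly_continuous_on {0..1} \<tau>" by (rule compact_uniformly_continuous[OF t(2)]) simp
    then obtain d where d: "d > 0" "\<And>x y. x \<in> {0..1} \<Longrightarrow> y \<in> {0..1} \<Longrightarrow> dist y x < d \<Longrightarrow> dist (\<tau> y) (\<tau> x) < e"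
      unfolding uniformly_continuous_on_def using e by metis
    have "(\<lambda>k. (1/2 :: real) ^ k) \<longlonglongrightarrow> 0" by (rule LIMSEQ_power_zero) auto
    from order_tendstoD(2)[OF this d(1)]
    show "\<forall>\<^sub>F k in sequentially. \<forall>p\<in>unit_square. dist (\<tau> (dyad k (\<sigma> (f p)))) (f p) < e"
    proof (rule eventually_mono, intro ballI)
      fix k p assume k: "(1/2 :: real) ^ k < d" and p: "p \<in> unit_square"
      have s: "\<sigma> (f p) \<in> {0..1}" using t(1)[OF f[OF p]] .
      have "dist (dyad k (\<sigma> (f p))) (\<sigma> (f p)) < d"
        using dyad_close[OF s, of k] k by (simp add: dist_real_def)
      from d(2)[OF s dyad_mem[OF s] this] show "dist (\<tau> (dyad k (\<sigma> (f p)))) (f p) < e"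
        using t(3)[OF f[OF p]] by simp
    qed
  qed
  have u1: "uniform_limit unit_square (\<lambda>k p. \<tau>1 (dyad k (\<sigma>1 (fst p)))) fst sequentially"
    by (rule one) (use t1 in auto)
  have u2: "uniform_limit unit_square (\<lambda>k p. \<tau>2 (dyad k (\<sigma>2 (snd p)))) snd sequentially"
    by (rule one) (use t2 in auto)
  show "uniform_limit unit_square ?P (\<lambda>p. p) sequentially"
  proof (rule uniform_limitI)
    fix e :: real assume "e > 0"
    then have "e / 2 > 0" by simp
    from uniform_limitD[OF u1 this] uniform_limitD[OF u2 this]
    show "\<forall>\<^sub>F k in sequentially. \<forall>p\<in>unit_square. dist (?P k p) p < e"
    proof (rule eventually_elim2, intro ballI)
      fix k and p :: "real \<times> real"
      assume "\<forall>p\<in>unit_square. dist (\<tau>1 (dyad k (\<sigma>1 (fst p)))) (fst p) < e / 2"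
        "\<forall>p\<in>unit_square. dist (\<tau>2 (dyad k (\<sigma>2 (snd p)))) (snd p) < e / 2" "p \<in> unit_square"
      then have "dist (\<tau>1 (dyad k (\<sigma>1 (fst p)))) (fst p) + dist (\<tau>2 (dyad k (\<sigma>2 (snd p)))) (snd p) < e"
        by force
      moreover have "dist (?P k p) p \<le> dist (\<tau>1 (dyad k (\<sigma>1 (fst p)))) (fst p) + dist (\<tau>2 (dyad k (\<sigma>2 (snd p)))) (snd p)"
        unfolding dist_prod_def by (simp add: sqrt_sum_squares_le_sum)
      ultimately show "dist (?P k p) p < e" by linarith
    qed
  qed
qed
qed

text \<open>Being stated with the nonnegative integral, the bound includes that the moments are finite.\<close>

definition rect_moment :: "'a measure \<Rightarrow> ('a \<Rightarrow> real \<times> real \<Rightarrow> real) \<Rightarrow> nat \<Rightarrow>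
   (real \<Rightarrow> real) \<Rightarrow> real \<Rightarrow> (real \<Rightarrow> real) \<Rightarrow> real \<Rightarrow> real \<Rightarrow> bool" where
  "rect_moment M X m G1 a1 G2 a2 C \<longleftrightarrow> (\<forall>s s' t t'. 0 \<le> s \<and> s < s' \<and> s' \<le> 1 \<and> 0 \<le> t \<and> t < t' \<and> t' \<le> 1 \<longrightarrow>
     (\<integral>\<^sup>+\<omega>. ennreal ((rect_incr (X \<omega>) s t s' t') ^ m) \<partial>M) \<le> ennreal (C * (G1 s' - G1 s) powr a1 * (G2 t' - G2 t) powr a2))"

definition null_on_axes :: "(real \<times> real \<Rightarrow> real) \<Rightarrow> bool" where
  "null_on_axes x \<longleftrightarrow> (\<forall>u\<in>{0..1}. x (0, u) = 0 \<and> x (u, 0) = 0)"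

text \<open>The mesh \<open>P\<close> and the rate \<open>e\<close> are the same for all \<open>n\<close>: they depend only on \<open>G1\<close>, \<open>G2\<close>, the exponents, \<open>m\<close> and \<open>C\<close>.
The process is read in the new times, where the dyadic chaining applies, and the mesh is the dyadic mesh
carried back.\<close>

theorem equicontinuity_of_rect_moment:
  fixes G1 G2 :: "real \<Rightarrow> real" and X :: "nat \<Rightarrow> 'a \<Rightarrow> real \<times> real \<Rightarrow> real"
  assumes G1: "mono_on {0..1} G1" "continuous_on {0..1} G1" and G2: "mono_on {0..1} G2" "continuous_on {0..1} G2"
    and a: "1 < a1" "1 < a2" and C: "0 \<le> C" and m: "even m" "0 < m"
    and M: "prob_space M"
    and meas: "\<And>n p. p \<in> unit_square \<Longrightarrow> (\<lambda>\<omega>. X n \<omega> p) \<in> borel_measurable M"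
    and cont: "\<And>n \<omega>. \<omega> \<in> space M \<Longrightarrow> continuous_on unit_square (X n \<omega>)"
    and zero: "\<And>n \<omega>. \<omega> \<in> space M \<Longrightarrow> null_on_axes (X n \<omega>)"
    and mom: "\<And>n. rect_moment M (X n) m G1 a1 G2 a2 C"
  obtains P R e where "mesh P" "e \<longlonglongrightarrow> (0::real)" "\<And>k. 0 \<le> e k" "\<And>n k. R n k \<in> borel_measurable M"
    "\<And>n k \<omega> p. \<omega> \<in> space M \<Longrightarrow> p \<in> unit_square \<Longrightarrow> ennreal \<bar>X n \<omega> p - X n \<omega> (P k p)\<bar> \<le> R n k \<omega>"
    "\<And>n k. (\<integral>\<^sup>+\<omega>. R n k \<omega> \<partial>M) \<le> ennreal (e k)"
proof -
  obtain \<tau>1 \<sigma>1 c1 where tc1: "time_change G1 \<tau>1 \<sigma>1 c1" using time_change_exists[OF G1] by blast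
  obtain \<tau>2 \<sigma>2 c2 where tc2: "time_change G2 \<tau>2 \<sigma>2 c2" using time_change_exists[OF G2] by blast
  note t1 = tc1[unfolded time_change_def] and t2 = tc2[unfolded time_change_def]
  have tm: "s \<in> {0..1} \<Longrightarrow> \<tau>1 s \<in> {0..1}" "s \<in> {0..1} \<Longrightarrow> \<tau>2 s \<in> {0..1}" for s using t1 t2 by blast+
  have sm: "s \<in> {0..1} \<Longrightarrow> \<sigma>1 s \<in> {0..1}" "s \<in> {0..1} \<Longrightarrow> \<sigma>2 s \<in> {0..1}" for s using t1 t2 by blast+
  have ct: "continuous_on {0..1} \<tau>1" "continuous_on {0..1} \<tau>2" using t1 t2 by blast+
  define P where "P k p = (\<tau>1 (dyad k (\<sigma>1 (fst p))), \<tau>2 (dyad k (\<sigma>2 (snd p))))" for k p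
  define Y where "Y n \<omega> = (\<lambda>p. X n \<omega> (\<tau>1 (fst p), \<tau>2 (snd p)))" for n \<omega>
  define a where "a = min a1 a2"
  \<comment> \<open>chosen so that \<open>\<mu>\<^bsup>2m\<^esup> = 2\<^bsup>1-a\<^esup>\<close>, the ratio of the total moments of the cells of consecutive levels\<close>
  define \<mu> :: real where "\<mu> = 2 powr ((1 - a) / (2 * real m))"
  define D where "D = C * c1 powr a1 * c2 powr a2"
  have a1: "1 < a" using a by (simp add: a_def)
  have D: "0 \<le> D" using C by (simp add: D_def)
  have mu: "0 < \<mu>" "\<mu> < 1" "\<mu> ^ (2 * m) = 2 powr (1 - a)"
  proof -
    show "\<mu> < 1" unfolding \<mu>_def using a1 m by (intro powr_less_one divide_neg_pos) auto
    show "\<mu> ^ (2 * m) = 2 powr (1 - a)"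
      unfolding \<mu>_def using m by (subst powr_realpow[symmetric]) (auto simp: powr_powr)
  qed (simp add: \<mu>_def)
  have Tm: "(\<tau>1 (fst p), \<tau>2 (snd p)) \<in> unit_square" if "p \<in> unit_square" for p
  proof -
    have "fst p \<in> {0..1}" "snd p \<in> {0..1}" using that by auto
    then show ?thesis by (intro SigmaI tm)
  qed
  have Ymeas: "(\<lambda>\<omega>. Y n \<omega> p) \<in> borel_measurable M" if "p \<in> unit_square" for n p
    unfolding Y_def by (rule meas[OF Tm[OF that]])
  have Ymom: "(\<integral>\<^sup>+\<omega>. ennreal ((rect_incr (Y n \<omega>) s t s' t') ^ m) \<partial>M) \<le> ennreal (D * ((s' - s) * (t' - t)) powr a)"
    if st: "0 \<le> s" "s < s'" "s' \<le> 1" "0 \<le> t" "t < t'" "t' \<le> 1" for n s s' t t'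
  proof -
    have pw: "(G (\<tau> y) - G (\<tau> x)) powr b \<le> c powr b * (y - x) powr a"
      if "0 \<le> x" "x < y" "y \<le> 1" "G (\<tau> y) - G (\<tau> x) \<le> c * (y - x)" "0 \<le> G (\<tau> y) - G (\<tau> x)" "a \<le> b" "0 < c"
      for G \<tau> :: "real \<Rightarrow> real" and x y b c
    proof -
      have "(G (\<tau> y) - G (\<tau> x)) powr b \<le> (c * (y - x)) powr b"
        using that a1 by (intro powr_mono2) auto
      also have "\<dots> = c powr b * (y - x) powr b" using that by (simp add: powr_mult)
      also have "\<dots> \<le> c powr b * (y - x) powr a"
        using that by (intro mult_left_mono powr_mono') auto
      finally show ?thesis .
    qed
    have 1: "\<tau>1 s < \<tau>1 s'" "\<tau>2 t < \<tau>2 t'"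
      using t1 t2 st by blast+
    have 2: "\<tau>1 s \<in> {0..1}" "\<tau>1 s' \<in> {0..1}" "\<tau>2 t \<in> {0..1}" "\<tau>2 t' \<in> {0..1}"
      using st by (intro tm; simp)+
    have 3: "0 \<le> G1 (\<tau>1 s') - G1 (\<tau>1 s)" "0 \<le> G2 (\<tau>2 t') - G2 (\<tau>2 t)"
      using mono_onD[OF G1(1), of "\<tau>1 s" "\<tau>1 s'"] mono_onD[OF G2(1), of "\<tau>2 t" "\<tau>2 t'"] 1 2 by auto
    have "rect_incr (Y n \<omega>) s t s' t' = rect_incr (X n \<omega>) (\<tau>1 s) (\<tau>2 t) (\<tau>1 s') (\<tau>2 t')" for \<omega>
      by (simp add: rect_incr_def Y_def)
    then have "(\<integral>\<^sup>+\<omega>. ennreal ((rect_incr (Y n \<omega>) s t s' t') ^ m) \<partial>M) \<le>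
       ennreal (C * (G1 (\<tau>1 s') - G1 (\<tau>1 s)) powr a1 * (G2 (\<tau>2 t') - G2 (\<tau>2 t)) powr a2)"
      using mom[of n] 1 2 by (simp add: rect_moment_def)
    also have "\<dots> \<le> ennreal (C * (c1 powr a1 * (s' - s) powr a) * (c2 powr a2 * (t' - t) powr a))"
    proof (rule ennreal_leI, rule mult_mono[OF mult_left_mono[OF _ C]])
      have "G1 (\<tau>1 s') - G1 (\<tau>1 s) \<le> c1 * (s' - s)" "0 < c1" using t1 st by blast+
      then show "(G1 (\<tau>1 s') - G1 (\<tau>1 s)) powr a1 \<le> c1 powr a1 * (s' - s) powr a"
        by (intro pw st 3) (simp_all add: a_def)
      have "G2 (\<tau>2 t') - G2 (\<tau>2 t) \<le> c2 * (t' - t)" "0 < c2" using t2 st by blast+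
      then show "(G2 (\<tau>2 t') - G2 (\<tau>2 t)) powr a2 \<le> c2 powr a2 * (t' - t) powr a"
        by (intro pw st 3) (simp_all add: a_def)
    qed (use C in \<open>simp_all add: mult_nonneg_nonneg\<close>)
    also have "C * (c1 powr a1 * (s' - s) powr a) * (c2 powr a2 * (t' - t) powr a) = D * ((s' - s) * (t' - t)) powr a"
      using st by (simp add: D_def powr_mult)
    finally show ?thesis .
  qed
  have Ycont: "continuous_on unit_square (Y n \<omega>)" if "\<omega> \<in> space M" for n \<omega>
    unfolding Y_def
  proof (rule continuous_on_compose2[OF cont[OF that]])
    have "fst ` unit_square \<subseteq> {0..1}" "snd ` unit_square \<subseteq> {0..1}" by auto
    then show "continuous_on unit_square (\<lambda>p. (\<tau>1 (fst p), \<tau>2 (snd p)))"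
      by (intro continuous_on_Pair continuous_on_compose2[OF ct(1)] continuous_on_compose2[OF ct(2)]
          continuous_on_fst continuous_on_snd continuous_on_id)
    show "(\<lambda>p. (\<tau>1 (fst p), \<tau>2 (snd p))) ` unit_square \<subseteq> unit_square" by (intro image_subsetI Tm)
  qed
  have Yzero: "Y n \<omega> (0, u) = 0" "Y n \<omega> (u, 0) = 0" if "\<omega> \<in> space M" "u \<in> {0..1}" for n \<omega> u
  proof -
    have "\<tau>1 u \<in> {0..1}" "\<tau>2 u \<in> {0..1}" "\<tau>1 0 = 0" "\<tau>2 0 = 0" using tm that(2) t1 t2 by blast+
    then show "Y n \<omega> (0, u) = 0" "Y n \<omega> (u, 0) = 0"
      using zero[OF that(1), of n] by (simp_all add: Y_def null_on_axes_def)
  qed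
  note cb = nn_integral_chain_bound[OF m mu a1 D M Ymeas Ymom]
  show thesis
  proof (rule that[of P "\<lambda>k. (1 + D) * \<mu> ^ k / (1 - \<mu>) ^ 2" "\<lambda>n k \<omega>. chain_bound \<mu> m k (Y n \<omega>)"])
    show "mesh P" unfolding P_def by (rule mesh_time_change[OF tc1 tc2])
    have "(\<lambda>k. (1 + D) * \<mu> ^ k / (1 - \<mu>) ^ 2) \<longlonglongrightarrow> (1 + D) * 0 / (1 - \<mu>) ^ 2"
      using mu by (intro tendsto_intros LIMSEQ_power_zero) auto
    then show "(\<lambda>k. (1 + D) * \<mu> ^ k / (1 - \<mu>) ^ 2) \<longlonglongrightarrow> 0" by simp
    show "0 \<le> (1 + D) * \<mu> ^ k / (1 - \<mu>) ^ 2" for k using mu D by simp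
    fix n k
    show "(\<lambda>\<omega>. chain_bound \<mu> m k (Y n \<omega>)) \<in> borel_measurable M" by (rule cb(1))
    show "(\<integral>\<^sup>+\<omega>. chain_bound \<mu> m k (Y n \<omega>) \<partial>M) \<le> ennreal ((1 + D) * \<mu> ^ k / (1 - \<mu>) ^ 2)" by (rule cb(2))
    fix \<omega> and p :: "real \<times> real" assume w: "\<omega> \<in> space M" and p: "p \<in> unit_square"
    obtain s t where st: "p = (s, t)" "s \<in> {0..1}" "t \<in> {0..1}" using p by (cases p) auto
    have "ennreal \<bar>Y n \<omega> (\<sigma>1 s, \<sigma>2 t) - Y n \<omega> (dyad k (\<sigma>1 s), dyad k (\<sigma>2 t))\<bar> \<le> chain_bound \<mu> m k (Y n \<omega>)"
      by (rule chain_bound_le[OF mu(1) m sm(1)[OF st(2)] sm(2)[OF st(3)] Ycont[OF w] Yzero[OF w]])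
    then show "ennreal \<bar>X n \<omega> p - X n \<omega> (P k p)\<bar> \<le> chain_bound \<mu> m k (Y n \<omega>)"
      using st t1 t2 by (simp add: Y_def P_def)
  qed
qed

section \<open>The bilinear form of a bounded kernel\<close>

definition integrable01 :: "(real \<Rightarrow> real) \<Rightarrow> bool" where
  "integrable01 f \<longleftrightarrow> set_integrable lborel {0..1} f"

definition norm1 :: "(real \<Rightarrow> real) \<Rightarrow> real" where
  "norm1 f = (LINT x:{0..1}|lborel. \<bar>f x\<bar>)"

definition bounded_kernel :: "(real \<Rightarrow> real \<Rightarrow> real) \<Rightarrow> real \<Rightarrow> bool" where
  "bounded_kernel h c \<longleftrightarrow> set_borel_measurable lborel unit_square (\<lambda>p. h (fst p) (snd p)) \<and>
     (\<forall>x\<in>{0..1}. \<forall>y\<in>{0..1}. \<bar>h x y\<bar> \<le> c)"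

text \<open>The bilinear form \<open>(f, g) \<mapsto> \<integral> f \<otimes> g \<cdot> h\<close>. The processes \<open>X_proc\<close>, \<open>zeta_proc\<close> and \<open>Y_proc\<close> are its values at
kernels, at indicator functions and at products of both, and rectangular increments are its values at
differences.\<close>

definition kernel_form :: "(real \<Rightarrow> real \<Rightarrow> real) \<Rightarrow> (real \<Rightarrow> real) \<Rightarrow> (real \<Rightarrow> real) \<Rightarrow> real" where
  "kernel_form h f g = (LINT p:unit_square|lborel. f (fst p) * g (snd p) * h (fst p) (snd p))"

lemma tensor_integrable:
  fixes f g :: "real \<Rightarrow> real"
  assumes f: "integrable lborel f" and g: "integrable lborel g"
  shows "integrable lborel (\<lambda>p. f (fst p) * g (snd p))"
    and "(LINT p|lborel. f (fst p) * g (snd p)) = (LINT x|lborel. f x) * (LINT x|lborel. g x)"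
proof -
  have [measurable]: "f \<in> borel_measurable borel" "g \<in> borel_measurable borel" using f g by auto
  have I: "integrable (lborel \<Otimes>\<^sub>M lborel) (\<lambda>p. f (fst p) * g (snd p))"
  proof (rule lborel_pair.Fubini_integrable)
    show "integrable lborel (\<lambda>x. LINT y|lborel. norm (f (fst (x, y)) * g (snd (x, y))))"
      using f by (simp add: abs_mult)
    show "AE x in lborel. integrable lborel (\<lambda>y. f (fst (x, y)) * g (snd (x, y)))"
      using g by simp
  qed measurable
  then show "integrable lborel (\<lambda>p. f (fst p) * g (snd p))" by (simp add: lborel_prod)
  from lborel_pair.integral_fst'[OF I]
  show "(LINT p|lborel. f (fst p) * g (snd p)) = (LINT x|lborel. f x) * (LINT x|lborel. g x)"
    by (simp add: lborel_prod)
qed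

lemma tensor_indicator:
  "indicator unit_square p *\<^sub>R (f (fst p) * g (snd p)) =
    (indicator {0..1} (fst p) *\<^sub>R f (fst p)) * (indicator {0..1} (snd p) *\<^sub>R g (snd p) :: real)"
  by (auto simp: indicator_def mem_Times_iff)

lemma tensor_set_integrable:
  assumes "integrable01 f" "integrable01 g"
  shows "set_integrable lborel unit_square (\<lambda>p. f (fst p) * g (snd p))"
    and "(LINT p:unit_square|lborel. f (fst p) * g (snd p)) = (LINT x:{0..1}|lborel. f x) * (LINT x:{0..1}|lborel. g x)"
  using tensor_integrable[OF assms[unfolded integrable01_def set_integrable_def]]
  unfolding set_integrable_def set_lebesgue_integral_def tensor_indicator by auto

lemma integrable01_abs: "integrable01 f \<Longrightarrow> integrable01 (\<lambda>x. \<bar>f x\<bar>)"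
  unfolding integrable01_def by (rule set_integrable_abs)

lemma kernel_form_integrable:
  assumes h: "bounded_kernel h c" and fg: "integrable01 f" "integrable01 g"
  shows "set_integrable lborel unit_square (\<lambda>p. f (fst p) * g (snd p) * h (fst p) (snd p))"
    and "\<bar>kernel_form h f g\<bar> \<le> c * (norm1 f * norm1 g)"
proof -
  let ?T = "\<lambda>p. \<bar>f (fst p)\<bar> * \<bar>g (snd p)\<bar>"
  note T = tensor_set_integrable[OF integrable01_abs[OF fg(1)] integrable01_abs[OF fg(2)]]
  have cT: "set_integrable lborel unit_square (\<lambda>p. c * ?T p)"
    using T(1) by simp
  have m1: "(\<lambda>p. indicator unit_square p *\<^sub>R (f (fst p) * g (snd p))) \<in> borel_measurable lborel"
    using tensor_set_integrable(1)[OF fg] unfolding set_integrable_def by auto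
  have m2: "(\<lambda>p. indicator unit_square p *\<^sub>R h (fst p) (snd p)) \<in> borel_measurable lborel"
    using h unfolding bounded_kernel_def set_borel_measurable_def by auto
  have bound: "\<bar>h (fst p) (snd p)\<bar> \<le> c" if "p \<in> unit_square" for p
    using h that unfolding bounded_kernel_def by (auto simp: mem_Times_iff)
  have le: "\<bar>f (fst p) * g (snd p) * h (fst p) (snd p)\<bar> \<le> c * ?T p" if "p \<in> unit_square" for p
    using mult_right_mono[OF bound[OF that], of "?T p"] by (simp add: abs_mult mult.commute)
  show I: "set_integrable lborel unit_square (\<lambda>p. f (fst p) * g (snd p) * h (fst p) (snd p))"
  proof (rule set_integrable_bound[OF cT])
    have "(\<lambda>p. (indicator unit_square p *\<^sub>R (f (fst p) * g (snd p))) * (indicator unit_square p *\<^sub>R h (fst p) (snd p)))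
      \<in> borel_measurable lborel"
      using m1 m2 by (rule borel_measurable_times)
    also have "(\<lambda>p. (indicator unit_square p *\<^sub>R (f (fst p) * g (snd p))) * (indicator unit_square p *\<^sub>R h (fst p) (snd p))) =
       (\<lambda>p. indicator unit_square p *\<^sub>R (f (fst p) * g (snd p) * h (fst p) (snd p)))"
      by (auto simp: indicator_def)
    finally show "set_borel_measurable lborel unit_square (\<lambda>p. f (fst p) * g (snd p) * h (fst p) (snd p))"
      unfolding set_borel_measurable_def .
    show "AE p in lborel. p \<in> unit_square \<longrightarrow> norm (f (fst p) * g (snd p) * h (fst p) (snd p)) \<le> norm (c * ?T p)"
      by (intro AE_I2 impI) (simp only: real_norm_def, rule order_trans[OF le abs_ge_self])
  qed
  have "\<bar>kernel_form h f g\<bar> \<le> (LINT p:unit_square|lborel. \<bar>f (fst p) * g (snd p) * h (fst p) (snd p)\<bar>)"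
    using set_integral_norm_bound[OF I] unfolding kernel_form_def by simp
  also have "\<dots> \<le> (LINT p:unit_square|lborel. c * ?T p)"
    by (rule set_integral_mono[OF set_integrable_abs[OF I] cT le])
  also have "\<dots> = c * (norm1 f * norm1 g)"
    using T(2) by (simp add: norm1_def)
  finally show "\<bar>kernel_form h f g\<bar> \<le> c * (norm1 f * norm1 g)" .
qed

lemma integrable01_diff: "integrable01 f \<Longrightarrow> integrable01 g \<Longrightarrow> integrable01 (\<lambda>x. f x - g x)"
  unfolding integrable01_def by (rule set_integral_diff)

lemma integrable01_cmult: "integrable01 f \<Longrightarrow> integrable01 (\<lambda>x. c * f x)"
  unfolding integrable01_def by simp

lemma integrable01_indicator: "A \<in> sets borel \<Longrightarrow> integrable01 f \<Longrightarrow> integrable01 (\<lambda>x. f x * indicator A x)"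
  unfolding integrable01_def set_integrable_def
  using integrable_real_mult_indicator[of A lborel "\<lambda>x. indicator {0..1} x *\<^sub>R f x"] by (simp add: ac_simps)

lemma integrable01_const: "integrable01 (\<lambda>_. c)"
  unfolding integrable01_def set_integrable_def by simp

lemma integrable01_indicator1: "A \<in> sets borel \<Longrightarrow> integrable01 (indicator A)"
  using integrable01_indicator[OF _ integrable01_const[of 1], of A] by simp

lemma kernel_form_add:
  assumes "bounded_kernel h c" "integrable01 f" "integrable01 f'" "integrable01 g"
  shows "kernel_form h (\<lambda>x. f x + f' x) g = kernel_form h f g + kernel_form h f' g" "kernel_form h g (\<lambda>x. f x + f' x) = kernel_form h g f + kernel_form h g f'"
  unfolding kernel_form_def
  using kernel_form_integrable(1)[OF assms(1)] assms by (simp_all add: distrib_right distrib_left set_integral_add)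

lemma kernel_form_diff:
  assumes "bounded_kernel h c" "integrable01 f" "integrable01 f'" "integrable01 g"
  shows "kernel_form h (\<lambda>x. f x - f' x) g = kernel_form h f g - kernel_form h f' g" "kernel_form h g (\<lambda>x. f x - f' x) = kernel_form h g f - kernel_form h g f'"
  unfolding kernel_form_def
  using kernel_form_integrable(1)[OF assms(1)] assms by (simp_all add: left_diff_distrib right_diff_distrib set_integral_diff)

lemma kernel_form_cmult:
  "kernel_form h (\<lambda>x. c * f x) g = c * kernel_form h f g" "kernel_form h f (\<lambda>x. c * g x) = c * kernel_form h f g"
  unfolding kernel_form_def by (simp_all add: mult.assoc mult.left_commute[of _ c])

lemma kernel_form_zero: "kernel_form h (\<lambda>_. 0) g = 0" "kernel_form h f (\<lambda>_. 0) = 0"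
  unfolding kernel_form_def by simp_all

lemma rect_incr_kernel_form:
  assumes h: "bounded_kernel h c" and F: "integrable01 (F s)" "integrable01 (F s')" and H: "integrable01 (H t)" "integrable01 (H t')"
    and x: "\<And>u v. u \<in> {s, s'} \<Longrightarrow> v \<in> {t, t'} \<Longrightarrow> x (u, v) = kernel_form h (F u) (H v)"
  shows "rect_incr x s t s' t' = kernel_form h (\<lambda>x. F s' x - F s x) (\<lambda>x. H t' x - H t x)"
  using F H by (simp add: rect_incr_def x kernel_form_diff[OF h] integrable01_diff)

text \<open>The indicators of \<open>A\<close> and \<open>B\<close> are moved into the integrand so that all iterated integrals of the
processes become integrals over the same square.\<close>

lemma iterated_integral:
  fixes F :: "real \<Rightarrow> real \<Rightarrow> real"
  assumes A: "A \<subseteq> {0..1}" "B \<subseteq> {0..1}" and I: "set_integrable lborel unit_square (\<lambda>p. F (fst p) (snd p) * (indicator A (fst p) * indicator B (snd p)))"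
  shows "(LINT v:B|lborel. (LINT u:A|lborel. F u v)) =
    (LINT p:unit_square|lborel. F (fst p) (snd p) * (indicator A (fst p) * indicator B (snd p)))"
proof -
  let ?f = "\<lambda>u v. indicator unit_square (u, v) *\<^sub>R (F u v * (indicator A u * indicator B v))"
  have "integrable lborel (\<lambda>(u, v). ?f u v)"
    using I unfolding set_integrable_def by (simp add: case_prod_beta')
  then have I': "integrable (lborel \<Otimes>\<^sub>M lborel) (\<lambda>(u, v). ?f u v)" by (simp add: lborel_prod)
  have "(LINT v:B|lborel. (LINT u:A|lborel. F u v)) = (LINT v|lborel. (LINT u|lborel. ?f u v))"
    unfolding set_lebesgue_integral_def integral_scaleR_right[symmetric]
    by (intro Bochner_Integration.integral_cong refl) (use A in \<open>auto simp: indicator_def\<close>)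
  also have "\<dots> = integral\<^sup>L (lborel \<Otimes>\<^sub>M lborel) (\<lambda>(u, v). ?f u v)"
    by (rule lborel_pair.integral_snd[OF I'])
  also have "\<dots> = (LINT p:unit_square|lborel. F (fst p) (snd p) * (indicator A (fst p) * indicator B (snd p)))"
    unfolding set_lebesgue_integral_def lborel_prod by (simp add: case_prod_beta')
  finally show ?thesis .
qed

lemma X_proc_kernel_form:
  assumes h: "bounded_kernel (\<theta> n \<omega>) c" and "integrable01 (K1 s)" "integrable01 (K2 t)"
  shows "X_proc K1 K2 \<theta> n \<omega> (s, t) = kernel_form (\<theta> n \<omega>) (K1 s) (K2 t)"
proof -
  have eq: "indicator unit_square p *\<^sub>R (y * (indicator {0..1} (fst p) * indicator {0..1} (snd p))) = indicator unit_square p *\<^sub>R y"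
    for p :: "real \<times> real" and y :: real by (auto simp: indicator_def)
  have "set_integrable lborel unit_square (\<lambda>p. K1 s (fst p) * K2 t (snd p) * \<theta> n \<omega> (fst p) (snd p) * (indicator {0..1} (fst p) * indicator {0..1} (snd p)))"
    using kernel_form_integrable(1)[OF assms] unfolding set_integrable_def by (simp only: eq)
  from iterated_integral[OF _ _ this] show ?thesis
    unfolding X_proc_def kernel_form_def set_lebesgue_integral_def by (simp only: eq prod.case order_refl simp_thms)
qed

lemma zeta_proc_kernel_form:
  assumes h: "bounded_kernel (\<theta> n \<omega>) c" and "s \<in> {0..1}" "t \<in> {0..1}"
  shows "zeta_proc \<theta> n \<omega> (s, t) = kernel_form (\<theta> n \<omega>) (indicator {0..s}) (indicator {0..t})"
proof -
  have "set_integrable lborel unit_square (\<lambda>p. \<theta> n \<omega> (fst p) (snd p) * (indicator {0..s} (fst p) * indicator {0..t} (snd p)))"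
    using kernel_form_integrable(1)[OF h integrable01_indicator1 integrable01_indicator1, of "{0..s}" "{0..t}"] by (simp add: mult.commute)
  from iterated_integral[OF _ _ this] show ?thesis
    using assms unfolding zeta_proc_def kernel_form_def by (simp add: mult.commute)
qed

lemma Y_proc_kernel_form:
  assumes "s0 \<in> {0..1}" "t0 \<in> {0..1}"
  shows "Y_proc K1 K2 \<theta> s s' t t' n \<omega> (s0, t0) =
    kernel_form (\<theta> n \<omega>) (\<lambda>x. (K1 s' x - K1 s x) * indicator {0..s0} x) (\<lambda>y. (K2 t' y - K2 t y) * indicator {0..t0} y)"
  unfolding Y_proc_def kernel_form_def set_lebesgue_integral_def prod.case
  by (intro Bochner_Integration.integral_cong refl) (use assms in \<open>auto simp: indicator_def\<close>)

lemma in_L2_integrable01: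
  assumes "in_L2 f" shows "integrable01 f"
  unfolding integrable01_def
proof (rule set_integrable_bound)
  have c: "set_integrable lborel {0..1::real} (\<lambda>x. 1 :: real)"
    using integrable01_const[of 1] unfolding integrable01_def .
  show "set_integrable lborel {0..1} (\<lambda>x. 1 + (f x)\<^sup>2)"
    using assms c unfolding in_L2_def by (intro set_integral_add) auto
  show "set_borel_measurable lborel {0..1} f" using assms unfolding in_L2_def by simp
  have "\<bar>y\<bar> \<le> \<bar>1 + y\<^sup>2\<bar>" for y :: real
  proof -
    have "0 \<le> (\<bar>y\<bar> - 1)\<^sup>2 + 1 + y\<^sup>2" by simp
    then show ?thesis by (simp add: power2_eq_square algebra_simps)
  qed
  then show "AE x in lborel. x \<in> {0..1} \<longrightarrow> norm (f x) \<le> norm (1 + (f x)\<^sup>2)"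
    by simp
qed

text \<open>The variance of \<open>\<bar>f\<bar>\<close> under the uniform distribution on \<open>[0,1]\<close> is nonnegative.\<close>

lemma norm1_le_sqnorm2:
  assumes "in_L2 f" shows "(norm1 f)\<^sup>2 \<le> (LINT x:{0..1}|lborel. (f x)\<^sup>2)"
proof -
  let ?c = "norm1 f"
  have f: "set_integrable lborel {0..1} (\<lambda>x. \<bar>f x\<bar>)" using integrable01_abs[OF in_L2_integrable01[OF assms]] by (simp add: integrable01_def)
  have f2: "set_integrable lborel {0..1} (\<lambda>x. (f x)\<^sup>2)" using assms by (simp add: in_L2_def)
  have c: "set_integrable lborel {0..1::real} (\<lambda>x. ?c\<^sup>2)" using integrable01_const unfolding integrable01_def .
  have "0 \<le> (LINT x:{0..1}|lborel. (\<bar>f x\<bar> - ?c)\<^sup>2)"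
    unfolding set_lebesgue_integral_def by (rule integral_nonneg_AE) auto
  also have "(LINT x:{0..1}|lborel. (\<bar>f x\<bar> - ?c)\<^sup>2) = (LINT x:{0..1}|lborel. ((f x)\<^sup>2 + ?c\<^sup>2) - (2 * ?c) * \<bar>f x\<bar>)"
    unfolding set_lebesgue_integral_def
    by (intro Bochner_Integration.integral_cong refl) (simp add: power2_diff mult.commute mult.left_commute)
  also have "\<dots> = (LINT x:{0..1}|lborel. (f x)\<^sup>2) + (LINT x:{0..1::real}|lborel. ?c\<^sup>2) - (2 * ?c) * ?c"
    using f f2 c by (simp add: set_integral_diff set_integral_add norm1_def)
  also have "(LINT x:{0..1::real}|lborel. ?c\<^sup>2) = ?c\<^sup>2" by (simp add: set_integral_const)
  finally show ?thesis by (simp add: power2_eq_square)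
qed

lemma norm1_cong_AE:
  assumes "integrable01 f" "integrable01 g" "AE x in lborel. x \<in> {0..1} \<longrightarrow> f x = g x" shows "norm1 f = norm1 g"
  unfolding norm1_def set_lebesgue_integral_def
proof (rule integral_cong_AE)
  show "(\<lambda>x. indicator {0..1} x *\<^sub>R \<bar>f x\<bar>) \<in> borel_measurable lborel" "(\<lambda>x. indicator {0..1} x *\<^sub>R \<bar>g x\<bar>) \<in> borel_measurable lborel"
    using integrable01_abs[OF assms(1)] integrable01_abs[OF assms(2)] unfolding integrable01_def set_integrable_def by auto
  show "AE x in lborel. indicator {0..1} x *\<^sub>R \<bar>f x\<bar> = indicator {0..1} x *\<^sub>R \<bar>g x\<bar>"
    using assms(3) by eventually_elim (auto simp: indicator_def)
qed

lemma norm1_nonneg: "0 \<le> norm1 f"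
  unfolding norm1_def set_lebesgue_integral_def by (rule integral_nonneg_AE) auto

section \<open>Kernels with square integrable increments\<close>

lemma kernel_measurable:
  assumes "kernel_basic K" "s \<in> {0..1}"
  shows "set_borel_measurable lborel {0..1} (K s)"
proof -
  have [measurable]: "(\<lambda>p. K (fst p) (snd p)) \<in> borel_measurable (restrict_space borel unit_square)"
    using assms(1) unfolding kernel_basic_def by (simp add: case_prod_beta')
  have "(\<lambda>r. (s, r)) \<in> restrict_space borel {0..1} \<rightarrow>\<^sub>M restrict_space borel unit_square"
    using assms(2) by (intro measurable_restrict_space3) (auto intro!: borel_measurable_continuous_onI continuous_intros)
  from measurable_compose[OF this, of "\<lambda>p. K (fst p) (snd p)" borel]
  have "K s \<in> borel_measurable (restrict_space borel {0..1})" by simp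
  then show ?thesis
    unfolding set_borel_measurable_def by (subst (asm) borel_measurable_restrict_space_iff) (auto simp: mult.commute)
qed

text \<open>The part that (H1) and (H1') have in common: the exponent \<open>a\<close> is above one in (H1) and at most one in (H1').\<close>

locale regular_kernel =
  fixes K :: "real \<Rightarrow> real \<Rightarrow> real" and G :: "real \<Rightarrow> real" and a :: real
  assumes basic: "kernel_basic K" and incr: "increment_bound K G a" and a_pos: "0 < a"
begin

lemma increment_in_L2:
  assumes "s \<in> {0..1}" "s' \<in> {0..1}"
  shows "in_L2 (\<lambda>r. K s' r - K s r)" and "(LINT r:{0..1}|lborel. (K s' r - K s r)\<^sup>2) \<le> \<bar>G s' - G s\<bar> powr a"
proof -
  have m: "set_borel_measurable lborel {0..1} (\<lambda>r. K s' r - K s r)"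
    using kernel_measurable[OF basic assms(1)] kernel_measurable[OF basic assms(2)]
    unfolding set_borel_measurable_def by (simp add: right_diff_distrib)
  have lt: "set_integrable lborel {0..1} (\<lambda>r. (K u' r - K u r)\<^sup>2) \<and>
      (LINT r:{0..1}|lborel. (K u' r - K u r)\<^sup>2) \<le> \<bar>G u' - G u\<bar> powr a" if "0 \<le> u" "u < u'" "u' \<le> 1" for u u'
    using incr that mono_onD[of "{0..1}" G u u'] unfolding increment_bound_def by auto
  have "set_integrable lborel {0..1} (\<lambda>r. (K s' r - K s r)\<^sup>2) \<and>
      (LINT r:{0..1}|lborel. (K s' r - K s r)\<^sup>2) \<le> \<bar>G s' - G s\<bar> powr a"
  proof (cases s s' rule: linorder_cases)
    case less then show ?thesis using lt assms by auto
  next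
    case equal then show ?thesis by (simp add: set_integrable_def)
  next
    case greater
    then show ?thesis using lt[of s' s] assms by (simp add: power2_commute abs_minus_commute)
  qed
  then show "in_L2 (\<lambda>r. K s' r - K s r)" "(LINT r:{0..1}|lborel. (K s' r - K s r)\<^sup>2) \<le> \<bar>G s' - G s\<bar> powr a"
    using m unfolding in_L2_def by auto
qed

lemma kernel_in_L2:
  assumes s: "s \<in> {0..1}" shows "in_L2 (K s)"
proof -
  have d: "set_integrable lborel {0..1} (\<lambda>r. (K s r - K 0 r)\<^sup>2)"
    using increment_in_L2(1)[of 0 s] s unfolding in_L2_def by auto
  have m: "set_borel_measurable lborel {0..1} (K s)" by (rule kernel_measurable[OF basic s])
  have "(\<lambda>x. (indicator {0..1} x *\<^sub>R K s x)\<^sup>2) \<in> borel_measurable lborel"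
    using m unfolding set_borel_measurable_def by (intro borel_measurable_power) auto
  also have "(\<lambda>x. (indicator {0..1} x *\<^sub>R K s x)\<^sup>2) = (\<lambda>x. indicator {0..1} x *\<^sub>R (K s x)\<^sup>2)"
    by (auto simp: indicator_def)
  finally have m2: "(\<lambda>x. indicator {0..1} x *\<^sub>R (K s x)\<^sup>2) \<in> borel_measurable lborel" .
  have ae: "AE r in lborel. r \<in> {0..1} \<longrightarrow> K 0 r = 0" using basic unfolding kernel_basic_def by auto
  have "set_integrable lborel {0..1} (\<lambda>r. (K s r)\<^sup>2)"
    unfolding set_integrable_def
  proof (rule integrable_cong_AE_imp[OF d[unfolded set_integrable_def] m2])
    show "AE x in lborel. indicator {0..1} x *\<^sub>R (K s x - K 0 x)\<^sup>2 = indicator {0..1} x *\<^sub>R (K s x)\<^sup>2"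
      using ae by eventually_elim (auto simp: indicator_def)
  qed
  then show ?thesis using m unfolding in_L2_def by simp
qed

lemma norm1_increment:
  assumes "s \<in> {0..1}" "s' \<in> {0..1}"
  shows "norm1 (\<lambda>r. K s' r - K s r) \<le> \<bar>G s' - G s\<bar> powr (a / 2)"
proof (rule power2_le_imp_le)
  have "(norm1 (\<lambda>r. K s' r - K s r))\<^sup>2 \<le> \<bar>G s' - G s\<bar> powr a"
    using norm1_le_sqnorm2[OF increment_in_L2(1)[OF assms]] increment_in_L2(2)[OF assms] by linarith
  also have "\<dots> = (\<bar>G s' - G s\<bar> powr (a / 2))\<^sup>2" by (simp add: power2_eq_square powr_add[symmetric])
  finally show "(norm1 (\<lambda>r. K s' r - K s r))\<^sup>2 \<le> (\<bar>G s' - G s\<bar> powr (a / 2))\<^sup>2" .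
qed simp

lemma norm1_zero: "norm1 (K 0) = 0"
proof -
  have "norm1 (K 0) = norm1 (\<lambda>_. 0)"
    by (rule norm1_cong_AE) (use in_L2_integrable01[OF kernel_in_L2[of 0]] integrable01_const basic in \<open>auto simp: kernel_basic_def\<close>)
  then show ?thesis by (simp add: norm1_def)
qed

lemma norm1_bound:
  assumes s: "s \<in> {0..1}"
  shows "norm1 (K s) \<le> \<bar>G s - G 0\<bar> powr (a / 2)"
proof -
  have "norm1 (K s) = norm1 (\<lambda>r. K s r - K 0 r)"
  proof (rule norm1_cong_AE)
    show "integrable01 (K s)" "integrable01 (\<lambda>r. K s r - K 0 r)" using s kernel_in_L2 increment_in_L2 in_L2_integrable01 by auto
    have "AE r in lborel. r \<in> {0..1} \<longrightarrow> K 0 r = 0" using basic unfolding kernel_basic_def by auto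
    then show "AE r in lborel. r \<in> {0..1} \<longrightarrow> K s r = K s r - K 0 r" by eventually_elim auto
  qed
  then show ?thesis using norm1_increment[of 0 s] s by simp
qed

lemma kernel_integrable01: "s \<in> {0..1} \<Longrightarrow> integrable01 (K s)" by (rule in_L2_integrable01[OF kernel_in_L2])

end

text \<open>Each of the two differences of the bilinear form is bounded by \<open>c\<close> times a product of \<open>L\<^sup>1\<close> norms, and the
\<open>L\<^sup>1\<close> norm of an increment of a kernel is at most \<open>\<bar>\<Delta>G\<bar>\<^bsup>a/2\<^esup>\<close>.\<close>

lemma kernel_form_continuous:
  assumes h: "bounded_kernel h c" and K1: "regular_kernel K1 G1 a1" and K2: "regular_kernel K2 G2 a2"
  shows "continuous_on unit_square (\<lambda>p. kernel_form h (K1 (fst p)) (K2 (snd p)))"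
  unfolding continuous_on_def
proof
  fix q assume q: "q \<in> unit_square"
  then have q': "fst q \<in> {0..1}" "snd q \<in> {0..1}" by auto
  interpret K1: regular_kernel K1 G1 a1 by fact
  interpret K2: regular_kernel K2 G2 a2 by fact
  have "\<bar>h 0 0\<bar> \<le> c" using h unfolding bounded_kernel_def by simp
  then have c: "0 \<le> c" by linarith
  define R where "R p = c * (\<bar>G1 (fst p) - G1 (fst q)\<bar> powr (a1 / 2) * \<bar>G2 (snd p) - G2 0\<bar> powr (a2 / 2)) +
    c * (\<bar>G1 (fst q) - G1 0\<bar> powr (a1 / 2) * \<bar>G2 (snd p) - G2 (snd q)\<bar> powr (a2 / 2))" for p
  have "continuous_on {0..1} G1" "continuous_on {0..1} G2"
    using K1.incr K2.incr unfolding increment_bound_def by auto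
  note G = continuous_on_compose2[OF this(1), of unit_square fst] continuous_on_compose2[OF this(2), of unit_square snd]
  have "continuous_on unit_square R"
    unfolding R_def using K1.a_pos K2.a_pos
    by (intro continuous_on_add continuous_on_mult continuous_on_const continuous_on_powr' continuous_on_rabs continuous_on_diff G
         continuous_on_fst continuous_on_snd continuous_on_id) auto
  then have "(R \<longlongrightarrow> R q) (at q within unit_square)" using q unfolding continuous_on_def by blast
  moreover have "R q = 0" using K1.a_pos K2.a_pos by (simp add: R_def)
  ultimately have R: "(R \<longlongrightarrow> 0) (at q within unit_square)" by simp
  have bound: "\<bar>kernel_form h (K1 (fst p)) (K2 (snd p)) - kernel_form h (K1 (fst q)) (K2 (snd q))\<bar> \<le> R p" if p: "p \<in> unit_square" for p
  proof -
    have p': "fst p \<in> {0..1}" "snd p \<in> {0..1}" using p by auto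
    note i = K1.kernel_integrable01[OF p'(1)] K2.kernel_integrable01[OF p'(2)] K1.kernel_integrable01[OF q'(1)] K2.kernel_integrable01[OF q'(2)]
    let ?d1 = "\<lambda>r. K1 (fst p) r - K1 (fst q) r" and ?d2 = "\<lambda>r. K2 (snd p) r - K2 (snd q) r"
    have eq: "kernel_form h (K1 (fst p)) (K2 (snd p)) - kernel_form h (K1 (fst q)) (K2 (snd q)) =
      kernel_form h ?d1 (K2 (snd p)) + kernel_form h (K1 (fst q)) ?d2"
      by (simp add: kernel_form_diff[OF h] i)
    have "\<bar>kernel_form h ?d1 (K2 (snd p)) + kernel_form h (K1 (fst q)) ?d2\<bar> \<le> c * (norm1 ?d1 * norm1 (K2 (snd p))) + c * (norm1 (K1 (fst q)) * norm1 ?d2)"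
    proof (rule order_trans[OF abs_triangle_ineq], rule add_mono)
      show "\<bar>kernel_form h ?d1 (K2 (snd p))\<bar> \<le> c * (norm1 ?d1 * norm1 (K2 (snd p)))"
        by (rule kernel_form_integrable(2)[OF h integrable01_diff[OF i(1,3)] i(2)])
      show "\<bar>kernel_form h (K1 (fst q)) ?d2\<bar> \<le> c * (norm1 (K1 (fst q)) * norm1 ?d2)"
        by (rule kernel_form_integrable(2)[OF h i(3) integrable01_diff[OF i(2,4)]])
    qed
    also have "\<dots> \<le> R p"
      unfolding R_def using c K1.norm1_increment[OF q'(1) p'(1)] K2.norm1_bound[OF p'(2)] K1.norm1_bound[OF q'(1)] K2.norm1_increment[OF q'(2) p'(2)]
      by (intro add_mono mult_left_mono mult_mono norm1_nonneg powr_ge_zero)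
    finally show ?thesis unfolding eq .
  qed
  have "((\<lambda>p. kernel_form h (K1 (fst p)) (K2 (snd p)) - kernel_form h (K1 (fst q)) (K2 (snd q))) \<longlongrightarrow> 0) (at q within unit_square)"
  proof (rule Lim_null_comparison[OF _ R])
    show "\<forall>\<^sub>F p in at q within unit_square. norm (kernel_form h (K1 (fst p)) (K2 (snd p)) - kernel_form h (K1 (fst q)) (K2 (snd q))) \<le> R p"
      unfolding eventually_at_filter by (rule always_eventually) (use bound in \<open>simp del: mem_Sigma_iff\<close>)
  qed
  then show "((\<lambda>p. kernel_form h (K1 (fst p)) (K2 (snd p))) \<longlongrightarrow> kernel_form h (K1 (fst q)) (K2 (snd q))) (at q within unit_square)"
    by (simp add: LIM_zero_iff)
qed

lemma kernel_form_measurable: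
  assumes \<theta>: "random_kernels M \<theta>" and fg: "integrable01 f" "integrable01 g"
  shows "(\<lambda>\<omega>. kernel_form (\<theta> n \<omega>) f g) \<in> borel_measurable M"
proof -
  have t: "(\<lambda>z. \<theta> n (fst z) (fst (snd z)) (snd (snd z))) \<in> borel_measurable (M \<Otimes>\<^sub>M restrict_space borel unit_square)"
    using \<theta> unfolding random_kernels_def by (simp add: case_prod_beta')
  have m1: "(\<lambda>p. indicator unit_square p *\<^sub>R (f (fst p) * g (snd p))) \<in> borel_measurable lborel"
    using tensor_set_integrable(1)[OF fg] unfolding set_integrable_def by auto
  have U: "unit_square \<in> sets (borel :: (real \<times> real) measure)" by (intro borel_closed closed_Times) auto
  have "(\<lambda>p. f (fst p) * g (snd p)) \<in> borel_measurable (restrict_space borel unit_square)"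
    using m1 U by (subst borel_measurable_restrict_space_iff) (auto simp: mult.commute)
  then have "(\<lambda>z. f (fst (snd z)) * g (snd (snd z)) * \<theta> n (fst z) (fst (snd z)) (snd (snd z))) \<in>
    borel_measurable (M \<Otimes>\<^sub>M restrict_space borel unit_square)"
    using t by (intro borel_measurable_times[OF measurable_compose[OF measurable_snd, of "\<lambda>p. f (fst p) * g (snd p)"]])
  moreover have "sigma_finite_measure (restrict_space lborel unit_square)"
    by (rule sigma_finite_measure_restrict_space) (use U in \<open>auto intro: lborel.sigma_finite_measure_axioms\<close>)
  then interpret S: sigma_finite_measure "restrict_space lborel unit_square" .
  have sets_eq: "sets (M \<Otimes>\<^sub>M restrict_space lborel unit_square) = sets (M \<Otimes>\<^sub>M restrict_space borel unit_square)"
    by (intro sets_pair_measure_cong refl sets_restrict_space_cong) auto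
  ultimately have "(\<lambda>(\<omega>, p). f (fst p) * g (snd p) * \<theta> n \<omega> (fst p) (snd p)) \<in> borel_measurable (M \<Otimes>\<^sub>M restrict_space lborel unit_square)"
    by (simp add: case_prod_beta' measurable_cong_sets[OF sets_eq refl])
  from S.borel_measurable_lebesgue_integral[OF this]
  show ?thesis unfolding kernel_form_def set_lebesgue_integral_def using U by (simp add: integral_restrict_space)
qed

lemma random_kernel_bounded:
  assumes \<theta>: "random_kernels M \<theta>" and w: "\<omega> \<in> space M"
  shows "\<exists>c. bounded_kernel (\<theta> n \<omega>) c"
proof -
  have U: "unit_square \<in> sets (borel :: (real \<times> real) measure)" by (intro borel_closed closed_Times) auto
  have t: "(\<lambda>z. \<theta> n (fst z) (fst (snd z)) (snd (snd z))) \<in> borel_measurable (M \<Otimes>\<^sub>M restrict_space borel unit_square)"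
    using \<theta> unfolding random_kernels_def by (simp add: case_prod_beta')
  have "(\<lambda>p. \<theta> n \<omega> (fst p) (snd p)) \<in> borel_measurable (restrict_space borel unit_square)"
    using measurable_compose[OF measurable_Pair1'[OF w] t] by simp
  then have "set_borel_measurable lborel unit_square (\<lambda>p. \<theta> n \<omega> (fst p) (snd p))"
    unfolding set_borel_measurable_def using U
    by (subst (asm) borel_measurable_restrict_space_iff) (auto simp: mult.commute)
  then show ?thesis using \<theta> w unfolding random_kernels_def bounded_kernel_def by blast
qed

section \<open>Second moments of rectangular increments\<close>

definition sqnorm2 :: "(real \<Rightarrow> real) \<Rightarrow> real" where
  "sqnorm2 f = (LINT x:{0..1}|lborel. (f x)\<^sup>2)"

lemma sqnorm2_nonneg: "0 \<le> sqnorm2 f"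
  unfolding sqnorm2_def set_lebesgue_integral_def by (rule integral_nonneg_AE) auto

lemma H3_kernel_form:
  assumes "H3 M \<theta>"
  obtains C where "0 \<le> C" "\<And>f g n. in_L2 f \<Longrightarrow> in_L2 g \<Longrightarrow>
    (\<integral>\<^sup>+\<omega>. ennreal ((kernel_form (\<theta> n \<omega>) f g)\<^sup>2) \<partial>M) \<le> ennreal (C * (sqnorm2 f * sqnorm2 g))"
proof -
  obtain C where C: "\<And>f g n. in_L2 f \<Longrightarrow> in_L2 g \<Longrightarrow>
    integrable M (\<lambda>\<omega>. (kernel_form (\<theta> n \<omega>) f g)\<^sup>2) \<and>
    (LINT \<omega>|M. (kernel_form (\<theta> n \<omega>) f g)\<^sup>2) \<le> C * (LINT p:unit_square|lborel. (f (fst p))\<^sup>2 * (g (snd p))\<^sup>2)"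
    using assms unfolding H3_def kernel_form_def by blast
  show thesis
  proof (rule that[of "max C 0"])
    fix f g :: "real \<Rightarrow> real" and n assume fg: "in_L2 f" "in_L2 g"
    have "(LINT p:unit_square|lborel. (f (fst p))\<^sup>2 * (g (snd p))\<^sup>2) = sqnorm2 f * sqnorm2 g"
      unfolding sqnorm2_def by (rule tensor_set_integrable(2)) (use fg in \<open>auto simp: integrable01_def in_L2_def\<close>)
    then have "(LINT \<omega>|M. (kernel_form (\<theta> n \<omega>) f g)\<^sup>2) \<le> C * (sqnorm2 f * sqnorm2 g)" using C[OF fg, of n] by simp
    also have "\<dots> \<le> max C 0 * (sqnorm2 f * sqnorm2 g)"
      by (intro mult_right_mono mult_nonneg_nonneg sqnorm2_nonneg) auto
    finally show "(\<integral>\<^sup>+\<omega>. ennreal ((kernel_form (\<theta> n \<omega>) f g)\<^sup>2) \<partial>M) \<le> ennreal (max C 0 * (sqnorm2 f * sqnorm2 g))"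
      using C[OF fg, of n] by (subst nn_integral_eq_integral) (auto intro: ennreal_leI)
  qed simp
qed

lemma X_proc_incr:
  assumes h: "bounded_kernel (\<theta> n \<omega>) c" and K1: "regular_kernel K1 G1 a1" and K2: "regular_kernel K2 G2 a2"
    and st: "s \<in> {0..1}" "s' \<in> {0..1}" "t \<in> {0..1}" "t' \<in> {0..1}"
  shows "rect_incr (X_proc K1 K2 \<theta> n \<omega>) s t s' t' = kernel_form (\<theta> n \<omega>) (\<lambda>x. K1 s' x - K1 s x) (\<lambda>y. K2 t' y - K2 t y)"
  by (rule rect_incr_kernel_form[OF h])
     (use regular_kernel.kernel_integrable01[OF K1] regular_kernel.kernel_integrable01[OF K2] st in \<open>auto intro!: X_proc_kernel_form[where \<theta>=\<theta> and n=n and \<omega>=\<omega>, OF h]\<close>)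

lemma rect_moment_of_H3:
  assumes \<theta>: "random_kernels M \<theta>" and H3: "H3 M \<theta>" and K1: "regular_kernel K1 G1 a1" and K2: "regular_kernel K2 G2 a2"
  shows "\<exists>C\<ge>0. \<forall>n. rect_moment M (X_proc K1 K2 \<theta> n) 2 G1 a1 G2 a2 C"
proof -
  obtain C where C: "0 \<le> C" "\<And>f g n. in_L2 f \<Longrightarrow> in_L2 g \<Longrightarrow>
    (\<integral>\<^sup>+\<omega>. ennreal ((kernel_form (\<theta> n \<omega>) f g)\<^sup>2) \<partial>M) \<le> ennreal (C * (sqnorm2 f * sqnorm2 g))"
    using H3_kernel_form[OF H3] by blast
  show ?thesis
  proof (intro exI[of _ C] conjI C(1) allI)
    fix n
    show "rect_moment M (X_proc K1 K2 \<theta> n) 2 G1 a1 G2 a2 C"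
      unfolding rect_moment_def
    proof (intro allI impI)
      fix s s' t t' :: real assume st: "0 \<le> s \<and> s < s' \<and> s' \<le> 1 \<and> 0 \<le> t \<and> t < t' \<and> t' \<le> 1"
      then have mem: "s \<in> {0..1}" "s' \<in> {0..1}" "t \<in> {0..1}" "t' \<in> {0..1}" by auto
      note inc1 = regular_kernel.increment_in_L2[OF K1 mem(1,2)] and inc2 = regular_kernel.increment_in_L2[OF K2 mem(3,4)]
      have G: "\<bar>G1 s' - G1 s\<bar> = G1 s' - G1 s" "\<bar>G2 t' - G2 t\<bar> = G2 t' - G2 t"
        using K1 K2 st mem mono_onD[of "{0..1}" G1 s s'] mono_onD[of "{0..1}" G2 t t']
        unfolding regular_kernel_def increment_bound_def by auto
      have "(\<integral>\<^sup>+\<omega>. ennreal ((rect_incr (X_proc K1 K2 \<theta> n \<omega>) s t s' t')\<^sup>2) \<partial>M) =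
        (\<integral>\<^sup>+\<omega>. ennreal ((kernel_form (\<theta> n \<omega>) (\<lambda>x. K1 s' x - K1 s x) (\<lambda>y. K2 t' y - K2 t y))\<^sup>2) \<partial>M)"
      proof (rule nn_integral_cong)
        fix \<omega> assume "\<omega> \<in> space M"
        then obtain c where "bounded_kernel (\<theta> n \<omega>) c" using random_kernel_bounded[OF \<theta>] by blast
        from X_proc_incr[where \<theta>=\<theta> and n=n and \<omega>=\<omega>, OF this K1 K2 mem]
        show "ennreal ((rect_incr (X_proc K1 K2 \<theta> n \<omega>) s t s' t')\<^sup>2) =
          ennreal ((kernel_form (\<theta> n \<omega>) (\<lambda>x. K1 s' x - K1 s x) (\<lambda>y. K2 t' y - K2 t y))\<^sup>2)" by simp
      qed
      also have "\<dots> \<le> ennreal (C * (sqnorm2 (\<lambda>x. K1 s' x - K1 s x) * sqnorm2 (\<lambda>y. K2 t' y - K2 t y)))"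
        by (rule C(2)[OF inc1(1) inc2(1)])
      also have "\<dots> \<le> ennreal (C * ((G1 s' - G1 s) powr a1 * (G2 t' - G2 t) powr a2))"
        using C(1) inc1(2) inc2(2) unfolding G sqnorm2_def[symmetric]
        by (intro ennreal_leI mult_left_mono mult_mono sqnorm2_nonneg powr_ge_zero)
      finally show "(\<integral>\<^sup>+\<omega>. ennreal ((rect_incr (X_proc K1 K2 \<theta> n \<omega>) s t s' t')\<^sup>2) \<partial>M) \<le>
        ennreal (C * (G1 s' - G1 s) powr a1 * (G2 t' - G2 t) powr a2)" by (simp add: mult.assoc)
    qed
  qed
qed

section \<open>Higher moments of rectangular increments\<close>

lemma norm1_shrink:
  assumes f: "integrable01 f" and x: "x \<longlonglongrightarrow> 0"
  shows "(\<lambda>N. norm1 (\<lambda>u. f u * indicator {0..x N} u)) \<longlonglongrightarrow> 0"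
proof -
  have fi: "integrable lborel (\<lambda>u. indicator {0..1} u *\<^sub>R f u)" using f unfolding integrable01_def set_integrable_def .
  have "(\<lambda>N. LINT u|lborel. indicator {0..1} u *\<^sub>R \<bar>f u * indicator {0..x N} u\<bar>) \<longlonglongrightarrow> (LINT u::real|lborel. 0 :: real)"
  proof (rule integral_dominated_convergence[where w="\<lambda>u. \<bar>indicator {0..1} u *\<^sub>R f u\<bar>"])
    show "integrable lborel (\<lambda>u. \<bar>indicator {0..1} u *\<^sub>R f u\<bar>)" using fi by (rule integrable_abs)
    show "(\<lambda>u. indicator {0..1} u *\<^sub>R \<bar>f u * indicator {0..x N} u\<bar>) \<in> borel_measurable lborel" for N
      using integrable01_abs[OF integrable01_indicator[OF _ f, of "{0..x N}"]] unfolding integrable01_def set_integrable_def by auto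
    have "AE u in lborel. u \<noteq> (0 :: real)" by (rule AE_lborel_singleton)
    then show "AE u in lborel. (\<lambda>N. indicator {0..1} u *\<^sub>R \<bar>f u * indicator {0..x N} u\<bar>) \<longlonglongrightarrow> 0"
    proof eventually_elim
      case (elim u)
      show ?case
      proof (cases "u > 0")
        case True
        then have "\<forall>\<^sub>F N in sequentially. x N < u" using order_tendstoD(2)[OF x] by blast
        then have "\<forall>\<^sub>F N in sequentially. indicator {0..1} u *\<^sub>R \<bar>f u * indicator {0..x N} u\<bar> = 0"
          by eventually_elim auto
        then show ?thesis by (rule tendsto_eventually)
      next
        case False
        then show ?thesis using elim by auto
      qed
    qed
    show "AE u in lborel. norm (indicator {0..1} u *\<^sub>R \<bar>f u * indicator {0..x N} u\<bar>) \<le> \<bar>indicator {0..1} u *\<^sub>R f u\<bar>" for N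
      by (rule AE_I2) (auto simp: indicator_def)
  qed simp_all
  then show ?thesis by (simp add: norm1_def set_lebesgue_integral_def)
qed

text \<open>Jensen's inequality for the weights \<open>w i / \<Sum> w\<close>. Geometric weights will compensate the decay of the summands,
so that a sum of arbitrarily many terms has a bounded moment.\<close>

lemma weighted_power_mean:
  fixes a w :: "'i \<Rightarrow> real"
  assumes I: "finite I" and w: "\<And>i. i \<in> I \<Longrightarrow> 0 < w i" and m: "even m" "0 < m" and W: "(\<Sum>i\<in>I. w i) \<le> W"
  shows "(\<Sum>i\<in>I. a i) ^ m \<le> W ^ (m - 1) * (\<Sum>i\<in>I. a i ^ m / w i ^ (m - 1))"
proof (cases "I = {}")
  case False
  define V where "V = (\<Sum>i\<in>I. w i)"
  have V: "0 < V" unfolding V_def using I False w by (intro sum_pos) auto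
  have "(\<Sum>i\<in>I. (w i / V) *\<^sub>R (a i * V / w i)) ^ m \<le> (\<Sum>i\<in>I. (w i / V) * (a i * V / w i) ^ m)"
    by (rule convex_on_sum[OF I False convex_power_even[OF m(1)]])
       (use w V in \<open>auto simp: sum_divide_distrib[symmetric] V_def[symmetric] less_imp_le\<close>)
  moreover have "(\<Sum>i\<in>I. (w i / V) *\<^sub>R (a i * V / w i)) = (\<Sum>i\<in>I. a i)"
    using w V by (intro sum.cong) (auto simp: field_simps less_imp_neq[symmetric])
  moreover have "(w i / V) * (a i * V / w i) ^ m = V ^ (m - 1) * (a i ^ m / w i ^ (m - 1))" if "i \<in> I" for i
  proof -
    obtain l where "m = Suc l" using m(2) by (cases m) auto
    then show ?thesis using w[OF that] V by (simp add: power_mult_distrib power_divide field_simps)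
  qed
  ultimately have "(\<Sum>i\<in>I. a i) ^ m \<le> V ^ (m - 1) * (\<Sum>i\<in>I. a i ^ m / w i ^ (m - 1))"
    by (simp add: sum_distrib_left)
  also have "\<dots> \<le> W ^ (m - 1) * (\<Sum>i\<in>I. a i ^ m / w i ^ (m - 1))"
    using V W m w by (intro mult_right_mono power_mono sum_nonneg divide_nonneg_nonneg)
      (auto simp: V_def zero_le_even_power less_imp_le)
  finally show ?thesis .
qed (use m in \<open>simp add: zero_power\<close>)

text \<open>Terms whose \<open>m\<close>-th moments decay geometrically have sums with bounded \<open>m\<close>-th moments; the bound does not
depend on the number of terms.\<close>

lemma moment_sum_geometric:
  fixes a :: "nat \<Rightarrow> nat \<Rightarrow> 'a \<Rightarrow> real"
  assumes meas: "\<And>i j. a i j \<in> borel_measurable M" and m: "even m" "0 < m" and q: "0 < q" "q < 1" and D: "0 \<le> D"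
    and mom: "\<And>i j. (\<integral>\<^sup>+\<omega>. ennreal ((a i j \<omega>) ^ m) \<partial>M) \<le> ennreal (D * (q ^ i * q ^ j) ^ m)"
  shows "(\<integral>\<^sup>+\<omega>. ennreal ((\<Sum>i<N. \<Sum>j<N. a i j \<omega>) ^ m) \<partial>M) \<le> ennreal (D * (1 / (1 - q)\<^sup>2) ^ m)"
proof -
  let ?I = "{..<N} \<times> {..<N}"
  define w where "w p = q ^ fst p * q ^ snd p" for p :: "nat \<times> nat"
  define W where "W = 1 / (1 - q)\<^sup>2"
  have w: "0 < w p" for p using q by (simp add: w_def)
  have W0: "0 \<le> W" by (simp add: W_def)
  have geo: "(\<Sum>i<N. q ^ i) \<le> 1 / (1 - q)"
    using sum_le_suminf[OF summable_geometric, of q "{..<N}"] suminf_geometric[of q] q by auto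
  have W: "(\<Sum>p\<in>?I. w p) \<le> W"
  proof -
    have "(\<Sum>p\<in>?I. w p) = (\<Sum>i<N. q ^ i) * (\<Sum>j<N. q ^ j)"
      by (simp add: w_def sum_product sum.cartesian_product case_prod_beta')
    also have "\<dots> \<le> (1 / (1 - q)) * (1 / (1 - q))"
      using geo q by (intro mult_mono sum_nonneg) auto
    finally show ?thesis by (simp add: W_def power2_eq_square)
  qed
  have cw: "0 \<le> W ^ (m - 1) * (1 / w p ^ (m - 1))" for p using W0 w[of p] by simp
  have "(\<integral>\<^sup>+\<omega>. ennreal ((\<Sum>i<N. \<Sum>j<N. a i j \<omega>) ^ m) \<partial>M) \<le>
    (\<integral>\<^sup>+\<omega>. (\<Sum>p\<in>?I. ennreal (W ^ (m - 1) * (1 / w p ^ (m - 1))) * ennreal ((a (fst p) (snd p) \<omega>) ^ m)) \<partial>M)"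
  proof (rule nn_integral_mono)
    fix \<omega>
    have "(\<Sum>i<N. \<Sum>j<N. a i j \<omega>) ^ m = (\<Sum>p\<in>?I. a (fst p) (snd p) \<omega>) ^ m"
      by (simp add: sum.cartesian_product case_prod_beta')
    also have "\<dots> \<le> W ^ (m - 1) * (\<Sum>p\<in>?I. (a (fst p) (snd p) \<omega>) ^ m / w p ^ (m - 1))"
      by (rule weighted_power_mean[OF _ w m W]) simp
    also have "\<dots> = (\<Sum>p\<in>?I. W ^ (m - 1) * (1 / w p ^ (m - 1)) * (a (fst p) (snd p) \<omega>) ^ m)"
      by (simp add: sum_distrib_left)
    finally have le: "ennreal ((\<Sum>i<N. \<Sum>j<N. a i j \<omega>) ^ m) \<le>
      ennreal (\<Sum>p\<in>?I. W ^ (m - 1) * (1 / w p ^ (m - 1)) * (a (fst p) (snd p) \<omega>) ^ m)" by (rule ennreal_leI)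
    have "(\<Sum>p\<in>?I. ennreal (W ^ (m - 1) * (1 / w p ^ (m - 1))) * ennreal ((a (fst p) (snd p) \<omega>) ^ m)) =
      (\<Sum>p\<in>?I. ennreal (W ^ (m - 1) * (1 / w p ^ (m - 1)) * (a (fst p) (snd p) \<omega>) ^ m))"
      using cw m by (intro sum.cong refl ennreal_mult[symmetric]) (auto simp: zero_le_even_power)
    also have "\<dots> = ennreal (\<Sum>p\<in>?I. W ^ (m - 1) * (1 / w p ^ (m - 1)) * (a (fst p) (snd p) \<omega>) ^ m)"
      using cw m by (intro sum_ennreal mult_nonneg_nonneg[OF cw]) (auto simp: zero_le_even_power)
    finally show "ennreal ((\<Sum>i<N. \<Sum>j<N. a i j \<omega>) ^ m) \<le>
      (\<Sum>p\<in>?I. ennreal (W ^ (m - 1) * (1 / w p ^ (m - 1))) * ennreal ((a (fst p) (snd p) \<omega>) ^ m))" using le by simp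
  qed
  also have "\<dots> = (\<Sum>p\<in>?I. ennreal (W ^ (m - 1) * (1 / w p ^ (m - 1))) * (\<integral>\<^sup>+\<omega>. ennreal ((a (fst p) (snd p) \<omega>) ^ m) \<partial>M))"
    using meas by (subst nn_integral_sum) (auto intro!: sum.cong nn_integral_cmult)
  also have "\<dots> \<le> (\<Sum>p\<in>?I. ennreal (W ^ (m - 1) * D * w p))"
  proof (rule sum_mono)
    fix p
    have "ennreal (W ^ (m - 1) * (1 / w p ^ (m - 1))) * (\<integral>\<^sup>+\<omega>. ennreal ((a (fst p) (snd p) \<omega>) ^ m) \<partial>M) \<le>
      ennreal (W ^ (m - 1) * (1 / w p ^ (m - 1))) * ennreal (D * w p ^ m)"
      unfolding w_def by (intro mult_left_mono mom) auto
    also have "\<dots> = ennreal (W ^ (m - 1) * (1 / w p ^ (m - 1)) * (D * w p ^ m))"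
      using cw[of p] D w[of p] by (intro ennreal_mult[symmetric]) auto
    also have "W ^ (m - 1) * (1 / w p ^ (m - 1)) * (D * w p ^ m) = W ^ (m - 1) * D * w p"
    proof -
      obtain l where "m = Suc l" using m(2) by (cases m) auto
      then show ?thesis using w[of p] by simp
    qed
    finally show "ennreal (W ^ (m - 1) * (1 / w p ^ (m - 1))) * (\<integral>\<^sup>+\<omega>. ennreal ((a (fst p) (snd p) \<omega>) ^ m) \<partial>M) \<le>
      ennreal (W ^ (m - 1) * D * w p)" .
  qed
  also have "\<dots> = ennreal (\<Sum>p\<in>?I. W ^ (m - 1) * D * w p)"
    using W0 D w by (intro sum_ennreal) (simp add: less_imp_le)
  also have "\<dots> \<le> ennreal (D * W ^ m)"
  proof (rule ennreal_leI)
    have "(\<Sum>p\<in>?I. W ^ (m - 1) * D * w p) = W ^ (m - 1) * D * (\<Sum>p\<in>?I. w p)" by (simp add: sum_distrib_left)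
    also have "\<dots> \<le> W ^ (m - 1) * D * W" using W W0 D by (intro mult_left_mono) auto
    also have "\<dots> = D * W ^ m" using m(2) by (cases m) auto
    finally show "(\<Sum>p\<in>?I. W ^ (m - 1) * D * w p) \<le> D * W ^ m" .
  qed
  finally show ?thesis unfolding W_def .
qed

text \<open>The cells \<open>(r\<^bsup>i+1\<^esup>, r\<^sup>i] \<times> (r\<^bsup>j+1\<^esup>, r\<^sup>j]\<close> exhaust the square. The double sum telescopes; the terms that remain besides
the full increment are integrals over strips along the axes of width \<open>r\<^sup>N\<close>, which tend to zero because the
kernel \<open>\<theta>\<close> is bounded for fixed \<open>\<omega>\<close>.\<close>

lemma Y_proc_incr_telescope:
  assumes h: "bounded_kernel (\<theta> n \<omega>) c" and K1: "regular_kernel K1 G1 a1" and K2: "regular_kernel K2 G2 a2"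
    and st: "s \<in> {0..1}" "s' \<in> {0..1}" "t \<in> {0..1}" "t' \<in> {0..1}" and r: "0 < r" "r < 1"
  shows "(\<lambda>N. \<Sum>i<N. \<Sum>j<N. rect_incr (Y_proc K1 K2 \<theta> s s' t t' n \<omega>) (r ^ Suc i) (r ^ Suc j) (r ^ i) (r ^ j)) \<longlonglongrightarrow>
    rect_incr (X_proc K1 K2 \<theta> n \<omega>) s t s' t'"
proof -
  let ?f = "\<lambda>x. K1 s' x - K1 s x" and ?g = "\<lambda>y. K2 t' y - K2 t y"
  define y where "y u v = Y_proc K1 K2 \<theta> s s' t t' n \<omega> (u, v)" for u v
  have fi: "integrable01 ?f" "integrable01 ?g"
    using regular_kernel.kernel_integrable01[OF K1] regular_kernel.kernel_integrable01[OF K2] st by (auto intro!: integrable01_diff)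
  have y: "y u v = kernel_form (\<theta> n \<omega>) (\<lambda>x. ?f x * indicator {0..u} x) (\<lambda>x. ?g x * indicator {0..v} x)"
    if "u \<in> {0..1}" "v \<in> {0..1}" for u v
    unfolding y_def by (rule Y_proc_kernel_form[OF that])
  have one: "(1::real) \<in> {0..1}" by simp
  have rm: "r ^ i \<in> {0..1}" for i using r by (auto intro: power_le_one)
  have r0: "(\<lambda>N. r ^ N) \<longlonglongrightarrow> 0" using r by (intro LIMSEQ_power_zero) auto
  have c: "0 \<le> c" using h unfolding bounded_kernel_def by (force intro: order_trans[OF abs_ge_zero])
  have yb: "\<bar>y u v\<bar> \<le> c * (norm1 (\<lambda>x. ?f x * indicator {0..u} x) * norm1 (\<lambda>x. ?g x * indicator {0..v} x))"
    if "u \<in> {0..1}" "v \<in> {0..1}" for u v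
    unfolding y[OF that] by (rule kernel_form_integrable(2)[OF h]) (intro integrable01_indicator fi; simp)+
  have lim1: "(\<lambda>N. c * (norm1 (\<lambda>x. ?f x * indicator {0..r ^ N} x) * norm1 (\<lambda>x. ?g x * indicator {0..1} x))) \<longlonglongrightarrow> c * (0 * norm1 (\<lambda>x. ?g x * indicator {0..1} x))"
    by (intro tendsto_intros norm1_shrink[OF fi(1) r0])
  have lim2: "(\<lambda>N. c * (norm1 (\<lambda>x. ?f x * indicator {0..1} x) * norm1 (\<lambda>x. ?g x * indicator {0..r ^ N} x))) \<longlonglongrightarrow> c * (norm1 (\<lambda>x. ?f x * indicator {0..1} x) * 0)"
    by (intro tendsto_intros norm1_shrink[OF fi(2) r0])
  have lim3: "(\<lambda>N. c * (norm1 (\<lambda>x. ?f x * indicator {0..r ^ N} x) * norm1 (\<lambda>x. ?g x * indicator {0..r ^ N} x))) \<longlonglongrightarrow> c * (0 * 0)"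
    by (intro tendsto_intros norm1_shrink[OF fi(1) r0] norm1_shrink[OF fi(2) r0])
  have y1: "(\<lambda>N. y (r ^ N) 1) \<longlonglongrightarrow> 0"
    by (rule Lim_null_comparison[OF _ lim1[simplified]]) (use yb rm one in \<open>auto intro!: always_eventually simp del: atLeastAtMost_iff\<close>)
  have y2: "(\<lambda>N. y 1 (r ^ N)) \<longlonglongrightarrow> 0"
    by (rule Lim_null_comparison[OF _ lim2[simplified]]) (use yb rm one in \<open>auto intro!: always_eventually simp del: atLeastAtMost_iff\<close>)
  have y3: "(\<lambda>N. y (r ^ N) (r ^ N)) \<longlonglongrightarrow> 0"
    by (rule Lim_null_comparison[OF _ lim3[simplified]]) (use yb rm one in \<open>auto intro!: always_eventually simp del: atLeastAtMost_iff\<close>)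
  have "y 1 1 = kernel_form (\<theta> n \<omega>) ?f ?g"
    unfolding y_def Y_proc_def kernel_form_def by simp
  also have "\<dots> = rect_incr (X_proc K1 K2 \<theta> n \<omega>) s t s' t'"
    by (rule X_proc_incr[where \<theta>=\<theta> and n=n and \<omega>=\<omega>, OF h K1 K2 st, symmetric])
  finally have y11: "y 1 1 = rect_incr (X_proc K1 K2 \<theta> n \<omega>) s t s' t'" .
  have S: "(\<Sum>i<N. \<Sum>j<N. rect_incr (Y_proc K1 K2 \<theta> s s' t t' n \<omega>) (r ^ Suc i) (r ^ Suc j) (r ^ i) (r ^ j)) =
     y (r ^ N) (r ^ N) - y (r ^ N) 1 - y 1 (r ^ N) + y 1 1" for N
    using sum_rect_incr_telescope[of "\<lambda>i j. y (r ^ i) (r ^ j)" N]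
    by (simp add: rect_incr_def y_def algebra_simps)
  have "(\<lambda>N. y (r ^ N) (r ^ N) - y (r ^ N) 1 - y 1 (r ^ N) + y 1 1) \<longlonglongrightarrow> 0 - 0 - 0 + y 1 1"
    by (intro tendsto_intros y1 y2 y3)
  then show ?thesis unfolding S y11 by simp
qed

text \<open>The ratio \<open>2/3\<close> keeps the cells of the geometric decomposition inside the range \<open>s0' < 2 s0\<close> of (H4). On the
cell \<open>(i, j)\<close> the last factor of (H4) is at most \<open>(q\<^sup>i q\<^sup>j)\<^sup>m\<close> with \<open>q = (2/3)\<^sup>\<gamma>\<close>, so \<open>moment_sum_geometric\<close>
bounds all partial sums, and Fatou's lemma bounds their limit. The condition on \<open>m\<close> is exactly
\<open>m \<rho>1 / 4 > 1\<close> and \<open>m \<rho>2 / 4 > 1\<close>.\<close>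

lemma rect_moment_of_H4:
  assumes \<theta>: "random_kernels M \<theta>" and H4: "H4 M \<theta> K1 K2 G1 G2 \<rho>1 \<rho>2"
    and K1: "regular_kernel K1 G1 \<rho>1" and K2: "regular_kernel K2 G2 \<rho>2"
  shows "\<exists>m C. even m \<and> 0 < m \<and> 1 < real m * \<rho>1 / 4 \<and> 1 < real m * \<rho>2 / 4 \<and> 0 \<le> C \<and>
    (\<forall>n. rect_moment M (X_proc K1 K2 \<theta> n) m G1 (real m * \<rho>1 / 4) G2 (real m * \<rho>2 / 4) C)"
proof -
  obtain m \<gamma> C0 where m: "even m" "real m > 4 / min \<rho>1 \<rho>2" and g: "0 < \<gamma>" "\<gamma> < 1" and
    H: "\<And>n s s' t t' s0 s0' t0 t0'.
          0 \<le> s \<and> s < s' \<and> s' \<le> 1 \<and> 0 \<le> t \<and> t < t' \<and> t' \<le> 1 \<and>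
          0 < s0 \<and> s0 < s0' \<and> s0' < 2 * s0 \<and> s0' \<le> 1 \<and>
          0 < t0 \<and> t0 < t0' \<and> t0' < 2 * t0 \<and> t0' \<le> 1 \<Longrightarrow>
          integrable M (\<lambda>\<omega>. (rect_incr (Y_proc K1 K2 \<theta> s s' t t' n \<omega>) s0 t0 s0' t0') ^ m) \<and>
          (LINT \<omega>|M. (rect_incr (Y_proc K1 K2 \<theta> s s' t t' n \<omega>) s0 t0 s0' t0') ^ m)
            \<le> C0 * (G1 s' - G1 s) powr (real m * \<rho>1 / 4) * (G2 t' - G2 t) powr (real m * \<rho>2 / 4)
                * ((s0' - s0) * (t0' - t0)) powr (real m * \<gamma>)"
    using H4 unfolding H4_def by metis
  have rho: "0 < \<rho>1" "0 < \<rho>2" using K1 K2 by (auto simp: regular_kernel_def)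
  have m4: "4 < real m * min \<rho>1 \<rho>2" using m(2) rho by (simp add: field_simps min_def split: if_splits)
  have mle: "real m * min \<rho>1 \<rho>2 \<le> real m * \<rho>1" "real m * min \<rho>1 \<rho>2 \<le> real m * \<rho>2" by (simp_all add: mult_left_mono)
  have m0: "0 < m" using m4 by (cases m) auto
  define r :: real where "r = 2/3"
  have r_le: "0 < r" "r \<le> 1" by (auto simp: r_def)
  define q where "q = r powr \<gamma>"
  define C where "C = max C0 0"
  have q: "0 < q" "q < 1" using g powr_less_mono2[of \<gamma> r 1] by (auto simp: q_def r_def)
  define C' where "C' = C * (1 / (1 - q)\<^sup>2) ^ m"
  have C': "0 \<le> C'" by (simp add: C'_def C_def)
  have "rect_moment M (X_proc K1 K2 \<theta> n) m G1 (real m * \<rho>1 / 4) G2 (real m * \<rho>2 / 4) C'" for n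
    unfolding rect_moment_def
  proof (intro allI impI)
    fix s s' t t' :: real assume st: "0 \<le> s \<and> s < s' \<and> s' \<le> 1 \<and> 0 \<le> t \<and> t < t' \<and> t' \<le> 1"
    then have mem: "s \<in> {0..1}" "s' \<in> {0..1}" "t \<in> {0..1}" "t' \<in> {0..1}" by auto
    define Q where "Q = (G1 s' - G1 s) powr (real m * \<rho>1 / 4) * (G2 t' - G2 t) powr (real m * \<rho>2 / 4)"
    have Q: "0 \<le> Q" by (simp add: Q_def)
    define a where "a i j \<omega> = rect_incr (Y_proc K1 K2 \<theta> s s' t t' n \<omega>) (r ^ Suc i) (r ^ Suc j) (r ^ i) (r ^ j)" for i j \<omega>
    have rm: "r ^ i \<in> {0..1}" for i by (auto simp: r_def intro: power_le_one)
    have fi: "integrable01 (\<lambda>x. K1 s' x - K1 s x)" "integrable01 (\<lambda>y. K2 t' y - K2 t y)"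
      using regular_kernel.kernel_integrable01[OF K1] regular_kernel.kernel_integrable01[OF K2] mem by (auto intro!: integrable01_diff)
    have ym: "(\<lambda>\<omega>. Y_proc K1 K2 \<theta> s s' t t' n \<omega> (u, v)) \<in> borel_measurable M" if "u \<in> {0..1}" "v \<in> {0..1}" for u v
      unfolding Y_proc_kernel_form[OF that]
      by (rule kernel_form_measurable[OF \<theta>]) (intro integrable01_indicator fi; simp)+
    have am: "a i j \<in> borel_measurable M" for i j
      unfolding a_def rect_incr_def by (intro borel_measurable_add borel_measurable_diff ym rm)
    have ab: "(\<integral>\<^sup>+\<omega>. ennreal ((a i j \<omega>) ^ m) \<partial>M) \<le> ennreal ((C * Q) * (q ^ i * q ^ j) ^ m)" for i j
    proof -
      have lt: "0 < r ^ Suc i \<and> r ^ Suc i < r ^ i \<and> r ^ i < 2 * r ^ Suc i \<and> r ^ i \<le> 1" for i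
        using rm[of i] by (auto simp: r_def)
      have I: "integrable M (\<lambda>\<omega>. (a i j \<omega>) ^ m)" and
        le: "(LINT \<omega>|M. (a i j \<omega>) ^ m) \<le> C0 * (G1 s' - G1 s) powr (real m * \<rho>1 / 4) * (G2 t' - G2 t) powr (real m * \<rho>2 / 4)
                * ((r ^ i - r ^ Suc i) * (r ^ j - r ^ Suc j)) powr (real m * \<gamma>)"
        using H[of s s' t t' "r ^ Suc i" "r ^ i" "r ^ Suc j" "r ^ j" n] st lt[of i] lt[of j] unfolding a_def by blast+
      have pw: "((r ^ i - r ^ Suc i) * (r ^ j - r ^ Suc j)) powr (real m * \<gamma>) \<le> (q ^ i * q ^ j) ^ m"
      proof -
        have "((r ^ i - r ^ Suc i) * (r ^ j - r ^ Suc j)) powr (real m * \<gamma>) \<le> (r ^ i * r ^ j) powr (real m * \<gamma>)"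
          using lt[of i] lt[of j] g r_le by (intro powr_mono2 mult_mono mult_nonneg_nonneg) auto
        also have "\<dots> = ((r powr \<gamma>) powr real (i + j)) powr real m"
          by (simp add: r_def powr_realpow[symmetric] powr_add[symmetric] powr_powr algebra_simps)
        also have "\<dots> = (q ^ i * q ^ j) ^ m"
          using q by (simp add: q_def[symmetric] powr_realpow power_add del: of_nat_add)
        finally show ?thesis .
      qed
      have "(LINT \<omega>|M. (a i j \<omega>) ^ m) \<le> C0 * (Q * ((r ^ i - r ^ Suc i) * (r ^ j - r ^ Suc j)) powr (real m * \<gamma>))"
        using le by (simp add: Q_def mult.assoc)
      also have "\<dots> \<le> C * (Q * ((r ^ i - r ^ Suc i) * (r ^ j - r ^ Suc j)) powr (real m * \<gamma>))"
        using Q by (intro mult_right_mono mult_nonneg_nonneg) (auto simp: C_def)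
      also have "\<dots> \<le> C * (Q * (q ^ i * q ^ j) ^ m)"
        using pw Q by (intro mult_left_mono) (auto simp: C_def)
      finally have "(LINT \<omega>|M. (a i j \<omega>) ^ m) \<le> (C * Q) * (q ^ i * q ^ j) ^ m" by (simp add: mult.assoc)
      then show ?thesis using I m(1)
        by (subst nn_integral_eq_integral) (auto intro!: ennreal_leI simp: zero_le_even_power)
    qed
    have CQ: "0 \<le> C * Q" using Q by (simp add: C_def)
    note bound = moment_sum_geometric[where a=a, OF am m(1) m0 q CQ ab]
    have "(\<integral>\<^sup>+\<omega>. ennreal ((rect_incr (X_proc K1 K2 \<theta> n \<omega>) s t s' t') ^ m) \<partial>M) =
      (\<integral>\<^sup>+\<omega>. liminf (\<lambda>N. ennreal ((\<Sum>i<N. \<Sum>j<N. a i j \<omega>) ^ m)) \<partial>M)"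
    proof (rule nn_integral_cong)
      fix \<omega> assume "\<omega> \<in> space M"
      then obtain c where h: "bounded_kernel (\<theta> n \<omega>) c" using random_kernel_bounded[OF \<theta>] by blast
      have "(\<lambda>N. \<Sum>i<N. \<Sum>j<N. a i j \<omega>) \<longlonglongrightarrow> rect_incr (X_proc K1 K2 \<theta> n \<omega>) s t s' t'"
        unfolding a_def by (rule Y_proc_incr_telescope[where \<theta>=\<theta> and n=n and \<omega>=\<omega>, OF h K1 K2 mem]) (auto simp: r_def)
      then have "(\<lambda>N. ennreal ((\<Sum>i<N. \<Sum>j<N. a i j \<omega>) ^ m)) \<longlonglongrightarrow> ennreal ((rect_incr (X_proc K1 K2 \<theta> n \<omega>) s t s' t') ^ m)"
        by (intro tendsto_ennrealI tendsto_power)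
      from lim_imp_Liminf[OF _ this]
      show "ennreal ((rect_incr (X_proc K1 K2 \<theta> n \<omega>) s t s' t') ^ m) = liminf (\<lambda>N. ennreal ((\<Sum>i<N. \<Sum>j<N. a i j \<omega>) ^ m))"
        by simp
    qed
    also have "\<dots> \<le> liminf (\<lambda>N. \<integral>\<^sup>+\<omega>. ennreal ((\<Sum>i<N. \<Sum>j<N. a i j \<omega>) ^ m) \<partial>M)"
      by (rule nn_integral_liminf) (intro measurable_compose[OF _ measurable_ennreal] borel_measurable_power borel_measurable_sum am)
    also have "\<dots> \<le> liminf (\<lambda>N :: nat. ennreal (C * Q * (1 / (1 - q)\<^sup>2) ^ m))"
      by (rule Liminf_mono, rule always_eventually, rule allI, rule bound)
    also have "\<dots> = ennreal (C * Q * (1 / (1 - q)\<^sup>2) ^ m)" by (simp add: Liminf_const)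
    finally show "(\<integral>\<^sup>+\<omega>. ennreal ((rect_incr (X_proc K1 K2 \<theta> n \<omega>) s t s' t') ^ m) \<partial>M) \<le>
      ennreal (C' * (G1 s' - G1 s) powr (real m * \<rho>1 / 4) * (G2 t' - G2 t) powr (real m * \<rho>2 / 4))"
      by (simp add: C'_def Q_def ac_simps)
  qed
  moreover have "1 < real m * \<rho>1 / 4" "1 < real m * \<rho>2 / 4" using m4 mle by linarith+
  ultimately show ?thesis using m(1) m0 C' by blast
qed

section \<open>Step functions of one variable and their tensor products\<close>

lemma square_add_le: "(x + y)\<^sup>2 \<le> 2 * x\<^sup>2 + 2 * y\<^sup>2" for x y :: real
proof -
  have "0 \<le> (x - y)\<^sup>2" by simp
  then show ?thesis by (simp add: power2_eq_square algebra_simps)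
qed

lemma in_L2_add:
  assumes "in_L2 f" "in_L2 g"
  shows "in_L2 (\<lambda>x. f x + g x)" and "sqnorm2 (\<lambda>x. f x + g x) \<le> 2 * sqnorm2 f + 2 * sqnorm2 g"
proof -
  have m: "set_borel_measurable lborel {0..1} (\<lambda>x. f x + g x)"
    using assms unfolding in_L2_def set_borel_measurable_def by (auto simp: distrib_left intro!: borel_measurable_add)
  have "(\<lambda>x. (indicator {0..1} x *\<^sub>R (f x + g x))\<^sup>2) \<in> borel_measurable lborel"
    using m unfolding set_borel_measurable_def by (intro borel_measurable_power) auto
  also have "(\<lambda>x. (indicator {0..1} x *\<^sub>R (f x + g x))\<^sup>2) = (\<lambda>x. indicator {0..1} x *\<^sub>R (f x + g x)\<^sup>2)"
    by (auto simp: indicator_def)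
  finally have m2: "set_borel_measurable lborel {0..1} (\<lambda>x. (f x + g x)\<^sup>2)" unfolding set_borel_measurable_def .
  have dom: "set_integrable lborel {0..1} (\<lambda>x. 2 * (f x)\<^sup>2 + 2 * (g x)\<^sup>2)"
    using assms unfolding in_L2_def by (intro set_integral_add) auto
  have I: "set_integrable lborel {0..1} (\<lambda>x. (f x + g x)\<^sup>2)"
    by (rule set_integrable_bound[OF dom m2]) (auto intro!: AE_I2 square_add_le)
  then show "in_L2 (\<lambda>x. f x + g x)" using m unfolding in_L2_def by simp
  have "sqnorm2 (\<lambda>x. f x + g x) \<le> (LINT x:{0..1}|lborel. 2 * (f x)\<^sup>2 + 2 * (g x)\<^sup>2)"
    unfolding sqnorm2_def by (rule set_integral_mono[OF I dom square_add_le])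
  also have "\<dots> = 2 * sqnorm2 f + 2 * sqnorm2 g"
    using assms unfolding in_L2_def sqnorm2_def by (subst set_integral_add) auto
  finally show "sqnorm2 (\<lambda>x. f x + g x) \<le> 2 * sqnorm2 f + 2 * sqnorm2 g" .
qed

lemma in_L2_cmult: "in_L2 f \<Longrightarrow> in_L2 (\<lambda>x. c * f x)"
  unfolding in_L2_def by (auto simp: power_mult_distrib set_borel_measurable_def mult.left_commute[of _ c])

lemma in_L2_diff: "in_L2 f \<Longrightarrow> in_L2 g \<Longrightarrow> in_L2 (\<lambda>x. f x - g x)"
  using in_L2_add(1)[OF _ in_L2_cmult[of g "-1"], of f] by simp

type_synonym step1 = "(real \<times> real \<times> real) list"

definition valid_step1 :: "step1 \<Rightarrow> bool" where
  "valid_step1 T \<longleftrightarrow> (\<forall>(c, a, b) \<in> set T. 0 \<le> a \<and> a \<le> b \<and> b \<le> 1)"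

definition step_fun1 :: "step1 \<Rightarrow> real \<Rightarrow> real" where
  "step_fun1 T x = (\<Sum>(c, a, b) \<leftarrow> T. c * indicator {a<..b} x)"

definition tensor_step :: "step1 \<Rightarrow> step1 \<Rightarrow> step" where
  "tensor_step T U = concat (map (\<lambda>(c, a, b). map (\<lambda>(c', a', b'). (c * c', a, b, a', b')) U) T)"

lemma valid_tensor_step: "valid_step1 T \<Longrightarrow> valid_step1 U \<Longrightarrow> valid_step (tensor_step T U)"
  unfolding valid_step_def valid_step1_def tensor_step_def by fastforce

lemma step_fun_append: "step_fun (S @ S') p = step_fun S p + step_fun S' p"
  by (simp add: step_fun_def)

lemma step_fun_tensor: "step_fun (tensor_step T U) p = step_fun1 T (fst p) * step_fun1 U (snd p)"
proof (induction T)
  case (Cons e T)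
  obtain c a b where e: "e = (c, a, b)" by (cases e)
  have "step_fun (map (\<lambda>(c', a', b'). (c * c', a, b, a', b')) U) p = c * indicator {a<..b} (fst p) * step_fun1 U (snd p)"
    by (induction U) (auto simp: step_fun_def step_fun1_def indicator_def algebra_simps mem_Times_iff)
  then show ?case using Cons by (simp add: tensor_step_def e step_fun_append step_fun1_def algebra_simps)
qed (simp add: tensor_step_def step_fun_def step_fun1_def)

lemma step_fun1_L2: "in_L2 (step_fun1 T)"
proof (induction T)
  case Nil
  then show ?case by (simp add: in_L2_def step_fun1_def set_borel_measurable_def set_integrable_def)
next
  case (Cons e T)
  obtain c a b where e: "e = (c, a, b)" by (cases e)
  have "in_L2 (indicator {a<..b})"
  proof -
    have "integrable01 (indicator {a<..b})" by (rule integrable01_indicator1) simp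
    moreover have "(\<lambda>x. (indicator {a<..b} x :: real)\<^sup>2) = indicator {a<..b}" by (auto simp: indicator_def)
    ultimately show ?thesis
      unfolding in_L2_def integrable01_def set_borel_measurable_def by (auto simp: set_integrable_def)
  qed
  then have "in_L2 (\<lambda>x. c * indicator {a<..b} x + step_fun1 T x)"
    by (intro in_L2_add(1) in_L2_cmult Cons)
  then show ?case by (simp add: step_fun1_def e)
qed

lemma rect_incr_zeta:
  assumes h: "bounded_kernel (\<theta> n \<omega>) c" and ab: "0 \<le> a" "a \<le> b" "b \<le> 1" "0 \<le> a'" "a' \<le> b'" "b' \<le> 1"
  shows "rect_incr (zeta_proc \<theta> n \<omega>) a a' b b' = kernel_form (\<theta> n \<omega>) (indicator {a<..b}) (indicator {a'<..b'})"
proof -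
  have "rect_incr (zeta_proc \<theta> n \<omega>) a a' b b' =
    kernel_form (\<theta> n \<omega>) (\<lambda>x. indicator {0..b} x - indicator {0..a} x) (\<lambda>x. indicator {0..b'} x - indicator {0..a'} x)"
    by (rule rect_incr_kernel_form[OF h, where F="\<lambda>s. indicator {0..s}" and H="\<lambda>s. indicator {0..s}"])
       (use ab in \<open>auto intro!: integrable01_indicator1 zeta_proc_kernel_form[where \<theta>=\<theta> and n=n and \<omega>=\<omega>, OF h]\<close>)
  moreover have "(\<lambda>x. indicator {0..v} x - indicator {0..u} x) = (indicator {u<..v} :: real \<Rightarrow> real)" if "0 \<le> u" "u \<le> v" for u v
    using that by (auto simp: indicator_def fun_eq_iff)
  ultimately show ?thesis using ab by simp
qed

lemma step_integral_append: "step_integral x (S @ S') = step_integral x S + step_integral x S'"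
  by (simp add: step_integral_def)

text \<open>Increments of \<open>zeta_proc\<close> are integrals of \<open>\<theta>\<close> over rectangles, so a step kernel integrates \<open>\<theta>\<close> exactly.\<close>

lemma step_integral_zeta:
  assumes h: "bounded_kernel (\<theta> n \<omega>) c" and T: "valid_step1 T" and U: "valid_step1 U"
  shows "step_integral (zeta_proc \<theta> n \<omega>) (tensor_step T U) = kernel_form (\<theta> n \<omega>) (step_fun1 T) (step_fun1 U)"
  using T
proof (induction T)
  case Nil
  then show ?case by (simp add: tensor_step_def step_integral_def step_fun1_def kernel_form_zero)
next
  case (Cons e T)
  let ?h = "\<theta> n \<omega>" and ?z = "zeta_proc \<theta> n \<omega>"
  obtain k a b where e: "e = (k, a, b)" by (cases e)
  have ab: "0 \<le> a" "a \<le> b" "b \<le> 1" and T: "valid_step1 T" using Cons.prems e by (auto simp: valid_step1_def)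
  have i: "integrable01 (step_fun1 V)" for V by (rule in_L2_integrable01[OF step_fun1_L2])
  have j: "integrable01 (indicator {u<..v})" for u v :: real by (rule integrable01_indicator1) simp
  have "step_integral ?z (map (\<lambda>(c', a', b'). (k * c', a, b, a', b')) U) = k * kernel_form ?h (indicator {a<..b}) (step_fun1 U)"
    using U
  proof (induction U)
    case Nil
    then show ?case by (simp add: step_integral_def step_fun1_def kernel_form_zero)
  next
    case (Cons e' U)
    obtain k' a' b' where e': "e' = (k', a', b')" by (cases e')
    have ab': "0 \<le> a'" "a' \<le> b'" "b' \<le> 1" and U: "valid_step1 U" using Cons.prems e' by (auto simp: valid_step1_def)
    have "step_fun1 (e' # U) = (\<lambda>x. k' * indicator {a'<..b'} x + step_fun1 U x)" by (auto simp: step_fun1_def e')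
    then have "kernel_form ?h (indicator {a<..b}) (step_fun1 (e' # U)) =
      k' * kernel_form ?h (indicator {a<..b}) (indicator {a'<..b'}) + kernel_form ?h (indicator {a<..b}) (step_fun1 U)"
      by (simp add: kernel_form_add(2)[OF h integrable01_cmult[OF j] i j] kernel_form_cmult)
    then show ?case using Cons.IH[OF U] rect_incr_zeta[where \<theta>=\<theta> and n=n and \<omega>=\<omega>, OF h ab ab']
      by (simp add: step_integral_def e' distrib_left mult.assoc)
  qed
  moreover have "step_fun1 (e # T) = (\<lambda>x. k * indicator {a<..b} x + step_fun1 T x)" by (auto simp: step_fun1_def e)
  then have "kernel_form ?h (step_fun1 (e # T)) (step_fun1 U) = k * kernel_form ?h (indicator {a<..b}) (step_fun1 U) + kernel_form ?h (step_fun1 T) (step_fun1 U)"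
    by (simp add: kernel_form_add(1)[OF h integrable01_cmult[OF j] i i] kernel_form_cmult)
  ultimately show ?case using Cons.IH[OF T] by (simp add: tensor_step_def e step_integral_append)
qed

section \<open>Approximation by slices of planar step functions\<close>

lemma nn_integral_square_L2:
  assumes "in_L2 f"
  shows "(\<integral>\<^sup>+x. ennreal ((indicator {0..1} x * f x)\<^sup>2) \<partial>lborel) = ennreal (sqnorm2 f)"
proof -
  have "integrable lborel (\<lambda>x. indicator {0..1} x *\<^sub>R (f x)\<^sup>2)"
    using assms by (simp add: in_L2_def set_integrable_def)
  from nn_integral_eq_integral[OF this]
  have "(\<integral>\<^sup>+x. ennreal (indicator {0..1} x *\<^sub>R (f x)\<^sup>2) \<partial>lborel) = ennreal (sqnorm2 f)"
    unfolding sqnorm2_def set_lebesgue_integral_def by simp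
  moreover have "(indicator {0..1} x * f x)\<^sup>2 = indicator {0..1} x *\<^sub>R (f x)\<^sup>2" for x
    by (simp add: indicator_def)
  ultimately show ?thesis by simp
qed

text \<open>For fixed \<open>v\<close> with \<open>g v \<noteq> 0\<close>, the function \<open>\<sigma> u v / g v\<close> of \<open>u\<close> is a step function whose squared distance to \<open>f\<close> is
\<open>(g v)\<^sup>-\<^sup>2\<close> times the inner integral. If every such distance were at least \<open>\<epsilon>\<close>, integrating over \<open>v\<close> would give
at least \<open>\<epsilon> * sqnorm2 g\<close>.\<close>

lemma step_approx_slice:
  assumes f: "in_L2 f" and g: "in_L2 g"
    and slice: "\<And>v k. \<exists>T. valid_step1 T \<and> (\<forall>u. step_fun1 T u = k * \<sigma> u v)"
    and int: "(\<integral>\<^sup>+v. \<integral>\<^sup>+u. ennreal ((indicator {0..1} v * (indicator {0..1} u * (f u * g v - \<sigma> u v)))\<^sup>2) \<partial>lborel \<partial>lborel)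
      < ennreal (\<epsilon> * sqnorm2 g)" and eps: "0 \<le> \<epsilon>"
  obtains T where "valid_step1 T" "sqnorm2 (\<lambda>x. f x - step_fun1 T x) < \<epsilon>"
proof (rule ccontr)
  assume neg: "\<not> thesis"
  have big: "\<epsilon> \<le> sqnorm2 (\<lambda>x. f x - step_fun1 T x)" if "valid_step1 T" for T
    using that neg \<open>\<And>T. valid_step1 T \<Longrightarrow> sqnorm2 (\<lambda>x. f x - step_fun1 T x) < \<epsilon> \<Longrightarrow> thesis\<close> by force
  have "ennreal \<epsilon> * ennreal ((indicator {0..1} v * g v)\<^sup>2) \<le>
    (\<integral>\<^sup>+u. ennreal ((indicator {0..1} v * (indicator {0..1} u * (f u * g v - \<sigma> u v)))\<^sup>2) \<partial>lborel)" for v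
  proof (cases "v \<in> {0..1} \<and> g v \<noteq> 0")
    case True
    obtain T where T: "valid_step1 T" "\<And>u. step_fun1 T u = (1 / g v) * \<sigma> u v" using slice by blast
    have L: "in_L2 (\<lambda>x. f x - step_fun1 T x)" by (intro in_L2_diff f step_fun1_L2)
    have eq: "f u * g v - \<sigma> u v = g v * (f u - step_fun1 T u)" for u
      using True by (simp add: T(2) field_simps)
    have "(\<lambda>u. ennreal ((indicator {0..1} v * (indicator {0..1} u * (f u * g v - \<sigma> u v)))\<^sup>2)) =
      (\<lambda>u. ennreal ((g v)\<^sup>2) * ennreal ((indicator {0..1} u * (f u - step_fun1 T u))\<^sup>2))"
      unfolding eq using True by (simp add: ennreal_mult[symmetric] power_mult_distrib mult.left_commute)
    moreover have "(\<lambda>u. indicator {0..1} u * (f u - step_fun1 T u)) \<in> borel_measurable lborel"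
      using L unfolding in_L2_def set_borel_measurable_def by simp
    ultimately have "(\<integral>\<^sup>+u. ennreal ((indicator {0..1} v * (indicator {0..1} u * (f u * g v - \<sigma> u v)))\<^sup>2) \<partial>lborel) =
      ennreal ((g v)\<^sup>2) * ennreal (sqnorm2 (\<lambda>x. f x - step_fun1 T x))"
      unfolding nn_integral_square_L2[OF L, symmetric] by (simp add: nn_integral_cmult)
    also have "\<dots> \<ge> ennreal ((g v)\<^sup>2) * ennreal \<epsilon>"
      by (intro mult_left_mono ennreal_leI big T) auto
    finally show ?thesis using True by (simp add: mult.commute)
  qed (auto simp: indicator_def)
  then have "(\<integral>\<^sup>+v. ennreal \<epsilon> * ennreal ((indicator {0..1} v * g v)\<^sup>2) \<partial>lborel) \<le>
    (\<integral>\<^sup>+v. \<integral>\<^sup>+u. ennreal ((indicator {0..1} v * (indicator {0..1} u * (f u * g v - \<sigma> u v)))\<^sup>2) \<partial>lborel \<partial>lborel)"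
    by (rule nn_integral_mono)
  moreover have "(\<lambda>v. indicator {0..1} v * g v) \<in> borel_measurable lborel"
    using g unfolding in_L2_def set_borel_measurable_def by simp
  then have "(\<integral>\<^sup>+v. ennreal \<epsilon> * ennreal ((indicator {0..1} v * g v)\<^sup>2) \<partial>lborel) = ennreal (\<epsilon> * sqnorm2 g)"
    using eps by (simp add: nn_integral_cmult nn_integral_square_L2[OF g] ennreal_mult sqnorm2_nonneg)
  ultimately show False using int by simp
qed

lemma step_slice:
  assumes S: "valid_step S"
  shows "\<exists>T. valid_step1 T \<and> (\<forall>u. step_fun1 T u = k * step_fun S (u, v))"
    and "\<exists>T. valid_step1 T \<and> (\<forall>v. step_fun1 T v = k * step_fun S (u, v))"
proof -
  let ?T = "map (\<lambda>(c, a, b, a', b'). (k * c * indicator {a'<..b'} v, a, b)) S"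
  have "step_fun1 ?T u = k * step_fun S (u, v)" for u
    by (induction S) (auto simp: step_fun1_def step_fun_def indicator_def algebra_simps)
  moreover have "valid_step1 ?T" using S by (fastforce simp: valid_step1_def valid_step_def)
  ultimately show "\<exists>T. valid_step1 T \<and> (\<forall>u. step_fun1 T u = k * step_fun S (u, v))" by blast
  let ?T = "map (\<lambda>(c, a, b, a', b'). (k * c * indicator {a<..b} u, a', b')) S"
  have "step_fun1 ?T v = k * step_fun S (u, v)" for v
    by (induction S) (auto simp: step_fun1_def step_fun_def indicator_def algebra_simps)
  moreover have "valid_step1 ?T" using S by (fastforce simp: valid_step1_def valid_step_def)
  ultimately show "\<exists>T. valid_step1 T \<and> (\<forall>v. step_fun1 T v = k * step_fun S (u, v))" by blast
qed

lemma step_fun_measurable [measurable]: "step_fun S \<in> borel_measurable borel"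
proof (induction S)
  case (Cons e S)
  obtain c a b a' b' where e: "e = (c, a, b, a', b')" by (cases e)
  have "{a<..b} \<times> {a'<..b'} \<in> sets (borel :: (real \<times> real) measure)"
    unfolding borel_prod[symmetric] by (rule pair_measureI) auto
  then have "(\<lambda>p. c * indicator ({a<..b} \<times> {a'<..b'}) p + step_fun S p) \<in> borel_measurable borel"
    by (intro borel_measurable_add borel_measurable_times borel_measurable_const borel_measurable_indicator Cons)
  then show ?case by (simp add: step_fun_def e)
qed (simp add: step_fun_def)

lemma tensor_L2_measurable:
  assumes "in_L2 f" "in_L2 g"
  shows "(\<lambda>p. (indicator {0..1} (snd p) * (indicator {0..1} (fst p) * (f (fst p) * g (snd p) - step_fun S p)))) \<in> borel_measurable lborel"
proof -
  have "(\<lambda>p. indicator unit_square p *\<^sub>R (f (fst p) * g (snd p))) \<in> borel_measurable lborel"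
    using tensor_set_integrable(1)[OF in_L2_integrable01[OF assms(1)] in_L2_integrable01[OF assms(2)]] unfolding set_integrable_def by auto
  moreover have "unit_square \<in> sets (borel :: (real \<times> real) measure)" by (intro borel_closed closed_Times) auto
  ultimately have "(\<lambda>p. indicator unit_square p *\<^sub>R (f (fst p) * g (snd p)) - indicator unit_square p * step_fun S p) \<in> borel_measurable lborel"
    by (intro borel_measurable_diff borel_measurable_times) auto
  also have "(\<lambda>p. indicator unit_square p *\<^sub>R (f (fst p) * g (snd p)) - indicator unit_square p * step_fun S p) =
    (\<lambda>p. (indicator {0..1} (snd p) * (indicator {0..1} (fst p) * (f (fst p) * g (snd p) - step_fun S p))))"
    by (auto simp: indicator_def fun_eq_iff)
  finally show ?thesis .
qed

definition sqdist :: "(real \<times> real \<Rightarrow> real) \<Rightarrow> (real \<times> real \<Rightarrow> real) \<Rightarrow> ennreal" where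
  "sqdist F S = (\<integral>\<^sup>+p\<in>unit_square. ennreal ((F p - S p)\<^sup>2) \<partial>lborel)"

text \<open>The two orders of integration serve to slice in either variable.\<close>

lemma sqdist_iterated:
  assumes f: "in_L2 f" and g: "in_L2 g"
  shows "sqdist (\<lambda>p. f (fst p) * g (snd p)) (step_fun S) =
    (\<integral>\<^sup>+v. \<integral>\<^sup>+u. ennreal ((indicator {0..1} v * (indicator {0..1} u * (f u * g v - step_fun S (u, v))))\<^sup>2) \<partial>lborel \<partial>lborel)"
    and "sqdist (\<lambda>p. f (fst p) * g (snd p)) (step_fun S) =
    (\<integral>\<^sup>+u. \<integral>\<^sup>+v. ennreal ((indicator {0..1} u * (indicator {0..1} v * (g v * f u - step_fun S (u, v))))\<^sup>2) \<partial>lborel \<partial>lborel)"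
proof -
  let ?F = "\<lambda>p. ennreal ((indicator {0..1} (snd p) * (indicator {0..1} (fst p) * (f (fst p) * g (snd p) - step_fun S p)))\<^sup>2)"
  have m: "?F \<in> borel_measurable (lborel \<Otimes>\<^sub>M lborel)"
    unfolding lborel_prod
    by (intro measurable_compose[OF _ measurable_ennreal] borel_measurable_power tensor_L2_measurable f g)
  have e: "sqdist (\<lambda>p. f (fst p) * g (snd p)) (step_fun S) = (\<integral>\<^sup>+p. ?F p \<partial>(lborel \<Otimes>\<^sub>M lborel))"
    unfolding sqdist_def lborel_prod by (intro nn_integral_cong) (auto simp: indicator_def)
  show "sqdist (\<lambda>p. f (fst p) * g (snd p)) (step_fun S) =
    (\<integral>\<^sup>+v. \<integral>\<^sup>+u. ennreal ((indicator {0..1} v * (indicator {0..1} u * (f u * g v - step_fun S (u, v))))\<^sup>2) \<partial>lborel \<partial>lborel)"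
    unfolding e lborel_pair.nn_integral_snd[OF m, symmetric] by simp
  show "sqdist (\<lambda>p. f (fst p) * g (snd p)) (step_fun S) =
    (\<integral>\<^sup>+u. \<integral>\<^sup>+v. ennreal ((indicator {0..1} u * (indicator {0..1} v * (g v * f u - step_fun S (u, v))))\<^sup>2) \<partial>lborel \<partial>lborel)"
    unfolding e lborel.nn_integral_fst[OF m, symmetric] by (simp add: ac_simps)
qed

text \<open>Up to a constant factor, this bounds the mean square error of the step approximation for every \<open>X n\<close>, by
(H3), and for the Wiener integral, by isometry. One choice of step functions therefore serves all \<open>n\<close> and the
limit.\<close>

definition tensor_err :: "(real \<Rightarrow> real) \<Rightarrow> (real \<Rightarrow> real) \<Rightarrow> step1 \<Rightarrow> step1 \<Rightarrow> real" where
  "tensor_err f g T U = sqnorm2 (\<lambda>x. f x - step_fun1 T x) * sqnorm2 g + sqnorm2 (step_fun1 T) * sqnorm2 (\<lambda>x. g x - step_fun1 U x)"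

lemma sqnorm2_zero: "sqnorm2 (\<lambda>x. 0) = 0" by (simp add: sqnorm2_def)

lemma tensor_step_approx:
  assumes f: "in_L2 f" and g: "in_L2 g" and S: "\<And>k. valid_step (S k)"
    and lim: "(\<lambda>k. sqdist (\<lambda>p. f (fst p) * g (snd p)) (step_fun (S k))) \<longlonglongrightarrow> 0" and eps: "\<epsilon> > 0"
  obtains T U where "valid_step1 T" "valid_step1 U" "tensor_err f g T U < \<epsilon>"
proof (cases "sqnorm2 f = 0 \<or> sqnorm2 g = 0")
  case True
  have n: "step_fun1 [] = (\<lambda>x. 0)" by (simp add: step_fun1_def fun_eq_iff)
  \<comment> \<open>slicing needs a nonzero factor; if one norm vanishes, the zero step functions have error zero\<close>
  have "tensor_err f g [] [] < \<epsilon>" unfolding tensor_err_def n sqnorm2_zero using True eps by auto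
  then show ?thesis using that[of "[]" "[]"] by (simp add: valid_step1_def)
next
  case False
  then have pos: "0 < sqnorm2 f" "0 < sqnorm2 g" using sqnorm2_nonneg[of f] sqnorm2_nonneg[of g] by auto
  have small: "\<exists>k. sqdist (\<lambda>p. f (fst p) * g (snd p)) (step_fun (S k)) < ennreal d" if "d > 0" for d
  proof -
    have "0 < ennreal d" using that by simp
    from order_tendstoD(2)[OF lim this] show ?thesis by (auto simp: eventually_sequentially)
  qed
  define e1 where "e1 = \<epsilon> / (2 * sqnorm2 g)"
  have e1: "e1 > 0" using eps pos by (simp add: e1_def)
  obtain k where k: "sqdist (\<lambda>p. f (fst p) * g (snd p)) (step_fun (S k)) < ennreal (e1 * sqnorm2 g)"
    using small[of "e1 * sqnorm2 g"] e1 pos by auto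
  obtain T where T: "valid_step1 T" "sqnorm2 (\<lambda>x. f x - step_fun1 T x) < e1"
    by (rule step_approx_slice[OF f g step_slice(1)[OF S] k[unfolded sqdist_iterated(1)[OF f g]] less_imp_le[OF e1]])
  define e2 where "e2 = \<epsilon> / (2 * (sqnorm2 (step_fun1 T) + 1))"
  have e2: "e2 > 0" using eps sqnorm2_nonneg[of "step_fun1 T"] by (simp add: e2_def)
  obtain k' where k': "sqdist (\<lambda>p. f (fst p) * g (snd p)) (step_fun (S k')) < ennreal (e2 * sqnorm2 f)"
    using small[of "e2 * sqnorm2 f"] e2 pos by auto
  obtain U where U: "valid_step1 U" "sqnorm2 (\<lambda>x. g x - step_fun1 U x) < e2"
    by (rule step_approx_slice[OF g f step_slice(2)[OF S] k'[unfolded sqdist_iterated(2)[OF f g]] less_imp_le[OF e2]])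
  have "sqnorm2 (\<lambda>x. f x - step_fun1 T x) * sqnorm2 g < e1 * sqnorm2 g" using T pos by simp
  also have "e1 * sqnorm2 g = \<epsilon> / 2" using pos by (simp add: e1_def)
  finally have 1: "sqnorm2 (\<lambda>x. f x - step_fun1 T x) * sqnorm2 g < \<epsilon> / 2" .
  have "sqnorm2 (step_fun1 T) * sqnorm2 (\<lambda>x. g x - step_fun1 U x) \<le> (sqnorm2 (step_fun1 T) + 1) * e2"
    using U sqnorm2_nonneg by (intro mult_mono) (auto simp: less_imp_le)
  also have "\<dots> = \<epsilon> / 2" using sqnorm2_nonneg[of "step_fun1 T"] by (simp add: e2_def field_simps)
  finally have "tensor_err f g T U < \<epsilon>" using 1 unfolding tensor_err_def by linarith
  then show ?thesis using that[OF T(1) U(1)] by blast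
qed

section \<open>Isometry of the integral of step functions\<close>

text \<open>\<open>step_integral x S\<close> as an explicit linear combination of values of \<open>x\<close>: a list of coefficients and points.\<close>

definition step_points :: "step \<Rightarrow> (real \<times> real \<times> real) list" where
  "step_points S = concat (map (\<lambda>(c, a, b, a', b'). [(c, b, b'), (- c, b, a'), (- c, a, b'), (c, a, a')]) S)"

lemma step_integral_points: "step_integral x S = (\<Sum>i<length (step_points S). fst (step_points S ! i) * x (snd (step_points S ! i)))"
proof -
  have "step_integral x S = (\<Sum>(c, p) \<leftarrow> step_points S. c * x p)"
    by (induction S) (auto simp: step_integral_def step_points_def rect_incr_def algebra_simps)
  then show ?thesis by (simp add: sum_list_sum_nth atLeast0LessThan case_prod_beta')
qed

lemma step_points_mem:
  assumes "valid_step S" "i < length (step_points S)" shows "snd (step_points S ! i) \<in> unit_square"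
proof -
  have "\<forall>e\<in>set (step_points S). snd e \<in> unit_square"
    using assms(1) by (fastforce simp: step_points_def valid_step_def)
  then show ?thesis using assms(2) nth_mem by blast
qed

lemma step_integral_second_moment:
  assumes S: "valid_step S" and I: "\<forall>p\<in>unit_square. \<forall>q\<in>unit_square. integrable M (\<lambda>\<omega>. X \<omega> p * X \<omega> q :: real)"
  defines "P \<equiv> step_points S"
  shows "integrable M (\<lambda>\<omega>. (step_integral (X \<omega>) S)\<^sup>2)"
    "(LINT \<omega>|M. (step_integral (X \<omega>) S)\<^sup>2) =
      (\<Sum>i<length P. \<Sum>j<length P. fst (P ! i) * fst (P ! j) * (LINT \<omega>|M. X \<omega> (snd (P ! i)) * X \<omega> (snd (P ! j))))"
proof -
  have sq: "(step_integral (X \<omega>) S)\<^sup>2 =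
    (\<Sum>i<length P. \<Sum>j<length P. fst (P ! i) * fst (P ! j) * (X \<omega> (snd (P ! i)) * X \<omega> (snd (P ! j))))" for \<omega>
    unfolding step_integral_points P_def power2_eq_square sum_product by (simp add: ac_simps)
  have J: "integrable M (\<lambda>\<omega>. fst (P ! i) * fst (P ! j) * (X \<omega> (snd (P ! i)) * X \<omega> (snd (P ! j))))"
    if "i \<in> {..<length P}" "j \<in> {..<length P}" for i j
    using that unfolding P_def by (intro integrable_mult_right I[rule_format] step_points_mem S) auto
  show "integrable M (\<lambda>\<omega>. (step_integral (X \<omega>) S)\<^sup>2)"
    unfolding sq by (intro Bochner_Integration.integrable_sum J)
  have "(LINT \<omega>|M. (step_integral (X \<omega>) S)\<^sup>2) = (\<Sum>i<length P. LINT \<omega>|M. (\<Sum>j<length P. fst (P ! i) * fst (P ! j) * (X \<omega> (snd (P ! i)) * X \<omega> (snd (P ! j)))))"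
    unfolding sq by (rule Bochner_Integration.integral_sum) (intro Bochner_Integration.integrable_sum J)
  also have "\<dots> = (\<Sum>i<length P. \<Sum>j<length P. LINT \<omega>|M. fst (P ! i) * fst (P ! j) * (X \<omega> (snd (P ! i)) * X \<omega> (snd (P ! j))))"
    by (intro sum.cong refl Bochner_Integration.integral_sum J)
  finally show "(LINT \<omega>|M. (step_integral (X \<omega>) S)\<^sup>2) =
      (\<Sum>i<length P. \<Sum>j<length P. fst (P ! i) * fst (P ! j) * (LINT \<omega>|M. X \<omega> (snd (P ! i)) * X \<omega> (snd (P ! j))))"
    by simp
qed

text \<open>Under Lebesgue measure, the indicator of \<open>(0,s] \<times> (0,t]\<close> is a field with the covariance of the Brownian
sheet, and \<open>step_fun S\<close> is its \<open>step_integral\<close>.\<close>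

definition corner_indicator :: "real \<times> real \<Rightarrow> real \<times> real \<Rightarrow> real" where
  "corner_indicator p q = indicator {0<..fst q} (fst p) * indicator {0<..snd q} (snd p)"

lemma step_fun_corner:
  assumes "valid_step S" shows "step_fun S p = step_integral (corner_indicator p) S"
proof -
  have "indicator ({a<..b} \<times> {a'<..b'}) p = rect_incr (corner_indicator p) a a' b b'"
    if "0 \<le> a" "a \<le> b" "0 \<le> a'" "a' \<le> b'" for a b a' b'
    using that by (auto simp: rect_incr_def corner_indicator_def indicator_def mem_Times_iff)
  then show ?thesis
    using assms unfolding step_fun_def step_integral_def valid_step_def
    by (intro arg_cong[of _ _ sum_list] map_cong refl) fastforce
qed

lemma corner_covariance:
  assumes "q \<in> unit_square" "q' \<in> unit_square"
  shows "integrable lborel (\<lambda>p. corner_indicator p q * corner_indicator p q')"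
    "(LINT p|lborel. corner_indicator p q * corner_indicator p q') = min (fst q) (fst q') * min (snd q) (snd q')"
proof -
  have eq: "(\<lambda>p. corner_indicator p q * corner_indicator p q') =
    (\<lambda>p. indicator {0<..min (fst q) (fst q')} (fst p) * indicator {0<..min (snd q) (snd q')} (snd p))"
    by (auto simp: corner_indicator_def indicator_def fun_eq_iff)
  have I: "integrable lborel (indicator {0<..u} :: real \<Rightarrow> real)" for u :: real
    by (rule integrable_real_indicator) (cases "0 \<le> u"; simp)+
  show "integrable lborel (\<lambda>p. corner_indicator p q * corner_indicator p q')"
    unfolding eq by (rule tensor_integrable(1)[OF I I])
  have "(LINT x|lborel. indicator {0<..u} x) = u" if "0 \<le> u" for u :: real using that by simp
  then show "(LINT p|lborel. corner_indicator p q * corner_indicator p q') = min (fst q) (fst q') * min (snd q) (snd q')"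
    unfolding eq tensor_integrable(2)[OF I I] using assms by (auto simp: mem_Times_iff)
qed

lemma centered_gaussian_square_integrable:
  assumes "centered_gaussian M X"
  shows "integrable M (\<lambda>\<omega>. (X \<omega>)\<^sup>2)"
proof -
  have m: "X \<in> borel_measurable M" using assms by (simp add: centered_gaussian_def)
  consider "AE \<omega> in M. X \<omega> = 0" | \<sigma> where "\<sigma> > 0" "distributed M lborel X (normal_density 0 \<sigma>)"
    using assms by (auto simp: centered_gaussian_def)
  then show ?thesis
  proof cases
    case 1
    show ?thesis
      by (rule integrable_cong_AE_imp[of M "\<lambda>_. 0"]) (use 1 m in auto)
  next
    case 2
    have "integrable lborel (\<lambda>x. normal_density 0 \<sigma> x * x\<^sup>2)"
      using normal_moment_even[OF 2(1), of 0 1] by (auto simp: has_bochner_integral_iff)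
    then show ?thesis
      by (subst (asm) distributed_integrable[OF 2(2)]) auto
  qed
qed

lemma brownian_gaussian:
  assumes "brownian_sheet N B" "r \<in> unit_square"
  shows "centered_gaussian N (\<lambda>\<omega>. B \<omega> r)" "(\<lambda>\<omega>. B \<omega> r) \<in> borel_measurable N"
proof -
  have "\<forall>A c. finite A \<and> A \<subseteq> unit_square \<longrightarrow> centered_gaussian N (\<lambda>\<omega>. \<Sum>p\<in>A. c p * B \<omega> p)"
    using assms(1) unfolding brownian_sheet_def centered_gaussian_process_def by (elim conjE)
  from this[THEN spec, THEN spec, of "{r}" "\<lambda>_. 1"] assms(2)
  show "centered_gaussian N (\<lambda>\<omega>. B \<omega> r)" by simp
  then show "(\<lambda>\<omega>. B \<omega> r) \<in> borel_measurable N" by (simp add: centered_gaussian_def)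
qed

lemma brownian_product_integrable:
  assumes "brownian_sheet N B" "p \<in> unit_square" "q \<in> unit_square"
  shows "integrable N (\<lambda>\<omega>. B \<omega> p * B \<omega> q)"
proof -
  note m = brownian_gaussian(2)[OF assms(1)]
  have I: "integrable N (\<lambda>\<omega>. (B \<omega> p)\<^sup>2 + (B \<omega> q)\<^sup>2)"
    by (intro Bochner_Integration.integrable_add centered_gaussian_square_integrable brownian_gaussian(1) assms)
  have ineq: "\<bar>x * y\<bar> \<le> \<bar>x\<^sup>2 + y\<^sup>2\<bar>" for x y :: real
  proof -
    have "0 \<le> (\<bar>x\<bar> - \<bar>y\<bar>)\<^sup>2 + x\<^sup>2 + y\<^sup>2" by simp
    then show ?thesis by (simp add: power2_diff abs_mult)
  qed
  show ?thesis
    by (rule Bochner_Integration.integrable_bound[OF I]) (use m assms ineq in auto)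
qed

text \<open>The second moment of \<open>step_integral\<close> depends only on the covariance, and \<open>B\<close> has the same covariance as
\<open>corner_indicator\<close>.\<close>

theorem step_integral_isometry:
  assumes B: "brownian_sheet N B" and S: "valid_step S"
  shows "(\<integral>\<^sup>+\<omega>. ennreal ((step_integral (B \<omega>) S)\<^sup>2) \<partial>N) = (\<integral>\<^sup>+p. ennreal ((step_fun S p)\<^sup>2) \<partial>lborel)"
proof -
  have "\<forall>p\<in>unit_square. \<forall>q\<in>unit_square. integrable N (\<lambda>\<omega>. B \<omega> p * B \<omega> q)"
    using brownian_product_integrable[OF B] by blast
  note 1 = step_integral_second_moment[where M=N and X=B, OF S this]
  have "\<forall>p\<in>unit_square. \<forall>q\<in>unit_square. integrable lborel (\<lambda>r. corner_indicator r p * corner_indicator r q)"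
    using corner_covariance(1) by blast
  note 2 = step_integral_second_moment[where M=lborel and X=corner_indicator, OF S this]
  have cov: "(LINT \<omega>|N. B \<omega> p * B \<omega> q) = (LINT r|lborel. corner_indicator r p * corner_indicator r q)"
    if "p \<in> unit_square" "q \<in> unit_square" for p q
    using B that corner_covariance(2)[OF that] unfolding brownian_sheet_def by (cases p; cases q) auto
  have "(LINT \<omega>|N. (step_integral (B \<omega>) S)\<^sup>2) = (LINT p|lborel. (step_integral (corner_indicator p) S)\<^sup>2)"
    unfolding 1(2) 2(2) by (intro sum.cong refl arg_cong2[of _ _ _ _ "(*)"] cov step_points_mem S) auto
  then show ?thesis
    unfolding step_fun_corner[OF S] by (simp add: nn_integral_eq_integral[OF 1(1)] nn_integral_eq_integral[OF 2(1)])
qed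

definition neg_step :: "step \<Rightarrow> step" where
  "neg_step S = map (\<lambda>(c, r). (- c, r)) S"

lemma neg_step:
  "valid_step S \<Longrightarrow> valid_step (neg_step S)" "step_fun (neg_step S) p = - step_fun S p" "step_integral x (neg_step S) = - step_integral x S"
proof -
  show "valid_step S \<Longrightarrow> valid_step (neg_step S)" by (auto simp: neg_step_def valid_step_def)
  show "step_fun (neg_step S) p = - step_fun S p"
    by (induction S) (auto simp: neg_step_def step_fun_def)
  show "step_integral x (neg_step S) = - step_integral x S"
    by (induction S) (auto simp: neg_step_def step_integral_def)
qed

lemma step_integral_diff_isometry:
  assumes B: "brownian_sheet N B" and S: "valid_step S" "valid_step S'"
  shows "(\<integral>\<^sup>+\<omega>. ennreal ((step_integral (B \<omega>) S - step_integral (B \<omega>) S')\<^sup>2) \<partial>N) = sqdist (step_fun S) (step_fun S')"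
proof -
  have v: "valid_step (S @ neg_step S')" using S neg_step(1)[OF S(2)] by (auto simp: valid_step_def)
  have out: "step_fun R p = 0" if "valid_step R" "p \<notin> unit_square" for R p
    using that by (induction R) (auto simp: step_fun_def valid_step_def indicator_def mem_Times_iff)
  have "(\<integral>\<^sup>+p. ennreal ((step_fun S p - step_fun S' p)\<^sup>2) \<partial>lborel) = sqdist (step_fun S) (step_fun S')"
    unfolding sqdist_def by (intro nn_integral_cong) (auto simp: indicator_def out S)
  then show ?thesis
    using step_integral_isometry[OF B v] by (simp add: step_fun_append step_integral_append neg_step)
qed

section \<open>Step approximation of the Wiener integral\<close>

lemma sqdist_triangle:
  assumes "set_borel_measurable lborel unit_square F" "set_borel_measurable lborel unit_square S" "set_borel_measurable lborel unit_square S'"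
  shows "sqdist S S' \<le> 2 * sqdist F S + 2 * sqdist F S'"
proof -
  have m: "(\<lambda>p. ennreal ((F p - R p)\<^sup>2) * indicator unit_square p) \<in> borel_measurable lborel"
    if "set_borel_measurable lborel unit_square R" for R
  proof -
    have "(\<lambda>p. ennreal ((indicator unit_square p *\<^sub>R F p - indicator unit_square p *\<^sub>R R p)\<^sup>2)) \<in> borel_measurable lborel"
      using that assms(1) unfolding set_borel_measurable_def
      by (intro measurable_compose[OF _ measurable_ennreal] borel_measurable_power borel_measurable_diff) auto
    also have "(\<lambda>p. ennreal ((indicator unit_square p *\<^sub>R F p - indicator unit_square p *\<^sub>R R p)\<^sup>2)) =
      (\<lambda>p. ennreal ((F p - R p)\<^sup>2) * indicator unit_square p)" by (auto simp: indicator_def)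
    finally show ?thesis .
  qed
  have pt: "ennreal ((S p - S' p)\<^sup>2) \<le> 2 * ennreal ((F p - S p)\<^sup>2) + 2 * ennreal ((F p - S' p)\<^sup>2)" for p
  proof -
    have "(S p - S' p)\<^sup>2 \<le> 2 * (F p - S p)\<^sup>2 + 2 * (F p - S' p)\<^sup>2"
      using square_add_le[of "S p - F p" "F p - S' p"] by (simp add: power2_commute)
    then have "ennreal ((S p - S' p)\<^sup>2) \<le> ennreal (2 * (F p - S p)\<^sup>2 + 2 * (F p - S' p)\<^sup>2)" by (rule ennreal_leI)
    also have "\<dots> = 2 * ennreal ((F p - S p)\<^sup>2) + 2 * ennreal ((F p - S' p)\<^sup>2)"
      by (subst ennreal_plus) (auto simp: ennreal_mult)
    finally show ?thesis .
  qed
  have "sqdist S S' \<le> (\<integral>\<^sup>+p. 2 * (ennreal ((F p - S p)\<^sup>2) * indicator unit_square p) + 2 * (ennreal ((F p - S' p)\<^sup>2) * indicator unit_square p) \<partial>lborel)"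
    unfolding sqdist_def by (intro nn_integral_mono) (use pt in \<open>auto simp: indicator_def\<close>)
  also have "\<dots> = 2 * sqdist F S + 2 * sqdist F S'"
    unfolding sqdist_def using m[OF assms(2)] m[OF assms(3)] by (simp add: nn_integral_add nn_integral_cmult)
  finally show ?thesis .
qed

lemma nn_integral_tensor_square:
  assumes "in_L2 f" "in_L2 g"
  shows "sqdist (\<lambda>p. f (fst p) * g (snd p)) (\<lambda>_. 0) = ennreal (sqnorm2 f * sqnorm2 g)"
proof -
  have i: "integrable01 (\<lambda>x. (f x)\<^sup>2)" "integrable01 (\<lambda>x. (g x)\<^sup>2)" using assms by (auto simp: integrable01_def in_L2_def)
  note T = tensor_set_integrable[OF i]
  have "sqdist (\<lambda>p. f (fst p) * g (snd p)) (\<lambda>_. 0) = (\<integral>\<^sup>+p. ennreal (indicator unit_square p *\<^sub>R ((f (fst p))\<^sup>2 * (g (snd p))\<^sup>2)) \<partial>lborel)"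
    unfolding sqdist_def by (intro nn_integral_cong) (auto simp: indicator_def power_mult_distrib)
  also have "\<dots> = ennreal (LINT p:unit_square|lborel. (f (fst p))\<^sup>2 * (g (snd p))\<^sup>2)"
    unfolding set_lebesgue_integral_def
    by (rule nn_integral_eq_integral[OF T(1)[unfolded set_integrable_def]]) auto
  finally show ?thesis unfolding T(2) sqnorm2_def .
qed

lemma tensor_set_measurable:
  assumes "in_L2 f" "in_L2 g"
  shows "set_borel_measurable lborel unit_square (\<lambda>p. f (fst p) * g (snd p))"
  using tensor_set_integrable(1)[OF in_L2_integrable01[OF assms(1)] in_L2_integrable01[OF assms(2)]]
  unfolding set_integrable_def set_borel_measurable_def by auto

lemma step_set_measurable: "set_borel_measurable lborel unit_square (step_fun S)"
proof -
  have "unit_square \<in> sets (borel :: (real \<times> real) measure)" by (intro borel_closed closed_Times) auto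
  then show ?thesis unfolding set_borel_measurable_def by auto
qed

lemma sqdist_tensor_step:
  assumes f: "in_L2 f" and g: "in_L2 g"
  shows "sqdist (\<lambda>p. f (fst p) * g (snd p)) (step_fun (tensor_step T U)) \<le> ennreal (2 * tensor_err f g T U)"
proof -
  let ?F = "\<lambda>p. (f (fst p) - step_fun1 T (fst p)) * g (snd p)" and ?G = "\<lambda>p. step_fun1 T (fst p) * (g (snd p) - step_fun1 U (snd p))"
  have d: "in_L2 (\<lambda>x. f x - step_fun1 T x)" "in_L2 (\<lambda>x. g x - step_fun1 U x)"
    by (intro in_L2_diff f g step_fun1_L2)+
  have m: "set_borel_measurable lborel unit_square ?F" "set_borel_measurable lborel unit_square ?G"
    by (rule tensor_set_measurable[OF d(1) g], rule tensor_set_measurable[OF step_fun1_L2 d(2)])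
  have m': "set_borel_measurable lborel unit_square (\<lambda>p. - ?G p)"
    using m(2) unfolding set_borel_measurable_def by simp
  have z: "set_borel_measurable lborel unit_square (\<lambda>p :: real \<times> real. 0 :: real)"
    unfolding set_borel_measurable_def by simp
  have "sqdist (\<lambda>p. f (fst p) * g (snd p)) (step_fun (tensor_step T U)) = sqdist ?F (\<lambda>p. - ?G p)"
    unfolding sqdist_def step_fun_tensor by (intro nn_integral_cong) (simp add: algebra_simps)
  also have "\<dots> \<le> 2 * sqdist (\<lambda>_. 0) ?F + 2 * sqdist (\<lambda>_. 0) (\<lambda>p. - ?G p)"
    by (rule sqdist_triangle[OF z m(1) m'])
  also have "sqdist (\<lambda>_. 0) ?F = sqdist ?F (\<lambda>_. 0)" by (simp add: sqdist_def)
  also have "sqdist (\<lambda>_. 0) (\<lambda>p. - ?G p) = sqdist ?G (\<lambda>_. 0)" by (simp add: sqdist_def)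
  also have "2 * sqdist ?F (\<lambda>_. 0) + 2 * sqdist ?G (\<lambda>_. 0) =
    2 * ennreal (sqnorm2 (\<lambda>x. f x - step_fun1 T x) * sqnorm2 g) + 2 * ennreal (sqnorm2 (step_fun1 T) * sqnorm2 (\<lambda>x. g x - step_fun1 U x))"
    by (simp only: nn_integral_tensor_square[OF d(1) g] nn_integral_tensor_square[OF step_fun1_L2 d(2)])
  also have "\<dots> = ennreal (2 * tensor_err f g T U)"
    using sqnorm2_nonneg by (simp add: tensor_err_def distrib_left ennreal_plus ennreal_mult)
  finally show ?thesis .
qed

text \<open>The step functions \<open>S k\<close> that define \<open>Z\<close> link it to \<open>tensor_step T U\<close>: \<open>Z\<close> is close to the integral of \<open>S k\<close>, and by
isometry the integrals of \<open>S k\<close> and of \<open>tensor_step T U\<close> differ by the distance of the two step functions.\<close>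

theorem wiener_integral_step_approx:
  assumes B: "brownian_sheet N B" and Z: "is_wiener_integral N B (\<lambda>(u, v). f u * g v) Z" and f: "in_L2 f" and g: "in_L2 g"
    and TU: "valid_step1 T" "valid_step1 U"
  shows "(\<integral>\<^sup>+\<omega>. ennreal ((Z \<omega> - step_integral (B \<omega>) (tensor_step T U))\<^sup>2) \<partial>N) \<le> ennreal (8 * tensor_err f g T U)"
proof -
  let ?F = "\<lambda>p. f (fst p) * g (snd p)" and ?TU = "tensor_step T U"
  have Z': "is_wiener_integral N B ?F Z" using Z by (simp add: case_prod_beta')
  then have Zm: "Z \<in> borel_measurable N" by (simp add: is_wiener_integral_def)
  obtain S where S: "\<And>k. valid_step (S k)" and l1: "(\<lambda>k. sqdist ?F (step_fun (S k))) \<longlonglongrightarrow> 0"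
    and l2: "(\<lambda>k. \<integral>\<^sup>+\<omega>. ennreal ((Z \<omega> - step_integral (B \<omega>) (S k))\<^sup>2) \<partial>N) \<longlonglongrightarrow> 0"
    using Z' unfolding is_wiener_integral_def sqdist_def by auto
  have vTU: "valid_step ?TU" by (rule valid_tensor_step[OF TU])
  have Bm: "(\<lambda>\<omega>. step_integral (B \<omega>) R) \<in> borel_measurable N" if "valid_step R" for R
    unfolding step_integral_points
    by (intro borel_measurable_sum borel_measurable_times borel_measurable_const brownian_gaussian(2)[OF B] step_points_mem[OF that])
       simp
  let ?a = "\<lambda>k. \<integral>\<^sup>+\<omega>. ennreal ((Z \<omega> - step_integral (B \<omega>) (S k))\<^sup>2) \<partial>N"
  let ?E = "sqdist ?F (step_fun ?TU)"
  have bound: "(\<integral>\<^sup>+\<omega>. ennreal ((Z \<omega> - step_integral (B \<omega>) ?TU)\<^sup>2) \<partial>N) \<le> 2 * ?a k + 2 * (2 * sqdist ?F (step_fun (S k)) + 2 * ?E)" for k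
  proof -
    have pt: "ennreal ((Z \<omega> - step_integral (B \<omega>) ?TU)\<^sup>2) \<le> 2 * ennreal ((Z \<omega> - step_integral (B \<omega>) (S k))\<^sup>2) +
        2 * ennreal ((step_integral (B \<omega>) (S k) - step_integral (B \<omega>) ?TU)\<^sup>2)" for \<omega>
    proof -
      have "ennreal ((Z \<omega> - step_integral (B \<omega>) ?TU)\<^sup>2) \<le> ennreal (2 * (Z \<omega> - step_integral (B \<omega>) (S k))\<^sup>2 +
        2 * (step_integral (B \<omega>) (S k) - step_integral (B \<omega>) ?TU)\<^sup>2)"
        using square_add_le[of "Z \<omega> - step_integral (B \<omega>) (S k)" "step_integral (B \<omega>) (S k) - step_integral (B \<omega>) ?TU"]
        by (intro ennreal_leI) simp
      then show ?thesis by (subst (asm) ennreal_plus) (auto simp: ennreal_mult)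
    qed
    have "(\<integral>\<^sup>+\<omega>. ennreal ((Z \<omega> - step_integral (B \<omega>) ?TU)\<^sup>2) \<partial>N) \<le>
      (\<integral>\<^sup>+\<omega>. 2 * ennreal ((Z \<omega> - step_integral (B \<omega>) (S k))\<^sup>2) +
        2 * ennreal ((step_integral (B \<omega>) (S k) - step_integral (B \<omega>) ?TU)\<^sup>2) \<partial>N)"
      by (rule nn_integral_mono) (rule pt)
    also have "\<dots> = 2 * ?a k + 2 * (\<integral>\<^sup>+\<omega>. ennreal ((step_integral (B \<omega>) (S k) - step_integral (B \<omega>) ?TU)\<^sup>2) \<partial>N)"
      using Zm Bm[OF S] Bm[OF vTU] by (simp add: nn_integral_add nn_integral_cmult)
    also have "(\<integral>\<^sup>+\<omega>. ennreal ((step_integral (B \<omega>) (S k) - step_integral (B \<omega>) ?TU)\<^sup>2) \<partial>N) = sqdist (step_fun (S k)) (step_fun ?TU)"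
      by (rule step_integral_diff_isometry[OF B S vTU])
    also have "2 * ?a k + 2 * sqdist (step_fun (S k)) (step_fun ?TU) \<le> 2 * ?a k + 2 * (2 * sqdist ?F (step_fun (S k)) + 2 * ?E)"
      by (intro add_left_mono mult_left_mono sqdist_triangle tensor_set_measurable f g step_set_measurable) simp
    finally show ?thesis .
  qed
  have "(\<lambda>k. 2 * ?a k + 2 * (2 * sqdist ?F (step_fun (S k)) + 2 * ?E)) \<longlonglongrightarrow> 2 * 0 + 2 * (2 * 0 + 2 * ?E)"
    by (intro tendsto_add tendsto_const ennreal_tendsto_cmult l1 l2) auto
  then have "(\<integral>\<^sup>+\<omega>. ennreal ((Z \<omega> - step_integral (B \<omega>) ?TU)\<^sup>2) \<partial>N) \<le> 2 * 0 + 2 * (2 * 0 + 2 * ?E)"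
    by (rule LIMSEQ_le_const) (use bound in blast)
  also have "\<dots> = 4 * ?E" by (simp add: mult.assoc[symmetric])
  also have "\<dots> \<le> 4 * ennreal (2 * tensor_err f g T U)" by (intro mult_left_mono sqdist_tensor_step f g) simp
  also have "\<dots> = ennreal (4 * (2 * tensor_err f g T U))"
    by (subst ennreal_mult) (auto simp: tensor_err_def sqnorm2_nonneg)
  finally show ?thesis by simp
qed

section \<open>Step approximation of the processes\<close>

lemma X_proc_step_approx:
  assumes \<theta>: "random_kernels M \<theta>" and H3: "H3 M \<theta>"
  obtains C where "0 \<le> C" "\<And>n s t T U. in_L2 (K1 s) \<Longrightarrow> in_L2 (K2 t) \<Longrightarrow> valid_step1 T \<Longrightarrow> valid_step1 U \<Longrightarrow>
    (\<integral>\<^sup>+\<omega>. ennreal ((X_proc K1 K2 \<theta> n \<omega> (s, t) - step_integral (zeta_proc \<theta> n \<omega>) (tensor_step T U))\<^sup>2) \<partial>M)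
      \<le> ennreal (C * tensor_err (K1 s) (K2 t) T U)"
proof -
  obtain C where C: "0 \<le> C" "\<And>f g n. in_L2 f \<Longrightarrow> in_L2 g \<Longrightarrow>
    (\<integral>\<^sup>+\<omega>. ennreal ((kernel_form (\<theta> n \<omega>) f g)\<^sup>2) \<partial>M) \<le> ennreal (C * (sqnorm2 f * sqnorm2 g))"
    using H3_kernel_form[OF H3] by blast
  show thesis
  proof (rule that[of "2 * C"])
    fix n and s t :: real and T U
    assume L: "in_L2 (K1 s)" "in_L2 (K2 t)" and TU: "valid_step1 T" "valid_step1 U"
    let ?f = "K1 s" and ?g = "K2 t"
    let ?df = "\<lambda>x. ?f x - step_fun1 T x" and ?dg = "\<lambda>x. ?g x - step_fun1 U x"
    have d: "in_L2 ?df" "in_L2 ?dg" by (intro in_L2_diff L step_fun1_L2)+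
    note i = in_L2_integrable01[OF L(1)] in_L2_integrable01[OF L(2)] in_L2_integrable01[OF step_fun1_L2]
    have pt: "ennreal ((X_proc K1 K2 \<theta> n \<omega> (s, t) - step_integral (zeta_proc \<theta> n \<omega>) (tensor_step T U))\<^sup>2) \<le>
      2 * ennreal ((kernel_form (\<theta> n \<omega>) ?df ?g)\<^sup>2) + 2 * ennreal ((kernel_form (\<theta> n \<omega>) (step_fun1 T) ?dg)\<^sup>2)" if w: "\<omega> \<in> space M" for \<omega>
    proof -
      obtain c where h: "bounded_kernel (\<theta> n \<omega>) c" using random_kernel_bounded[OF \<theta> w] by blast
      have "X_proc K1 K2 \<theta> n \<omega> (s, t) - step_integral (zeta_proc \<theta> n \<omega>) (tensor_step T U) =
        kernel_form (\<theta> n \<omega>) ?df ?g + kernel_form (\<theta> n \<omega>) (step_fun1 T) ?dg"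
        by (simp add: X_proc_kernel_form[where \<theta>=\<theta> and n=n and \<omega>=\<omega> and ?K1.0=K1 and ?K2.0=K2, OF h i(1,2)]
            step_integral_zeta[where \<theta>=\<theta> and n=n and \<omega>=\<omega>, OF h TU] kernel_form_diff[OF h] i)
      then have "ennreal ((X_proc K1 K2 \<theta> n \<omega> (s, t) - step_integral (zeta_proc \<theta> n \<omega>) (tensor_step T U))\<^sup>2) \<le>
        ennreal (2 * (kernel_form (\<theta> n \<omega>) ?df ?g)\<^sup>2 + 2 * (kernel_form (\<theta> n \<omega>) (step_fun1 T) ?dg)\<^sup>2)"
        using square_add_le by (intro ennreal_leI) simp
      then show ?thesis by (subst (asm) ennreal_plus) (auto simp: ennreal_mult)
    qed
    have m: "(\<lambda>\<omega>. kernel_form (\<theta> n \<omega>) f g) \<in> borel_measurable M" if "in_L2 f" "in_L2 g" for f g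
      by (rule kernel_form_measurable[OF \<theta> in_L2_integrable01[OF that(1)] in_L2_integrable01[OF that(2)]])
    have "(\<integral>\<^sup>+\<omega>. ennreal ((X_proc K1 K2 \<theta> n \<omega> (s, t) - step_integral (zeta_proc \<theta> n \<omega>) (tensor_step T U))\<^sup>2) \<partial>M) \<le>
      (\<integral>\<^sup>+\<omega>. 2 * ennreal ((kernel_form (\<theta> n \<omega>) ?df ?g)\<^sup>2) + 2 * ennreal ((kernel_form (\<theta> n \<omega>) (step_fun1 T) ?dg)\<^sup>2) \<partial>M)"
      by (rule nn_integral_mono) (rule pt)
    also have "\<dots> = 2 * (\<integral>\<^sup>+\<omega>. ennreal ((kernel_form (\<theta> n \<omega>) ?df ?g)\<^sup>2) \<partial>M) + 2 * (\<integral>\<^sup>+\<omega>. ennreal ((kernel_form (\<theta> n \<omega>) (step_fun1 T) ?dg)\<^sup>2) \<partial>M)"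
      using m[OF d(1) L(2)] m[OF step_fun1_L2 d(2)] by (simp add: nn_integral_add nn_integral_cmult)
    also have "\<dots> \<le> 2 * ennreal (C * (sqnorm2 ?df * sqnorm2 ?g)) + 2 * ennreal (C * (sqnorm2 (step_fun1 T) * sqnorm2 ?dg))"
      by (intro add_mono mult_left_mono C(2) d L step_fun1_L2) auto
    also have "\<dots> = ennreal (2 * C * tensor_err ?f ?g T U)"
    proof -
      have twice: "2 * ennreal x = ennreal (2 * x)" if "0 \<le> x" for x
        using that by (simp add: ennreal_mult)
      have nn: "0 \<le> C * (sqnorm2 ?df * sqnorm2 ?g)" "0 \<le> C * (sqnorm2 (step_fun1 T) * sqnorm2 ?dg)" using C(1) sqnorm2_nonneg by auto
      have "2 * ennreal (C * (sqnorm2 ?df * sqnorm2 ?g)) + 2 * ennreal (C * (sqnorm2 (step_fun1 T) * sqnorm2 ?dg)) =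
        ennreal (2 * (C * (sqnorm2 ?df * sqnorm2 ?g))) + ennreal (2 * (C * (sqnorm2 (step_fun1 T) * sqnorm2 ?dg)))"
        using nn by (simp only: twice)
      also have "\<dots> = ennreal (2 * (C * (sqnorm2 ?df * sqnorm2 ?g)) + 2 * (C * (sqnorm2 (step_fun1 T) * sqnorm2 ?dg)))"
        by (rule ennreal_plus[symmetric]) (use nn in auto)
      also have "2 * (C * (sqnorm2 ?df * sqnorm2 ?g)) + 2 * (C * (sqnorm2 (step_fun1 T) * sqnorm2 ?dg)) = 2 * C * tensor_err ?f ?g T U"
        by (simp add: tensor_err_def algebra_simps)
      finally show ?thesis .
    qed
    finally show "(\<integral>\<^sup>+\<omega>. ennreal ((X_proc K1 K2 \<theta> n \<omega> (s, t) - step_integral (zeta_proc \<theta> n \<omega>) (tensor_step T U))\<^sup>2) \<partial>M)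
      \<le> ennreal (2 * C * tensor_err (K1 s) (K2 t) T U)" .
  qed (use C in simp)
qed

text \<open>From mean square to mean by \<open>\<bar>y\<bar> \<le> \<epsilon> + y\<^sup>2 / \<epsilon>\<close>.\<close>

lemma nn_integral_abs_le:
  assumes "prob_space M" "Y \<in> borel_measurable M" "(\<integral>\<^sup>+\<omega>. ennreal ((Y \<omega>)\<^sup>2) \<partial>M) \<le> ennreal (\<epsilon>\<^sup>2)" "0 < \<epsilon>"
  shows "(\<integral>\<^sup>+\<omega>. ennreal \<bar>Y \<omega>\<bar> \<partial>M) \<le> ennreal (2 * \<epsilon>)"
proof -
  interpret prob_space M by fact
  have "(\<integral>\<^sup>+\<omega>. ennreal \<bar>Y \<omega>\<bar> \<partial>M) \<le> (\<integral>\<^sup>+\<omega>. ennreal \<epsilon> + ennreal (1 / \<epsilon>) * ennreal ((Y \<omega>)\<^sup>2) \<partial>M)"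
  proof (rule nn_integral_mono)
    fix \<omega>
    have "\<bar>Y \<omega>\<bar> \<le> \<epsilon> + (1 / \<epsilon>) * (Y \<omega>)\<^sup>2" using abs_le_young[OF assms(4), of 2 "Y \<omega>"] by simp
    then have "ennreal \<bar>Y \<omega>\<bar> \<le> ennreal (\<epsilon> + (1 / \<epsilon>) * (Y \<omega>)\<^sup>2)" by (rule ennreal_leI)
    also have "\<dots> = ennreal \<epsilon> + ennreal ((1 / \<epsilon>) * (Y \<omega>)\<^sup>2)" by (rule ennreal_plus) (use assms in auto)
    also have "ennreal ((1 / \<epsilon>) * (Y \<omega>)\<^sup>2) = ennreal (1 / \<epsilon>) * ennreal ((Y \<omega>)\<^sup>2)" by (rule ennreal_mult) (use assms in auto)
    finally show "ennreal \<bar>Y \<omega>\<bar> \<le> ennreal \<epsilon> + ennreal (1 / \<epsilon>) * ennreal ((Y \<omega>)\<^sup>2)" .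
  qed
  also have "\<dots> = ennreal \<epsilon> + ennreal (1 / \<epsilon>) * (\<integral>\<^sup>+\<omega>. ennreal ((Y \<omega>)\<^sup>2) \<partial>M)"
    using assms(2) by (simp add: nn_integral_add nn_integral_cmult emeasure_space_1)
  also have "\<dots> \<le> ennreal \<epsilon> + ennreal (1 / \<epsilon>) * ennreal (\<epsilon>\<^sup>2)"
    by (intro add_left_mono mult_left_mono assms) auto
  also have "ennreal (1 / \<epsilon>) * ennreal (\<epsilon>\<^sup>2) = ennreal (1 / \<epsilon> * \<epsilon>\<^sup>2)"
    using assms(4) by (intro ennreal_mult[symmetric]) auto
  also have "1 / \<epsilon> * \<epsilon>\<^sup>2 = \<epsilon>" using assms(4) by (simp add: power2_eq_square)
  also have "ennreal \<epsilon> + ennreal \<epsilon> = ennreal (2 * \<epsilon>)"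
    using assms(4) by (subst ennreal_plus[symmetric]) auto
  finally show ?thesis .
qed

section \<open>Transfer of convergence in law along step maps\<close>

lemma step_integral_continuous:
  assumes "valid_step S"
  shows "\<exists>c\<ge>0. \<forall>x\<in>mspace C_square. \<forall>y\<in>mspace C_square. \<bar>step_integral x S - step_integral y S\<bar> \<le> c * mdist C_square x y"
proof (intro exI[of _ "\<Sum>i<length (step_points S). \<bar>fst (step_points S ! i)\<bar>"] conjI ballI)
  fix x y assume xy: "x \<in> mspace C_square" "y \<in> mspace C_square"
  let ?P = "step_points S"
  have "\<bar>step_integral x S - step_integral y S\<bar> = \<bar>\<Sum>i<length ?P. fst (?P ! i) * (x (snd (?P ! i)) - y (snd (?P ! i)))\<bar>"
    by (simp add: step_integral_points sum_subtractf right_diff_distrib)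
  also have "\<dots> \<le> (\<Sum>i<length ?P. \<bar>fst (?P ! i)\<bar> * mdist C_square x y)"
    by (rule sum_abs[THEN order_trans], rule sum_mono)
       (auto simp: abs_mult intro!: mult_left_mono C_square_dist_ge[OF xy] step_points_mem[OF assms] simp del: mem_Sigma_iff)
  finally show "\<bar>step_integral x S - step_integral y S\<bar> \<le> (\<Sum>i<length ?P. \<bar>fst (?P ! i)\<bar>) * mdist C_square x y"
    by (simp add: sum_distrib_right)
qed (simp add: sum_nonneg)

lemma step_integral_restrict:
  "valid_step S \<Longrightarrow> step_integral (trajectory Z \<omega>) S = step_integral (Z \<omega>) S"
  unfolding step_integral_points trajectory_def
  by (intro sum.cong refl) (use step_points_mem in \<open>auto simp: restrict_def simp del: mem_Sigma_iff\<close>)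

lemma step_integral_measurable:
  assumes "trajectory Z \<in> M \<rightarrow>\<^sub>M borel_C" "valid_step S"
  shows "(\<lambda>\<omega>. step_integral (Z \<omega>) S) \<in> borel_measurable M"
proof -
  have "continuous_map (mtopology_of C_square) euclideanreal (\<lambda>x. step_integral x S)"
    using step_integral_continuous[OF assms(2)] continuous_map_lipschitz[of "\<lambda>x. step_integral x S"] by blast
  from measurable_compose[OF assms(1) continuous_map_borel_C[OF this]]
  show ?thesis by (simp add: step_integral_restrict[OF assms(2)])
qed

lemma trunc_lipschitz_expectation_diff:
  assumes M: "prob_space M" and H: "trunc_lipschitz L H"
    and m: "(\<lambda>\<omega>. H (U \<omega>)) \<in> borel_measurable M" "(\<lambda>\<omega>. H (V \<omega>)) \<in> borel_measurable M" "r \<in> borel_measurable M"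
    and r: "\<And>\<omega>. \<omega> \<in> space M \<Longrightarrow> ennreal (trunc_dist (U \<omega>) (V \<omega>)) \<le> r \<omega>" and e: "(\<integral>\<^sup>+\<omega>. r \<omega> \<partial>M) \<le> ennreal e" "0 \<le> e"
  shows "\<bar>(LINT \<omega>|M. H (U \<omega>)) - (LINT \<omega>|M. H (V \<omega>))\<bar> \<le> L * e"
proof -
  interpret prob_space M by fact
  have L: "0 \<le> L" using H by (simp add: trunc_lipschitz_def)
  have I: "integrable M (\<lambda>\<omega>. H (U \<omega>))" "integrable M (\<lambda>\<omega>. H (V \<omega>))"
    by (rule integrable_const_bound[where B="\<bar>H (\<lambda>_. 0)\<bar> + L"]; use trunc_lipschitz_bounded[OF H] m in auto)+
  have "ennreal \<bar>(LINT \<omega>|M. H (U \<omega>)) - (LINT \<omega>|M. H (V \<omega>))\<bar> = ennreal (norm (LINT \<omega>|M. H (U \<omega>) - H (V \<omega>)))"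
    using I by simp
  also have "\<dots> \<le> (\<integral>\<^sup>+\<omega>. ennreal (norm (H (U \<omega>) - H (V \<omega>))) \<partial>M)"
    by (rule integral_norm_bound_ennreal) (use I in auto)
  also have "\<dots> \<le> (\<integral>\<^sup>+\<omega>. ennreal L * r \<omega> \<partial>M)"
  proof (rule nn_integral_mono)
    fix \<omega> assume w: "\<omega> \<in> space M"
    have "ennreal (norm (H (U \<omega>) - H (V \<omega>))) \<le> ennreal (L * trunc_dist (U \<omega>) (V \<omega>))"
      using H unfolding trunc_lipschitz_def by (intro ennreal_leI) auto
    also have "\<dots> = ennreal L * ennreal (trunc_dist (U \<omega>) (V \<omega>))" by (rule ennreal_mult[OF L trunc_dist_nonneg])
    also have "\<dots> \<le> ennreal L * r \<omega>" by (intro mult_left_mono r w) auto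
    finally show "ennreal (norm (H (U \<omega>) - H (V \<omega>))) \<le> ennreal L * r \<omega>" .
  qed
  also have "\<dots> = ennreal L * (\<integral>\<^sup>+\<omega>. r \<omega> \<partial>M)" using m(3) by (rule nn_integral_cmult)
  also have "\<dots> \<le> ennreal L * ennreal e" by (intro mult_left_mono e) auto
  also have "\<dots> = ennreal (L * e)" by (rule ennreal_mult[OF L e(2), symmetric])
  finally show ?thesis using L e(2) by (subst (asm) ennreal_le_iff) auto
qed

text \<open>\<open>F\<close> first replaces \<open>z\<close> by the step function \<open>x \<mapsto> step_integral z (S (P x))\<close> and then applies \<open>H\<close>. It depends on
finitely many values of \<open>z\<close>, with a Lipschitz bound, hence it is continuous and bounded on the space of
continuous functions and the assumed convergence in law applies to it.\<close>

lemma step_map_converges: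
  assumes M: "prob_space M" and N: "prob_space N" and conv: "converges_in_law_C M Z N B" and H: "trunc_lipschitz L H"
    and J: "finite J" "\<And>x. x \<in> unit_square \<Longrightarrow> P x \<in> J" and S: "\<And>q. q \<in> J \<Longrightarrow> valid_step (S q)"
  defines "F \<equiv> \<lambda>z. H (\<lambda>x. step_integral z (S (P x)))"
  shows "(\<lambda>\<omega>. F (Z n \<omega>)) \<in> borel_measurable M" "(\<lambda>\<omega>. F (B \<omega>)) \<in> borel_measurable N"
    "(\<lambda>n. LINT \<omega>|M. F (Z n \<omega>)) \<longlonglongrightarrow> (LINT \<omega>|N. F (B \<omega>))"
proof -
  have L: "0 \<le> L" using H by (simp add: trunc_lipschitz_def)
  have "\<forall>q\<in>J. \<exists>c\<ge>0. \<forall>x\<in>mspace C_square. \<forall>y\<in>mspace C_square. \<bar>step_integral x (S q) - step_integral y (S q)\<bar> \<le> c * mdist C_square x y"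
    using step_integral_continuous[OF S] by blast
  then obtain c where c: "\<And>q. q \<in> J \<Longrightarrow> 0 \<le> c q" "\<And>q x y. q \<in> J \<Longrightarrow> x \<in> mspace C_square \<Longrightarrow> y \<in> mspace C_square \<Longrightarrow>
    \<bar>step_integral x (S q) - step_integral y (S q)\<bar> \<le> c q * mdist C_square x y"
    by metis
  have F: "continuous_map (mtopology_of C_square) euclideanreal F"
  proof (rule continuous_map_lipschitz)
    fix x y assume xy: "x \<in> mspace C_square" "y \<in> mspace C_square"
    have d: "0 \<le> mdist C_square x y" by simp
    have "\<bar>F x - F y\<bar> \<le> L * trunc_dist (\<lambda>p. step_integral x (S (P p))) (\<lambda>p. step_integral y (S (P p)))"
      using H unfolding trunc_lipschitz_def F_def by blast
    also have "\<dots> \<le> L * ((\<Sum>q\<in>J. c q) * mdist C_square x y)"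
    proof (intro mult_left_mono[OF _ L] trunc_dist_le)
      fix p assume p: "p \<in> unit_square"
      have "\<bar>step_integral x (S (P p)) - step_integral y (S (P p))\<bar> \<le> c (P p) * mdist C_square x y"
        by (rule c(2)[OF J(2)[OF p] xy])
      also have "\<dots> \<le> (\<Sum>q\<in>J. c q) * mdist C_square x y"
        using d by (intro mult_right_mono member_le_sum J p c(1)) auto
      finally show "\<bar>step_integral x (S (P p)) - step_integral y (S (P p))\<bar> \<le> (\<Sum>q\<in>J. c q) * mdist C_square x y" .
    qed
    finally show "\<bar>F x - F y\<bar> \<le> (L * (\<Sum>q\<in>J. c q)) * mdist C_square x y" by (simp add: mult.assoc)
  qed
  have tr: "F (trajectory U \<omega>) = F (U \<omega>)" for U :: "'z \<Rightarrow> real \<times> real \<Rightarrow> real" and \<omega>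
  proof -
    have "trunc_dist (\<lambda>p. step_integral (trajectory U \<omega>) (S (P p))) (\<lambda>p. step_integral (U \<omega>) (S (P p))) \<le> 0"
      by (rule trunc_dist_le) (use step_integral_restrict[OF S[OF J(2)]] in simp)
    then have "trunc_dist (\<lambda>p. step_integral (trajectory U \<omega>) (S (P p))) (\<lambda>p. step_integral (U \<omega>) (S (P p))) = 0"
      using trunc_dist_nonneg by (rule antisym)
    moreover have "\<bar>F (trajectory U \<omega>) - F (U \<omega>)\<bar> \<le>
      L * trunc_dist (\<lambda>p. step_integral (trajectory U \<omega>) (S (P p))) (\<lambda>p. step_integral (U \<omega>) (S (P p)))"
      using H unfolding trunc_lipschitz_def F_def by blast
    ultimately show ?thesis by simp
  qed
  have Zm: "trajectory (Z n) \<in> M \<rightarrow>\<^sub>M borel_C" for n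
    using conv unfolding converges_in_law_C_def by auto
  have Bm: "trajectory B \<in> N \<rightarrow>\<^sub>M borel_C"
    using conv unfolding converges_in_law_C_def by auto
  note Fb = continuous_map_borel_C[OF F]
  have trZ: "F (trajectory (Z n) \<omega>) = F (Z n \<omega>)" for n \<omega>
    using tr[of "\<lambda>_. Z n \<omega>"] by (simp add: trajectory_def)
  have trB: "F (trajectory B \<omega>) = F (B \<omega>)" for \<omega>
    using tr[of "\<lambda>_. B \<omega>"] by (simp add: trajectory_def)
  show "(\<lambda>\<omega>. F (Z n \<omega>)) \<in> borel_measurable M" using measurable_compose[OF Zm Fb, of n] by (simp add: trZ)
  show "(\<lambda>\<omega>. F (B \<omega>)) \<in> borel_measurable N" using measurable_compose[OF Bm Fb] by (simp add: trB)
  have "bounded (F ` mspace C_square)"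
    unfolding bounded_iff F_def using trunc_lipschitz_bounded[OF H] by (intro exI[of _ "\<bar>H (\<lambda>_. 0)\<bar> + L"]) auto
  then have "(\<lambda>n. LINT x|law_C M (Z n). F x) \<longlonglongrightarrow> (LINT x|law_C N B. F x)"
    using conv F unfolding converges_in_law_C_def weak_conv_C_def by blast
  moreover have "(LINT x|law_C M (Z n). F x) = (LINT \<omega>|M. F (Z n \<omega>))" for n
    unfolding law_C_def by (subst integral_distr[OF Zm Fb]) (simp add: trZ)
  moreover have "(LINT x|law_C N B. F x) = (LINT \<omega>|N. F (B \<omega>))"
    unfolding law_C_def by (subst integral_distr[OF Bm Fb]) (simp add: trB)
  ultimately show "(\<lambda>n. LINT \<omega>|M. F (Z n \<omega>)) \<longlonglongrightarrow> (LINT \<omega>|N. F (B \<omega>))" by simp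
qed

text \<open>The expectation of \<open>H (X n)\<close> reaches that of \<open>H W\<close> in five steps:
\<open>X n\<close>, \<open>X n \<circ> P k\<close>, the step map of \<open>Z n\<close>, the step map of \<open>B\<close>, \<open>W \<circ> P k\<close>, \<open>W\<close>. Only the middle step needs large
\<open>n\<close>. The mesh level \<open>k\<close> is chosen first, then the accuracy of the step functions, which depends on the number of mesh
points, and \<open>n\<close> last. For \<open>W\<close>, continuity of its trajectories and dominated convergence replace
the chaining estimate.\<close>

theorem convergence_by_step_maps:
  assumes M: "prob_space M" and N: "prob_space N" and P: "mesh P"
    and zeta: "converges_in_law_C M Z N B"
    and Xm: "\<And>n q. q \<in> unit_square \<Longrightarrow> (\<lambda>\<omega>. X n \<omega> q) \<in> borel_measurable M"
    and Xc: "\<And>n \<omega>. \<omega> \<in> space M \<Longrightarrow> continuous_on unit_square (X n \<omega>)"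
    and Wm: "\<And>q. q \<in> unit_square \<Longrightarrow> (\<lambda>\<omega>. W \<omega> q) \<in> borel_measurable N"
    and Wc: "\<And>\<omega>. \<omega> \<in> space N \<Longrightarrow> continuous_on unit_square (W \<omega>)"
    and e: "e \<longlonglongrightarrow> (0::real)" "\<And>k. 0 \<le> e k" and Rm: "\<And>n k. R n k \<in> borel_measurable M"
    and R: "\<And>n k \<omega> p. \<omega> \<in> space M \<Longrightarrow> p \<in> unit_square \<Longrightarrow> ennreal \<bar>X n \<omega> p - X n \<omega> (P k p)\<bar> \<le> R n k \<omega>"
    and Re: "\<And>n k. (\<integral>\<^sup>+\<omega>. R n k \<omega> \<partial>M) \<le> ennreal (e k)"
    and fdd: "\<And>q \<epsilon>. q \<in> unit_square \<Longrightarrow> \<epsilon> > 0 \<Longrightarrow> \<exists>S. valid_step S \<and>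
      (\<forall>n. (\<integral>\<^sup>+\<omega>. ennreal \<bar>X n \<omega> q - step_integral (Z n \<omega>) S\<bar> \<partial>M) \<le> ennreal \<epsilon>) \<and>
      (\<integral>\<^sup>+\<omega>. ennreal \<bar>W \<omega> q - step_integral (B \<omega>) S\<bar> \<partial>N) \<le> ennreal \<epsilon>"
  shows "converges_in_law_C M X N W"
proof (rule converges_in_law_lipschitz[OF M N])
  interpret M: prob_space M by fact
  interpret N: prob_space N by fact
  show Xt: "trajectory (X n) \<in> M \<rightarrow>\<^sub>M borel_C" for n by (rule trajectory_measurable[OF P Xc Xm])
  show Wt: "trajectory W \<in> N \<rightarrow>\<^sub>M borel_C" by (rule trajectory_measurable[OF P Wc Wm])
  have Zt: "trajectory (Z n) \<in> M \<rightarrow>\<^sub>M borel_C" for n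
    using zeta unfolding converges_in_law_C_def by auto
  have Bt: "trajectory B \<in> N \<rightarrow>\<^sub>M borel_C"
    using zeta unfolding converges_in_law_C_def by auto
  have Pk: "P k ` unit_square \<subseteq> unit_square" "finite (P k ` unit_square)" for k using P unfolding mesh_def by auto
  fix L H assume H: "trunc_lipschitz L H"
  have L: "0 \<le> L" using H by (simp add: trunc_lipschitz_def)
  note fr = finite_rank_measurable[OF H Pk(2,1)]
  have WP: "(\<lambda>k. LINT \<omega>|N. H (W \<omega> \<circ> P k)) \<longlonglongrightarrow> (LINT \<omega>|N. H (W \<omega>))"
  proof (rule integral_dominated_convergence[where w="\<lambda>_. \<bar>H (\<lambda>_. 0)\<bar> + L"])
    show "AE \<omega> in N. (\<lambda>k. H (W \<omega> \<circ> P k)) \<longlonglongrightarrow> H (W \<omega>)"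
      by (rule AE_I2) (rule trunc_lipschitz_mesh_tendsto[OF H P Wc])
    show "(\<lambda>\<omega>. H (W \<omega> \<circ> P k)) \<in> borel_measurable N" for k by (rule fr[OF Wm])
    show "(\<lambda>\<omega>. H (W \<omega>)) \<in> borel_measurable N" by (rule trunc_lipschitz_measurable[OF H Wt])
  qed (use trunc_lipschitz_bounded[OF H] in auto)
  show "(\<lambda>n. LINT \<omega>|M. H (X n \<omega>)) \<longlonglongrightarrow> (LINT \<omega>|N. H (W \<omega>))"
  proof (rule tendstoI)
    fix \<eta> :: real assume eta: "\<eta> > 0"
    have "(\<lambda>k. L * e k) \<longlonglongrightarrow> L * 0" by (intro tendsto_intros e)
    then have "\<forall>\<^sub>F k in sequentially. L * e k < \<eta> / 5" using order_tendstoD(2)[of _ "L * 0" _ "\<eta> / 5"] eta by simp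
    moreover have "\<forall>\<^sub>F k in sequentially. dist (LINT \<omega>|N. H (W \<omega> \<circ> P k)) (LINT \<omega>|N. H (W \<omega>)) < \<eta> / 5"
      using tendstoD[OF WP, of "\<eta> / 5"] eta by simp
    ultimately have "\<forall>\<^sub>F k in sequentially. L * e k < \<eta> / 5 \<and>
        dist (LINT \<omega>|N. H (W \<omega> \<circ> P k)) (LINT \<omega>|N. H (W \<omega>)) < \<eta> / 5" by (rule eventually_conj)
    then obtain k where k: "L * e k < \<eta> / 5" "\<bar>(LINT \<omega>|N. H (W \<omega> \<circ> P k)) - (LINT \<omega>|N. H (W \<omega>))\<bar> < \<eta> / 5"
      by (auto simp: eventually_sequentially dist_real_def)
    define J where "J = P k ` unit_square"
    have J: "finite J" "\<And>x. x \<in> unit_square \<Longrightarrow> P k x \<in> J" "\<And>q. q \<in> J \<Longrightarrow> q \<in> unit_square"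
      using Pk[of k] unfolding J_def by auto
    define \<epsilon> where "\<epsilon> = \<eta> / (5 * (L + 1) * (real (card J) + 1))"
    have eps: "\<epsilon> > 0" using eta L by (simp add: \<epsilon>_def)
    \<comment> \<open>the summand 1 in both factors of \<open>\<epsilon>\<close> covers \<open>L = 0\<close> and keeps the inequality strict\<close>
    have small: "L * (real (card J) * \<epsilon>) < \<eta> / 5"
    proof -
      have "L * (real (card J) * \<epsilon>) \<le> L * ((real (card J) + 1) * \<epsilon>)" using L eps by (intro mult_left_mono mult_right_mono) auto
      also have "\<dots> < (L + 1) * ((real (card J) + 1) * \<epsilon>)" using eps by (intro mult_strict_right_mono) auto
      also have "\<dots> = \<eta> / 5"
      proof -
        have "u * (v * (\<eta> / (5 * u * v))) = \<eta> / 5" if "0 < u" "0 < v" for u v :: real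
          using that by (simp add: field_simps)
        from this[of "L + 1" "real (card J) + 1"] show ?thesis using L unfolding \<epsilon>_def by simp
      qed
      finally show ?thesis .
    qed
    have "\<forall>q\<in>J. \<exists>S. valid_step S \<and>
      (\<forall>n. (\<integral>\<^sup>+\<omega>. ennreal \<bar>X n \<omega> q - step_integral (Z n \<omega>) S\<bar> \<partial>M) \<le> ennreal \<epsilon>) \<and>
      (\<integral>\<^sup>+\<omega>. ennreal \<bar>W \<omega> q - step_integral (B \<omega>) S\<bar> \<partial>N) \<le> ennreal \<epsilon>"
      using fdd[OF J(3) eps] by blast
    from bchoice[OF this] obtain S where SJ: "\<forall>q\<in>J. valid_step (S q) \<and>
      (\<forall>n. (\<integral>\<^sup>+\<omega>. ennreal \<bar>X n \<omega> q - step_integral (Z n \<omega>) (S q)\<bar> \<partial>M) \<le> ennreal \<epsilon>) \<and>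
      (\<integral>\<^sup>+\<omega>. ennreal \<bar>W \<omega> q - step_integral (B \<omega>) (S q)\<bar> \<partial>N) \<le> ennreal \<epsilon>" ..
    have S: "valid_step (S q)"
      "(\<integral>\<^sup>+\<omega>. ennreal \<bar>X n \<omega> q - step_integral (Z n \<omega>) (S q)\<bar> \<partial>M) \<le> ennreal \<epsilon>"
      "(\<integral>\<^sup>+\<omega>. ennreal \<bar>W \<omega> q - step_integral (B \<omega>) (S q)\<bar> \<partial>N) \<le> ennreal \<epsilon>" if "q \<in> J" for q n
      using SJ[rule_format, OF that] by simp_all
    define F where "F z = H (\<lambda>x. step_integral z (S (P k x)))" for z
    note step = step_map_converges[where P="P k" and S=S, OF M N zeta H J(1,2) S(1), folded F_def]
    have fin: "\<bar>(LINT \<omega>|Q. H (U \<omega> \<circ> P k)) - (LINT \<omega>|Q. F (V \<omega>))\<bar> \<le> L * (real (card J) * \<epsilon>)"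
      if Q: "prob_space Q" and Um: "\<And>q. q \<in> unit_square \<Longrightarrow> (\<lambda>\<omega>. U \<omega> q) \<in> borel_measurable Q"
        and Vt: "trajectory V \<in> Q \<rightarrow>\<^sub>M borel_C" and Fm: "(\<lambda>\<omega>. F (V \<omega>)) \<in> borel_measurable Q"
        and b: "\<And>q. q \<in> J \<Longrightarrow> (\<integral>\<^sup>+\<omega>. ennreal \<bar>U \<omega> q - step_integral (V \<omega>) (S q)\<bar> \<partial>Q) \<le> ennreal \<epsilon>"
      for Q :: "'z measure" and U V :: "'z \<Rightarrow> real \<times> real \<Rightarrow> real"
      unfolding F_def
    proof (rule trunc_lipschitz_expectation_diff[OF Q H fr[OF Um] Fm[unfolded F_def]])
      have m: "(\<lambda>\<omega>. ennreal \<bar>U \<omega> q - step_integral (V \<omega>) (S q)\<bar>) \<in> borel_measurable Q" if "q \<in> J" for q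
        using Um[OF J(3)[OF that]] step_integral_measurable[OF Vt S(1)[OF that]] by measurable
      show "(\<lambda>\<omega>. \<Sum>q\<in>J. ennreal \<bar>U \<omega> q - step_integral (V \<omega>) (S q)\<bar>) \<in> borel_measurable Q"
        by (rule borel_measurable_sum) (rule m)
      have "(\<integral>\<^sup>+\<omega>. (\<Sum>q\<in>J. ennreal \<bar>U \<omega> q - step_integral (V \<omega>) (S q)\<bar>) \<partial>Q) =
        (\<Sum>q\<in>J. \<integral>\<^sup>+\<omega>. ennreal \<bar>U \<omega> q - step_integral (V \<omega>) (S q)\<bar> \<partial>Q)"
        by (rule nn_integral_sum) (rule m)
      also have "\<dots> \<le> (\<Sum>q\<in>J. ennreal \<epsilon>)" by (rule sum_mono) (rule b)
      also have "\<dots> = ennreal (real (card J) * \<epsilon>)" using eps by (subst sum_ennreal) auto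
      finally show "(\<integral>\<^sup>+\<omega>. (\<Sum>q\<in>J. ennreal \<bar>U \<omega> q - step_integral (V \<omega>) (S q)\<bar>) \<partial>Q) \<le> ennreal (real (card J) * \<epsilon>)" .
      show "0 \<le> real (card J) * \<epsilon>" using eps by simp
      fix \<omega>
      have "trunc_dist (U \<omega> \<circ> P k) (\<lambda>x. step_integral (V \<omega>) (S (P k x))) \<le> (\<Sum>q\<in>J. \<bar>U \<omega> q - step_integral (V \<omega>) (S q)\<bar>)"
      proof (rule trunc_dist_le)
        fix p assume "p \<in> unit_square"
        from J(2)[OF this]
        show "\<bar>(U \<omega> \<circ> P k) p - step_integral (V \<omega>) (S (P k p))\<bar> \<le> (\<Sum>q\<in>J. \<bar>U \<omega> q - step_integral (V \<omega>) (S q)\<bar>)"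
          using member_le_sum[of "P k p" J "\<lambda>q. \<bar>U \<omega> q - step_integral (V \<omega>) (S q)\<bar>"] J(1) by simp
      qed
      then have "ennreal (trunc_dist (U \<omega> \<circ> P k) (\<lambda>x. step_integral (V \<omega>) (S (P k x)))) \<le>
        ennreal (\<Sum>q\<in>J. \<bar>U \<omega> q - step_integral (V \<omega>) (S q)\<bar>)" by (rule ennreal_leI)
      then show "ennreal (trunc_dist (U \<omega> \<circ> P k) (\<lambda>x. step_integral (V \<omega>) (S (P k x)))) \<le>
        (\<Sum>q\<in>J. ennreal \<bar>U \<omega> q - step_integral (V \<omega>) (S q)\<bar>)" by (simp add: sum_ennreal)
    qed
    have W4: "\<bar>(LINT \<omega>|N. H (W \<omega> \<circ> P k)) - (LINT \<omega>|N. F (B \<omega>))\<bar> \<le> L * (real (card J) * \<epsilon>)"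
      by (rule fin[OF N Wm Bt step(2) S(3)])
    have "\<forall>\<^sub>F n in sequentially. dist (LINT \<omega>|M. F (Z n \<omega>)) (LINT \<omega>|N. F (B \<omega>)) < \<eta> / 5"
      using tendstoD[OF step(3), of "\<eta> / 5"] eta by simp
    then show "\<forall>\<^sub>F n in sequentially. dist (LINT \<omega>|M. H (X n \<omega>)) (LINT \<omega>|N. H (W \<omega>)) < \<eta>"
    proof (rule eventually_mono)
      fix n assume d: "dist (LINT \<omega>|M. F (Z n \<omega>)) (LINT \<omega>|N. F (B \<omega>)) < \<eta> / 5"
      have X1: "\<bar>(LINT \<omega>|M. H (X n \<omega>)) - (LINT \<omega>|M. H (X n \<omega> \<circ> P k))\<bar> \<le> L * e k"
      proof (rule trunc_lipschitz_expectation_diff[OF M H trunc_lipschitz_measurable[OF H Xt] fr[OF Xm] Rm _ Re e(2)])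
        fix \<omega> assume w: "\<omega> \<in> space M"
        show "ennreal (trunc_dist (X n \<omega>) (X n \<omega> \<circ> P k)) \<le> R n k \<omega>"
        proof (cases "R n k \<omega>")
          case (real r)
          have "trunc_dist (X n \<omega>) (X n \<omega> \<circ> P k) \<le> r"
            by (rule trunc_dist_le) (use R[OF w, of _ n k] real in \<open>simp add: ennreal_le_iff del: mem_Sigma_iff\<close>)
          then show ?thesis using real by (simp add: ennreal_leI)
        qed simp
      qed
      have X2: "\<bar>(LINT \<omega>|M. H (X n \<omega> \<circ> P k)) - (LINT \<omega>|M. F (Z n \<omega>))\<bar> \<le> L * (real (card J) * \<epsilon>)"
        by (rule fin[OF M Xm Zt step(1) S(2)])
      show "dist (LINT \<omega>|M. H (X n \<omega>)) (LINT \<omega>|N. H (W \<omega>)) < \<eta>"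
        using X1 X2 W4 d k small unfolding dist_real_def by linarith
    qed
  qed
qed

section \<open>The limit theorem\<close>

text \<open>The two sets of hypotheses meet here: they differ only in the moment bound on rectangular increments, which is
an assumption of this theorem. The exponents \<open>b1\<close>, \<open>b2\<close> of the kernels enter through the continuity of the trajectories.\<close>

theorem convergence_of_rect_moment:
  assumes M: "prob_space M" and N: "prob_space N" and \<theta>: "random_kernels M \<theta>"
    and B: "brownian_sheet N B" and W: "continuous_version_W N B K1 K2 W"
    and H2: "H2 M \<theta> N B" and H3: "H3 M \<theta>"
    and K1: "regular_kernel K1 G1 b1" and K2: "regular_kernel K2 G2 b2"
    and m: "even m" "0 < m" and a: "1 < a1" "1 < a2" and C: "0 \<le> C"
    and mom: "\<And>n. rect_moment M (X_proc K1 K2 \<theta> n) m G1 a1 G2 a2 C"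
  shows "converges_in_law_C M (X_proc K1 K2 \<theta>) N W"
proof -
  interpret M: prob_space M by fact
  interpret N: prob_space N by fact
  interpret K1: regular_kernel K1 G1 b1 by fact
  interpret K2: regular_kernel K2 G2 b2 by fact
  have Xk: "X_proc K1 K2 \<theta> n \<omega> p = kernel_form (\<theta> n \<omega>) (K1 (fst p)) (K2 (snd p))" if w: "\<omega> \<in> space M" and p: "p \<in> unit_square" for n \<omega> p
  proof -
    obtain c where h: "bounded_kernel (\<theta> n \<omega>) c" using random_kernel_bounded[OF \<theta> w] by blast
    have "fst p \<in> {0..1}" "snd p \<in> {0..1}" using p by auto
    then show ?thesis
      using X_proc_kernel_form[where \<theta>=\<theta> and n=n and \<omega>=\<omega> and ?K1.0=K1 and ?K2.0=K2, OF h K1.kernel_integrable01 K2.kernel_integrable01, of "fst p" "snd p"] by simp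
  qed
  have Xm: "(\<lambda>\<omega>. X_proc K1 K2 \<theta> n \<omega> q) \<in> borel_measurable M" if q: "q \<in> unit_square" for n q
  proof -
    have "fst q \<in> {0..1}" "snd q \<in> {0..1}" using q by auto
    from kernel_form_measurable[OF \<theta> K1.kernel_integrable01[OF this(1)] K2.kernel_integrable01[OF this(2)], of n]
    show ?thesis by (rule measurable_cong[THEN iffD2, rotated]) (rule Xk[OF _ q])
  qed
  have Xc: "continuous_on unit_square (X_proc K1 K2 \<theta> n \<omega>)" if w: "\<omega> \<in> space M" for n \<omega>
  proof -
    obtain c where h: "bounded_kernel (\<theta> n \<omega>) c" using random_kernel_bounded[OF \<theta> w] by blast
    from kernel_form_continuous[OF h K1 K2] show ?thesis
      by (rule continuous_on_cong[THEN iffD2, rotated 2]) (use Xk[OF w] in auto)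
  qed
  have X0: "null_on_axes (X_proc K1 K2 \<theta> n \<omega>)" if w: "\<omega> \<in> space M" for n \<omega>
    unfolding null_on_axes_def
  proof
    fix u :: real assume u: "u \<in> {0..1}"
    obtain c where h: "bounded_kernel (\<theta> n \<omega>) c" using random_kernel_bounded[OF \<theta> w] by blast
    have z: "0 \<in> {0..1::real}" by simp
    have "\<bar>kernel_form (\<theta> n \<omega>) (K1 0) (K2 u)\<bar> \<le> 0" "\<bar>kernel_form (\<theta> n \<omega>) (K1 u) (K2 0)\<bar> \<le> 0"
      using kernel_form_integrable(2)[OF h K1.kernel_integrable01[OF z] K2.kernel_integrable01[OF u]] kernel_form_integrable(2)[OF h K1.kernel_integrable01[OF u] K2.kernel_integrable01[OF z]]
      by (simp_all add: K1.norm1_zero K2.norm1_zero)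
    then show "X_proc K1 K2 \<theta> n \<omega> (0, u) = 0 \<and> X_proc K1 K2 \<theta> n \<omega> (u, 0) = 0"
      using Xk[OF w, of "(0, u)" n] Xk[OF w, of "(u, 0)" n] u by simp
  qed
  have G: "mono_on {0..1} G1" "continuous_on {0..1} G1" "mono_on {0..1} G2" "continuous_on {0..1} G2"
    using K1.incr K2.incr unfolding increment_bound_def by auto
  obtain P R e where P: "mesh P" and e: "e \<longlonglongrightarrow> (0::real)" "\<And>k. 0 \<le> e k" and Rm: "\<And>n k. R n k \<in> borel_measurable M"
    and R: "\<And>n k \<omega> p. \<omega> \<in> space M \<Longrightarrow> p \<in> unit_square \<Longrightarrow> ennreal \<bar>X_proc K1 K2 \<theta> n \<omega> p - X_proc K1 K2 \<theta> n \<omega> (P k p)\<bar> \<le> R n k \<omega>"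
    and Re: "\<And>n k. (\<integral>\<^sup>+\<omega>. R n k \<omega> \<partial>M) \<le> ennreal (e k)"
    by (rule equicontinuity_of_rect_moment[where X="X_proc K1 K2 \<theta>", OF G a C m M Xm Xc X0 mom]) blast+
  have Wwi: "is_wiener_integral N B (\<lambda>(u, v). K1 s u * K2 t v) (\<lambda>\<omega>. W \<omega> (s, t))" if "s \<in> {0..1}" "t \<in> {0..1}" for s t
    using W that unfolding continuous_version_W_def by blast
  have Wm: "(\<lambda>\<omega>. W \<omega> q) \<in> borel_measurable N" if "q \<in> unit_square" for q
    using Wwi[of "fst q" "snd q"] that unfolding is_wiener_integral_def by auto
  have Wc: "continuous_on unit_square (W \<omega>)" if "\<omega> \<in> space N" for \<omega>
    using W that unfolding continuous_version_W_def by blast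
  have zeta: "converges_in_law_C M (zeta_proc \<theta>) N B" using H2 unfolding H2_def .
  have Zt: "trajectory (zeta_proc \<theta> n) \<in> M \<rightarrow>\<^sub>M borel_C" for n
    using zeta unfolding converges_in_law_C_def by auto
  have Bt: "trajectory B \<in> N \<rightarrow>\<^sub>M borel_C"
    using zeta unfolding converges_in_law_C_def by auto
  obtain D where D: "0 \<le> D" "\<And>n s t T U. in_L2 (K1 s) \<Longrightarrow> in_L2 (K2 t) \<Longrightarrow> valid_step1 T \<Longrightarrow> valid_step1 U \<Longrightarrow>
    (\<integral>\<^sup>+\<omega>. ennreal ((X_proc K1 K2 \<theta> n \<omega> (s, t) - step_integral (zeta_proc \<theta> n \<omega>) (tensor_step T U))\<^sup>2) \<partial>M)
      \<le> ennreal (D * tensor_err (K1 s) (K2 t) T U)"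
    by (rule X_proc_step_approx[OF \<theta> H3, of K1 K2]) blast
  have fdd: "\<exists>S. valid_step S \<and>
      (\<forall>n. (\<integral>\<^sup>+\<omega>. ennreal \<bar>X_proc K1 K2 \<theta> n \<omega> q - step_integral (zeta_proc \<theta> n \<omega>) S\<bar> \<partial>M) \<le> ennreal \<epsilon>) \<and>
      (\<integral>\<^sup>+\<omega>. ennreal \<bar>W \<omega> q - step_integral (B \<omega>) S\<bar> \<partial>N) \<le> ennreal \<epsilon>" if q: "q \<in> unit_square" and eps: "\<epsilon> > 0" for q \<epsilon>
  proof -
    obtain s t where st: "q = (s, t)" "s \<in> {0..1}" "t \<in> {0..1}" using q by (cases q) auto
    note L = K1.kernel_in_L2[OF st(2)] K2.kernel_in_L2[OF st(3)]
    obtain S where S: "\<And>k. valid_step (S k)" "(\<lambda>k. sqdist (\<lambda>p. K1 s (fst p) * K2 t (snd p)) (step_fun (S k))) \<longlonglongrightarrow> 0"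
      using Wwi[OF st(2,3)] unfolding is_wiener_integral_def sqdist_def case_prod_beta' by auto
    \<comment> \<open>\<open>D\<close> and \<open>8\<close> are the constants of the two mean square errors in terms of \<open>tensor_err\<close>\<close>
    define d where "d = (\<epsilon> / 2)\<^sup>2 / (D + 8)"
    have d: "d > 0" using eps D(1) by (simp add: d_def)
    obtain T U where TU: "valid_step1 T" "valid_step1 U" "tensor_err (K1 s) (K2 t) T U < d"
      by (rule tensor_step_approx[OF L S d])
    have v: "valid_step (tensor_step T U)" by (rule valid_tensor_step[OF TU(1,2)])
    have le: "c * tensor_err (K1 s) (K2 t) T U \<le> (\<epsilon> / 2)\<^sup>2" if "0 \<le> c" "c \<le> D + 8" for c
    proof -
      have "c * tensor_err (K1 s) (K2 t) T U \<le> c * d" using TU that by (intro mult_left_mono) auto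
      also have "\<dots> \<le> (D + 8) * d" using that d by (intro mult_right_mono) auto
      also have "\<dots> = (\<epsilon> / 2)\<^sup>2" using D(1) by (simp add: d_def)
      finally show ?thesis .
    qed
    have "(\<integral>\<^sup>+\<omega>. ennreal \<bar>X_proc K1 K2 \<theta> n \<omega> q - step_integral (zeta_proc \<theta> n \<omega>) (tensor_step T U)\<bar> \<partial>M) \<le> ennreal (2 * (\<epsilon> / 2))" for n
    proof (rule nn_integral_abs_le[OF M])
      show "(\<lambda>\<omega>. X_proc K1 K2 \<theta> n \<omega> q - step_integral (zeta_proc \<theta> n \<omega>) (tensor_step T U)) \<in> borel_measurable M"
        by (intro borel_measurable_diff Xm q step_integral_measurable[OF Zt v])
      show "(\<integral>\<^sup>+\<omega>. ennreal ((X_proc K1 K2 \<theta> n \<omega> q - step_integral (zeta_proc \<theta> n \<omega>) (tensor_step T U))\<^sup>2) \<partial>M) \<le> ennreal ((\<epsilon> / 2)\<^sup>2)"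
        unfolding st(1) by (rule order_trans[OF D(2)[of s t T U n, OF L TU(1,2)] ennreal_leI[OF le]]) (use D(1) in auto)
    qed (use eps in simp)
    moreover have "(\<integral>\<^sup>+\<omega>. ennreal \<bar>W \<omega> q - step_integral (B \<omega>) (tensor_step T U)\<bar> \<partial>N) \<le> ennreal (2 * (\<epsilon> / 2))"
    proof (rule nn_integral_abs_le[OF N])
      show "(\<lambda>\<omega>. W \<omega> q - step_integral (B \<omega>) (tensor_step T U)) \<in> borel_measurable N"
        by (intro borel_measurable_diff Wm q step_integral_measurable[OF Bt v])
      show "(\<integral>\<^sup>+\<omega>. ennreal ((W \<omega> q - step_integral (B \<omega>) (tensor_step T U))\<^sup>2) \<partial>N) \<le> ennreal ((\<epsilon> / 2)\<^sup>2)"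
        unfolding st(1)
        by (rule order_trans[OF wiener_integral_step_approx[OF B Wwi[OF st(2,3)] L TU(1,2)] ennreal_leI[OF le]]) (use D(1) in auto)
    qed (use eps in simp)
    ultimately show ?thesis using v by (intro exI[of _ "tensor_step T U"]) simp
  qed
  show ?thesis
    by (rule convergence_by_step_maps[where Z="zeta_proc \<theta>" and B=B and R=R and e=e, OF M N P zeta Xm Xc Wm Wc e Rm R Re fdd])
qed

theorem theorem3p1:
  fixes M :: "'a measure" and N :: "'b measure"
    and K1 K2 :: "real \<Rightarrow> real \<Rightarrow> real"
    and \<theta> :: "nat \<Rightarrow> 'a \<Rightarrow> real \<Rightarrow> real \<Rightarrow> real"
    and B W :: "'b \<Rightarrow> real \<times> real \<Rightarrow> real"
  assumes "prob_space M" and "prob_space N"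
    and "random_kernels M \<theta>"
    and "brownian_sheet N B"
    and "continuous_version_W N B K1 K2 W"
    and "(H1 K1 \<and> H1 K2 \<and> H2 M \<theta> N B \<and> H3 M \<theta>) \<or>
         (\<exists>G1 G2 \<rho>1 \<rho>2 M1 M2 \<beta>1 \<beta>2.
            H1' K1 G1 \<rho>1 M1 \<beta>1 \<and> H1' K2 G2 \<rho>2 M2 \<beta>2 \<and>
            H2 M \<theta> N B \<and> H3 M \<theta> \<and> H4 M \<theta> K1 K2 G1 G2 \<rho>1 \<rho>2)"
  shows "converges_in_law_C M (X_proc K1 K2 \<theta>) N W"
  using assms(6)
proof
  assume J1: "H1 K1 \<and> H1 K2 \<and> H2 M \<theta> N B \<and> H3 M \<theta>"
  then obtain G1 a1 G2 a2 where a: "1 < a1" "1 < a2"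
    and K: "kernel_basic K1" "increment_bound K1 G1 a1" "kernel_basic K2" "increment_bound K2 G2 a2"
    unfolding H1_def by blast
  have K1: "regular_kernel K1 G1 a1" and K2: "regular_kernel K2 G2 a2"
    using K a by (auto intro: regular_kernel.intro)
  obtain C where "0 \<le> C" "\<And>n. rect_moment M (X_proc K1 K2 \<theta> n) 2 G1 a1 G2 a2 C"
    using rect_moment_of_H3[OF assms(3) _ K1 K2] J1 by blast
  then show ?thesis
    using convergence_of_rect_moment[OF assms(1-5) _ _ K1 K2 _ _ a, of 2 C] J1 by simp
next
  assume "\<exists>G1 G2 \<rho>1 \<rho>2 M1 M2 \<beta>1 \<beta>2.
            H1' K1 G1 \<rho>1 M1 \<beta>1 \<and> H1' K2 G2 \<rho>2 M2 \<beta>2 \<and>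
            H2 M \<theta> N B \<and> H3 M \<theta> \<and> H4 M \<theta> K1 K2 G1 G2 \<rho>1 \<rho>2"
  then obtain G1 G2 \<rho>1 \<rho>2 M1 M2 \<beta>1 \<beta>2 where J2: "H1' K1 G1 \<rho>1 M1 \<beta>1" "H1' K2 G2 \<rho>2 M2 \<beta>2"
    "H2 M \<theta> N B" "H3 M \<theta>" "H4 M \<theta> K1 K2 G1 G2 \<rho>1 \<rho>2" by blast
  have K1: "regular_kernel K1 G1 \<rho>1" and K2: "regular_kernel K2 G2 \<rho>2"
    using J2(1,2) unfolding H1'_def by (auto intro: regular_kernel.intro)
  obtain m C where m: "even m" "0 < m" and a: "1 < real m * \<rho>1 / 4" "1 < real m * \<rho>2 / 4" and C: "0 \<le> C"
    and mom: "\<And>n. rect_moment M (X_proc K1 K2 \<theta> n) m G1 (real m * \<rho>1 / 4) G2 (real m * \<rho>2 / 4) C"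
    using rect_moment_of_H4[OF assms(3) J2(5) K1 K2] by blast
  show ?thesis
    by (rule convergence_of_rect_moment[OF assms(1-5) J2(3,4) K1 K2 m a C mom])
qed

end
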